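(* Let $\lambda(u)=(\lambda_1(u),\lambda_2(u))$ be a restricted tuple. The irreducible $Y^{[p]}$-module $L^{[p]}(\lambda_1(u),\lambda_2(u))$ is finite dimensional if and only if there exist monic polynomials $P_1(u),P_2(u)\in k[u]$ of the same degree and with no common roots such that $\frac{\lambda_1(u)}{\lambda_2(u)}=\frac{P_1(u)}{P_2(u)}$.
   Context: Let $k$ be an algebraically closed field of characteristic $p>2$, parities $|1|=0$, $|2|=1$. $Y=Y_{1|1}$ is the superalgebra over $k$ with generators $t_{i,j}^{(r)}$ ($1\le i,j\le2$, $r>0$, parity $|i|+|j|$) and relations $[t_{i,j}^{(r)},t_{k,l}^{(s)}]=(-1)^{|i||j|+|i||k|+|j||k|}\sum_{t=0}^{\min(r,s)-1}(t_{k,j}^{(t)}t_{i,l}^{(r+s-1-t)}-t_{k,j}^{(r+s-1-t)}t_{i,l}^{(t)})$, $t_{i,j}^{(0)}=\delta_{ij}$; $t_{i,j}(u)=\sum_{r\ge0}t_{i,j}^{(r)}u^{-r}$. Drinfeld generators $d_i^{(r)},e^{(r)},f^{(r)}$ are the coefficients of $d_i(u)$, $e(u)$, $f(u)$ defined by $t_{1,1}=d_1$, $t_{1,2}=d_1e$, $t_{2,1}=fd_1$, $t_{2,2}=fd_1e+d_2$. With $b_1(u)=d_1(u)\cdots d_1(u-p+1)$, $b_2(u)=d_2(u)^{-1}\cdots d_2(u-p+1)^{-1}$, the restricted super Yangian $Y^{[p]}$ is $Y$ modulo the ideal generated by the central elements $b_i^{(rp)}$ ($i=1,2$, $r>0$).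 A series $g(u)\in k[[u^{-1}]]$ is restricted if $g(u)g(u-1)\cdots g(u-p+1)=1$; a tuple $(\lambda_1(u),\lambda_2(u))$, $\lambda_i(u)=1+\sum_{r\ge1}\lambda_i^{(r)}u^{-r}$, is restricted if both entries are. The baby Verma module $Z^{[p]}(\lambda(u))$ is $Y^{[p]}$ modulo the left ideal generated by all $e^{(r)}$ and $d_i^{(r)}-\lambda_i^{(r)}$ ($i=1,2$, $r>0$); it has a unique simple quotient $L^{[p]}(\lambda(u))$. *)

theory Defs
  imports "HOL-Library.Poly_Mapping" "HOL-Computational_Algebra.Polynomial"
begin

datatype idx = I1 | I2

definition par :: "idx \<Rightarrow> nat" where
  "par i = (case i of I1 \<Rightarrow> 0 | I2 \<Rightarrow> 1)"

text \<open>Generator T i j n stands for t_{i,j}^{(n+1)}; so only r > 0 are generators.\<close>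
datatype gen = T idx idx nat

definition gpar :: "gen \<Rightarrow> nat" where
  "gpar g = (case g of T i j n \<Rightarrow> (par i + par j) mod 2)"

datatype word = Word "gen list"

instantiation word :: monoid_add
begin
definition zero_word :: word where "zero_word = Word []"
fun plus_word :: "word \<Rightarrow> word \<Rightarrow> word" where
  "plus_word (Word a) (Word b) = Word (a @ b)"
instance
proof
  fix a b c :: word
  show "a + b + c = a + (b + c)" by (cases a; cases b; cases c) simp
  show "0 + a = a" by (cases a) (simp add: zero_word_def)
  show "a + 0 = a" by (cases a) (simp add: zero_word_def)
qed
end

definition wpar :: "word \<Rightarrow> nat" where
  "wpar w = (case w of Word gs \<Rightarrow> (\<Sum>g\<leftarrow>gs. gpar g) mod 2)"

text \<open>The free associative k-algebra on the generators: finitely supported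
  k-linear combinations of words, with convolution product.\<close>
type_synonym 'k free = "word \<Rightarrow>\<^sub>0 'k"

definition scal :: "'k::ring_1 \<Rightarrow> 'k free" where
  "scal c = Poly_Mapping.single 0 c"

definition tt :: "idx \<Rightarrow> idx \<Rightarrow> nat \<Rightarrow> 'k::ring_1 free" where
  "tt i j r = (if r = 0 then (if i = j then 1 else 0)
               else Poly_Mapping.single (Word [T i j (r - 1)]) 1)"

text \<open>Defining relations of Y_{1|1} (left minus right side, super commutator on the left).\<close>
definition rtt_rel :: "idx \<Rightarrow> idx \<Rightarrow> idx \<Rightarrow> idx \<Rightarrow> nat \<Rightarrow> nat \<Rightarrow> 'k::ring_1 free" where
  "rtt_rel i j k l r s =
     (tt i j r * tt k l s
      - (-1) ^ ((par i + par j) * (par k + par l)) * tt k l s * tt i j r)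
     - (-1) ^ (par i * par j + par i * par k + par j * par k) *
       (\<Sum>t<min r s. tt k j t * tt i l (r + s - 1 - t) - tt k j (r + s - 1 - t) * tt i l t)"

section \<open>Power series in u^{-1} (coefficient n is the coefficient of u^{-n})\<close>

definition smul :: "(nat \<Rightarrow> 'a::ring_1) \<Rightarrow> (nat \<Rightarrow> 'a) \<Rightarrow> nat \<Rightarrow> 'a" where
  "smul A B n = (\<Sum>m\<le>n. A m * B (n - m))"

text \<open>Inverse of a series with constant term 1.\<close>
function sinv :: "(nat \<Rightarrow> 'a::ring_1) \<Rightarrow> nat \<Rightarrow> 'a" where
  "sinv A n = (if n = 0 then 1 else - (\<Sum>m\<in>{1..n}. A m * sinv A (n - m)))"
  by auto
termination
  by (relation "measure snd") auto

text \<open>Shift: the series A(u - c) for A(u) = sum A_r u^{-r}, using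
  (u-c)^{-r} = sum_m binom(r+m-1, m) c^m u^{-r-m}.\<close>
definition sshift :: "'a::ring_1 \<Rightarrow> (nat \<Rightarrow> 'a) \<Rightarrow> nat \<Rightarrow> 'a" where
  "sshift c A n = (if n = 0 then A 0
     else (\<Sum>r\<in>{1..n}. of_nat ((n - 1) choose (n - r)) * c ^ (n - r) * A r))"

definition sprod_shift :: "nat \<Rightarrow> (nat \<Rightarrow> 'a::ring_1) \<Rightarrow> nat \<Rightarrow> 'a" where
  "sprod_shift p A = foldr (\<lambda>j B. smul (sshift (of_nat j) A) B) [0..<p] (\<lambda>n. if n = 0 then 1 else 0)"

section \<open>Drinfeld generators (Gauss decomposition)\<close>

definition tser :: "idx \<Rightarrow> idx \<Rightarrow> nat \<Rightarrow> 'k::ring_1 free" where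
  "tser i j = tt i j"

definition dser1 :: "nat \<Rightarrow> 'k::ring_1 free" where
  "dser1 = tser I1 I1"

definition eser :: "nat \<Rightarrow> 'k::ring_1 free" where
  "eser = smul (sinv dser1) (tser I1 I2)"

definition fser :: "nat \<Rightarrow> 'k::ring_1 free" where
  "fser = smul (tser I2 I1) (sinv dser1)"

definition dser2 :: "nat \<Rightarrow> 'k::ring_1 free" where
  "dser2 = (\<lambda>n. tser I2 I2 n - smul (smul fser dser1) eser n)"

definition bser1 :: "nat \<Rightarrow> nat \<Rightarrow> 'k::ring_1 free" where
  "bser1 p = sprod_shift p dser1"

definition bser2 :: "nat \<Rightarrow> nat \<Rightarrow> 'k::ring_1 free" where
  "bser2 p = sprod_shift p (sinv dser2)"

inductive_set two_sided_ideal :: "'a::ring set \<Rightarrow> 'a set" for R where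
  gen: "x \<in> R \<Longrightarrow> x \<in> two_sided_ideal R"
| zero: "0 \<in> two_sided_ideal R"
| add: "x \<in> two_sided_ideal R \<Longrightarrow> y \<in> two_sided_ideal R \<Longrightarrow> x + y \<in> two_sided_ideal R"
| mult: "x \<in> two_sided_ideal R \<Longrightarrow> a * x * b \<in> two_sided_ideal R"

inductive_set left_ideal_gen :: "'a::ring set \<Rightarrow> 'a set" for S where
  gen: "x \<in> S \<Longrightarrow> x \<in> left_ideal_gen S"
| zero: "0 \<in> left_ideal_gen S"
| add: "x \<in> left_ideal_gen S \<Longrightarrow> y \<in> left_ideal_gen S \<Longrightarrow> x + y \<in> left_ideal_gen S"
| mult: "x \<in> left_ideal_gen S \<Longrightarrow> a * x \<in> left_ideal_gen S"

definition is_left_ideal :: "'a::ring set \<Rightarrow> bool" where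
  "is_left_ideal N \<longleftrightarrow> 0 \<in> N \<and> (\<forall>x\<in>N. \<forall>y\<in>N. x + y \<in> N) \<and> (\<forall>a. \<forall>x\<in>N. a * x \<in> N)"

definition graded :: "'k::ring_1 free set \<Rightarrow> bool" where
  "graded N \<longleftrightarrow> (\<forall>x\<in>N. Abs_poly_mapping (\<lambda>w. if wpar w = 0 then Poly_Mapping.lookup x w else 0) \<in> N)"

definition restricted_rels :: "nat \<Rightarrow> 'k::ring_1 free set" where
  "restricted_rels p =
     {rtt_rel i j k l r s | i j k l r s. r > 0 \<and> s > 0}
     \<union> {bser1 p (r * p) | r. r > 0} \<union> {bser2 p (r * p) | r. r > 0}"

text \<open>The left ideal K of the free algebra with Z^{[p]}(lambda) = free / K.\<close>
definition verma_ideal :: "nat \<Rightarrow> (nat \<Rightarrow> 'k::ring_1) \<Rightarrow> (nat \<Rightarrow> 'k) \<Rightarrow> 'k free set" where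
  "verma_ideal p lam1 lam2 = left_ideal_gen
     (two_sided_ideal (restricted_rels p)
      \<union> {eser r | r. r > 0}
      \<union> {dser1 r - scal (lam1 r) | r. r > 0}
      \<union> {dser2 r - scal (lam2 r) | r. r > 0})"

text \<open>Graded submodules of Z^{[p]}(lambda) correspond to graded left ideals containing K;
  proper means not containing (the image of) 1, the highest weight vector.
  The unique maximal proper graded submodule is the sum of all proper ones.\<close>
definition max_ideal :: "nat \<Rightarrow> (nat \<Rightarrow> 'k::ring_1) \<Rightarrow> (nat \<Rightarrow> 'k) \<Rightarrow> 'k free set" where
  "max_ideal p lam1 lam2 = left_ideal_gen
     (\<Union>{N. verma_ideal p lam1 lam2 \<subseteq> N \<and> is_left_ideal N \<and> graded N \<and> 1 \<notin> N})"

text \<open>L^{[p]}(lambda) = free / max_ideal is finite dimensional over k.\<close>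
definition simple_fin_dim :: "nat \<Rightarrow> (nat \<Rightarrow> 'k::field) \<Rightarrow> (nat \<Rightarrow> 'k) \<Rightarrow> bool" where
  "simple_fin_dim p lam1 lam2 \<longleftrightarrow>
     (\<exists>B. finite B \<and> (\<forall>x. \<exists>c. x - (\<Sum>b\<in>B. scal (c b) * b) \<in> max_ideal p lam1 lam2))"

definition restricted_series :: "nat \<Rightarrow> (nat \<Rightarrow> 'k::field) \<Rightarrow> bool" where
  "restricted_series p g \<longleftrightarrow> g 0 = 1 \<and> sprod_shift p g = (\<lambda>n. if n = 0 then 1 else 0)"

text \<open>For a polynomial P of degree n, the series u^{-n} P(u) in k[[u^{-1}]].\<close>
definition poly_ser :: "'k::field poly \<Rightarrow> nat \<Rightarrow> 'k" where
  "poly_ser P m = (if m \<le> degree P then coeff P (degree P - m) else 0)"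

end

theory Submission
  imports Defs "HOL-Computational_Algebra.Formal_Laurent_Series"
begin

text \<open>
  Write \<open>t\<^sub>1\<^sub>1 = d\<close>, \<open>t\<^sub>1\<^sub>2 = d e\<close>, \<open>t\<^sub>2\<^sub>1 = f d\<close>, \<open>t\<^sub>2\<^sub>2 = f d e + d h\<close>. In the super Yangian the coefficients of
  \<open>f\<close> anticommute, \<open>h\<close> commutes with \<open>f\<close>, and the anticommutator of \<open>e\<^sub>r\<close> and \<open>f\<^sub>s\<close> is \<open>h\<^sub>r\<^sub>+\<^sub>s\<^sub>-\<^sub>1\<close>. Hence the baby Verma
  module is spanned by the exterior algebra in the \<open>f\<^sub>r\<close>, on which \<open>h\<close> acts as the scalar series \<open>\<lambda>\<^sub>2/\<lambda>\<^sub>1\<close>.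
  The augmentation ideal of that algebra is nil, so every proper submodule lies in it, and there is
  a largest one. A linear combination of the \<open>f\<^sub>r\<close> lies in the largest proper submodule only if its
  coefficients define a linear recurrence for \<open>\<lambda>\<^sub>2/\<lambda>\<^sub>1\<close>; conversely a recurrence makes all but finitely many
  \<open>f\<^sub>r\<close> redundant in the simple quotient. A recurrence means that \<open>\<lambda>\<^sub>2/\<lambda>\<^sub>1\<close> is a ratio of monic polynomials of equal
  degree. That the baby Verma module is nonzero is shown by realising it on the alternating
  functions in variables \<open>x\<^sub>i\<close>, with \<open>d\<close> acting as multiplication by \<open>\<lambda>\<^sub>1(u) \<Prod>\<^sub>i (1 - 1/(u - x\<^sub>i))\<close>; the product of
  the p shifts of each factor telescopes to 1 in characteristic p.
\<close>

section \<open>Series in two variables\<close>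

text \<open>The factor h = d^{-1} d_2 replaces d_2 because it is the combination that commutes with
  f, so it acts by one scalar series on all f-monomials. Moving d(u) past f multiplies by 1 - 1/(u -
  x), where x raises the index of f; this is the origin of the multiplication operators of the
  model. The model consists of functions, so it is dual to an exterior algebra: e_r is contraction
  with a basis vector and f_s is exterior multiplication by the functional y -> h_{s+y}, which makes
  their anticommutator scalar by construction. Combinations of the f_s may vanish in the model; what
  is drawn from it is that its vacuum survives. Two obstacles shape the rest. Submodules have to be
  graded, whereas the nil argument finds the largest submodule without grading; the parity
  automorphism and division by 2 bridge the gap. And relations with 1/(u - v) need one ring for
  noncommuting series in u and v: power series in u^{-1} over Laurent series in v^{-1}.\<close>

lemma Abs_fps_smul: "Abs_fps (smul A B) = Abs_fps A * Abs_fps B"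
  by (rule fps_ext) (simp add: smul_def fps_mult_nth atLeast0AtMost)

lemma Abs_fps_inject_iff: "Abs_fps A = Abs_fps B \<longleftrightarrow> A = B"
  by (auto simp: fps_eq_iff)

lemma smul_assoc: "smul (smul A B) C = smul A (smul B C)"
  by (simp add: Abs_fps_inject_iff[symmetric] Abs_fps_smul mult.assoc)

definition sone :: "nat \<Rightarrow> 'a::ring_1" where
  "sone n = (if n = 0 then 1 else 0)"

lemma Abs_fps_sone: "Abs_fps sone = 1"
  by (rule fps_ext) (simp add: sone_def)

lemma smul_sone [simp]: "smul A sone = A" "smul sone A = A"
  by (simp_all add: Abs_fps_inject_iff[symmetric] Abs_fps_smul Abs_fps_sone)

lemma smul_rev: "smul A B n = (\<Sum>m\<le>n. A (n - m) * B m)"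
  unfolding smul_def
  by (subst sum.atLeastAtMost_rev[of _ 0, unfolded atLeast0AtMost]) (auto intro!: sum.cong)

lemma smul_const_left: "smul (\<lambda>i. if i = 0 then x else 0) A n = x * A n"
proof -
  have "smul (\<lambda>i. if i = 0 then x else 0) A n = (\<Sum>m\<le>n. if m = 0 then x * A n else 0)"
    unfolding smul_def by (intro sum.cong refl) auto
  then show ?thesis by simp
qed

lemma smul_commute:
  assumes "\<And>i j. A i * B j = B j * A i"
  shows "smul A B = smul B A"
proof
  show "smul A B n = smul B A n" for n
    unfolding smul_rev[of A B] smul_def[of B A] by (simp only: assms)
qed

lemma smul_nth_0: "smul A B 0 = A 0 * B 0"
  by (simp add: smul_def)

declare sinv.simps [simp del]

lemma sinv_0 [simp]: "sinv A 0 = 1"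
  by (simp add: sinv.simps)

lemma smul_sinv_right:
  assumes "A 0 = 1"
  shows "smul A (sinv A) = sone"
proof
  fix n
  show "smul A (sinv A) n = sone n"
  proof (cases "n = 0")
    case False
    then have "{..n} = insert 0 {1..n}" by auto
    then have "smul A (sinv A) n = sinv A n + (\<Sum>m\<in>{1..n}. A m * sinv A (n - m))"
      using assms by (simp add: smul_def)
    then show ?thesis using False by (simp add: sone_def sinv.simps[of A n])
  qed (use assms in \<open>simp add: smul_def sone_def\<close>)
qed

text \<open>The recursion for \<open>sinv\<close> directly gives a right inverse. Now
  \<open>sinv A\<close> has the left inverse \<open>A\<close> and itself a right inverse, and the
  two must agree.\<close>

lemma smul_sinv_left:
  assumes "A 0 = 1"
  shows "smul (sinv A) A = sone"
proof -
  have "smul (sinv A) (sinv (sinv A)) = sone"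
    by (simp add: smul_sinv_right)
  moreover from this have "A = sinv (sinv A)"
    using smul_sinv_right[where A=A, OF assms] by (metis smul_assoc smul_sone)
  ultimately show ?thesis by simp
qed

lemma sum_triangle_swap:
  fixes g :: "nat \<Rightarrow> nat \<Rightarrow> 'a::comm_monoid_add"
  shows "(\<Sum>i<r. \<Sum>j<r - 1 - i. g i j) = (\<Sum>j<r. \<Sum>i<r - 1 - j. g i j)"
proof -
  have *: "(\<Sum>j<r - 1 - i. g' j) = (\<Sum>j<r. if i + j + 1 < r then g' j else 0)" for i and g' :: "nat \<Rightarrow> 'a"
    by (rule sum.mono_neutral_cong_left) auto
  have "(\<Sum>i<r. \<Sum>j<r - 1 - i. g i j) = (\<Sum>i<r. \<Sum>j<r. if i + j + 1 < r then g i j else 0)"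
    by (intro sum.cong refl *)
  also have "\<dots> = (\<Sum>j<r. \<Sum>i<r. if i + j + 1 < r then g i j else 0)"
    by (rule sum.swap)
  also have "\<dots> = (\<Sum>j<r. \<Sum>i<r - 1 - j. g i j)"
    unfolding * by (intro sum.cong refl) (simp add: add.commute)
  finally show ?thesis .
qed

section \<open>Series in u and v in one ring, and the kernel 1/(u - v)\<close>

definition useries :: "(nat \<Rightarrow> 'a::ring_1) \<Rightarrow> 'a fls fps" where
  "useries A = Abs_fps (\<lambda>n. fls_const (A n))"

definition vseries :: "(nat \<Rightarrow> 'a::ring_1) \<Rightarrow> 'a fls fps" where
  "vseries A = fps_const (fps_to_fls (Abs_fps A))"

text \<open>The expansion of 1/(u - v) in powers of u^{-1}, with coefficients Laurent series in v^{-1}.\<close>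
definition wser :: "'a::ring_1 fls fps" where
  "wser = Abs_fps (\<lambda>n. if n = 0 then 0 else fls_X_intpow (1 - int n))"

lemma fls_const_sum: "fls_const (sum g I) = (\<Sum>i\<in>I. fls_const (g i))"
  by (induction I rule: infinite_finite_induct) (auto simp: fls_plus_const[symmetric])

lemma useries_smul: "useries (smul A B) = useries A * useries B"
  by (rule fps_ext)
    (simp add: useries_def fps_mult_nth smul_def fls_const_sum atLeast0AtMost)

lemma vseries_smul: "vseries (smul A B) = vseries A * vseries B"
  by (simp add: vseries_def Abs_fps_smul fls_times_fps_to_fls)

lemma useries_sone [simp]: "useries sone = 1"
  by (rule fps_ext) (simp add: useries_def sone_def)

lemma vseries_sone [simp]: "vseries sone = 1"
  by (simp add: vseries_def Abs_fps_sone)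

lemma useries_add: "useries (\<lambda>n. A n + B n) = useries A + useries B"
  by (rule fps_ext) (simp add: useries_def fls_plus_const)

lemma vseries_add: "vseries (\<lambda>n. A n + B n) = vseries A + vseries B"
proof -
  have "Abs_fps (\<lambda>n. A n + B n) = Abs_fps A + Abs_fps B"
    by (rule fps_ext) simp
  then show ?thesis by (simp add: vseries_def)
qed

text \<open>The coefficients of 1/(u - v) are powers of v, which commute with everything even over a
  noncommutative coefficient ring.\<close>

lemma wser_central: "x * wser = wser * x"
proof (rule fps_ext)
  fix n
  have comm: "y * fps_nth wser m = fps_nth wser m * y" for y :: "'a fls" and m
    using fls_X_intpow_times_comm[of "1 - int m" y] by (simp add: wser_def)
  have "(\<Sum>i=0..n. fps_nth x i * fps_nth wser (n - i)) = (\<Sum>i=0..n. fps_nth wser (n - i) * fps_nth x i)"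
    by (simp only: comm)
  also have "\<dots> = (\<Sum>i=0..n. fps_nth wser i * fps_nth x (n - i))"
    by (subst sum.atLeastAtMost_rev) simp
  finally show "fps_nth (x * wser) n = fps_nth (wser * x) n"
    by (simp add: fps_mult_nth)
qed

text \<open>The coefficient of u^{-r} v^{-s}: \<open>fps_X\<close> stands for u^{-1} and
  \<open>fls_X\<close> for v^{-1}.\<close>

definition coeff2 :: "'a::ring_1 fls fps \<Rightarrow> nat \<Rightarrow> nat \<Rightarrow> 'a" where
  "coeff2 X r s = fls_nth (fps_nth X r) (int s)"

lemma coeff2_add: "coeff2 (X + Y) r s = coeff2 X r s + coeff2 Y r s"
  and coeff2_diff: "coeff2 (X - Y) r s = coeff2 X r s - coeff2 Y r s"
  and coeff2_uminus: "coeff2 (- X) r s = - coeff2 X r s"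
  by (simp_all add: coeff2_def)

lemma coeff2_uv: "coeff2 (useries A * vseries B) r s = A r * B s"
  and coeff2_vu: "coeff2 (vseries B * useries A) r s = B s * A r"
  by (simp_all add: coeff2_def useries_def vseries_def)

lemma coeff2_u: "coeff2 (useries A) r s = (if s = 0 then A r else 0)"
  and coeff2_v: "coeff2 (vseries A) r s = (if r = 0 then A s else 0)"
  by (simp_all add: coeff2_def useries_def vseries_def)

text \<open>Absence of positive powers of v. As \<open>coeff2\<close> sees only s >= 0, it
  determines a series only under this condition, which \<open>wser\<close> itself violates.\<close>

definition vpower :: "'a::ring_1 fls fps \<Rightarrow> bool" where
  "vpower X \<longleftrightarrow> (\<forall>n k. k < 0 \<longrightarrow> fls_nth (fps_nth X n) k = 0)"

lemma vpower_uv: "vpower (useries A * vseries B)"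
  and vpower_vu: "vpower (vseries B * useries A)"
  by (simp_all add: vpower_def useries_def vseries_def)

lemma vpower_add: "vpower X \<Longrightarrow> vpower Y \<Longrightarrow> vpower (X + Y)"
  and vpower_diff: "vpower X \<Longrightarrow> vpower Y \<Longrightarrow> vpower (X - Y)"
  and vpower_uminus: "vpower X \<Longrightarrow> vpower (- X)"
  by (simp_all add: vpower_def)

lemma vpower_u: "vpower (useries A)" and vpower_v: "vpower (vseries A)"
  by (simp_all add: vpower_def useries_def vseries_def)

lemmas coeff2_simps = coeff2_add coeff2_diff coeff2_uminus coeff2_uv coeff2_vu coeff2_u coeff2_v
lemmas vpower_intros = vpower_add vpower_diff vpower_uminus vpower_uv vpower_vu vpower_u vpower_v

text \<open>The identity (1/v - 1/u) * 1/(u - v) = 1/(u v), a form of the defining property of the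
  kernel that avoids positive powers of u.\<close>

lemma wser_mult: "(fps_const fls_X - fps_X) * (wser :: 'a::ring_1 fls fps) = fps_const fls_X * fps_X"
proof (rule fps_ext)
  fix n
  show "fps_nth ((fps_const fls_X - fps_X) * wser) n = fps_nth (fps_const fls_X * fps_X :: 'a fls fps) n"
    by (cases n) (auto simp: left_diff_distrib wser_def fls_X_times_conv_shift intro!: fls_eqI)
qed

text \<open>Multiplication by 1/v - 1/u is injective: up to lower coefficients it acts on the
  coefficient of u^{-n} as an invertible shift in v, so the difference of two solutions vanishes
  coefficient by coefficient.\<close>

lemma eq_wser_mult_iff:
  "X = wser * Y \<longleftrightarrow> (fps_const fls_X - fps_X) * X = fps_const fls_X * fps_X * Y"
  for X Y :: "'a::ring_1 fls fps"
proof
  assume "X = wser * Y"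
  then show "(fps_const fls_X - fps_X) * X = fps_const fls_X * fps_X * Y"
    by (simp add: mult.assoc[symmetric] wser_mult)
next
  assume a: "(fps_const fls_X - fps_X) * X = fps_const fls_X * fps_X * Y"
  define D where "D = X - wser * Y"
  have eq0: "(fps_const fls_X - fps_X) * D = 0"
    unfolding D_def right_diff_distrib a by (simp add: mult.assoc[symmetric] wser_mult)
  have "fps_nth D n = 0" for n
  proof (induction n)
    case 0
    have "fls_X * fps_nth D 0 = fps_nth ((fps_const fls_X - fps_X) * D) 0" by (simp add: left_diff_distrib)
    then show ?case unfolding eq0 by (simp add: fls_X_times_conv_shift fls_shift_eq0_iff)
  next
    case (Suc n)
    have "fls_X * fps_nth D (Suc n) = fps_nth ((fps_const fls_X - fps_X) * D) (Suc n)"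
      using Suc by (simp add: left_diff_distrib)
    then show ?case unfolding eq0 by (simp add: fls_X_times_conv_shift fls_shift_eq0_iff)
  qed
  then have "D = 0" by (simp add: fps_eq_iff)
  then show "X = wser * Y" by (simp add: D_def)
qed

text \<open>Comparison of coefficients in (u - v) X = Y. The two edge conditions come from the
  positive powers u^1 and v^1, to which Y contributes nothing.\<close>

lemma eq_wser_mult_coeff2:
  assumes "vpower X" "vpower Y"
  shows "X = wser * Y \<longleftrightarrow> (\<forall>r s. coeff2 X (Suc r) s - coeff2 X r (Suc s) = coeff2 Y r s)
     \<and> (\<forall>s. coeff2 X 0 s = 0) \<and> (\<forall>r. coeff2 X r 0 = 0)"
proof -
  let ?L = "(fps_const fls_X - fps_X) * X" and ?R = "fps_const fls_X * fps_X * Y"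
  have L: "fls_nth (fps_nth (?L) n) k = fls_nth (fps_nth X n) (k - 1) - (if n = 0 then 0 else fls_nth (fps_nth X (n - 1)) k)" for n k
    by (simp add: left_diff_distrib fls_X_times_conv_shift)
  have R: "fls_nth (fps_nth (?R) n) k = (if n = 0 then 0 else fls_nth (fps_nth Y (n - 1)) (k - 1))" for n k
    by (simp add: mult.assoc fls_X_times_conv_shift)
  have neg: "fls_nth (fps_nth (X) n) k = 0" "fls_nth (fps_nth (Y) n) k = 0" if "k < 0" for n k
    using assms that by (auto simp: vpower_def)
  show ?thesis
    unfolding eq_wser_mult_iff
  proof (intro iffI conjI allI)
    assume "?L = ?R"
    then have e: "fls_nth (fps_nth X n) (k - 1) - (if n = 0 then 0 else fls_nth (fps_nth X (n - 1)) k) =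
       (if n = 0 then 0 else fls_nth (fps_nth Y (n - 1)) (k - 1))" for n k
      using L R by metis
    show "coeff2 X (Suc r) s - coeff2 X r (Suc s) = coeff2 Y r s" for r s
      using e[of "Suc r" "int (Suc s)"] by (simp add: coeff2_def)
    show "coeff2 X 0 s = 0" for s
      using e[of 0 "int s + 1"] by (simp add: coeff2_def)
    show "coeff2 X r 0 = 0" for r
      using e[of "Suc r" 0] by (simp add: coeff2_def neg)
  next
    assume a: "(\<forall>r s. coeff2 X (Suc r) s - coeff2 X r (Suc s) = coeff2 Y r s)
     \<and> (\<forall>s. coeff2 X 0 s = 0) \<and> (\<forall>r. coeff2 X r 0 = 0)"
    have "fls_nth (fps_nth (?L) n) k = fls_nth (fps_nth (?R) n) k" for n k
    proof (cases "k \<le> 0")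
      case True
      then show ?thesis unfolding L R using neg[of "k - 1"] neg[of k] a[THEN conjunct2, THEN conjunct2, rule_format, of "n - 1"]
        by (cases "k = 0") (auto simp: coeff2_def)
    next
      case False
      define m where "m = nat (k - 1)"
      have k: "k = int (Suc m)" using False by (simp add: m_def)
      show ?thesis
      proof (cases n)
        case 0
        then show ?thesis unfolding L R using a[THEN conjunct2, THEN conjunct1, rule_format, of m] by (simp add: k coeff2_def)
      next
        case (Suc r)
        then show ?thesis unfolding L R using a[THEN conjunct1, rule_format, of r m] by (simp add: k coeff2_def)
      qed
    qed
    then show "?L = ?R" by (intro fps_ext fls_eqI) blast
  qed
qed

section \<open>From Gauss factors to the RTT relations\<close>

lemma mult_assoc_rule: "a * b = c \<Longrightarrow> a * (b * x) = c * x" for a :: "'b::semigroup_mult"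
  by (simp add: mult.assoc[symmetric])

text \<open>\<open>w\<close> stands for 1/(u - v); unprimed letters are series in u, primed ones in
  v. The relations are oriented as rewrite rules: \<open>w\<close> and \<open>h\<close> move to the
  front, letters in different variables are put in the order f, d, e, and equal letters have the
  unprimed one first.\<close>

locale gauss_series =
  fixes w d d' e e' f f' h h' :: "'b::ring_1"
  assumes w_central: "x * w = w * x"
    and dd: "d' * d = d * d'"
    and df: "d * f' = f' * d - w * f' * d + w * f * d"
    and df': "d' * f = f * d' + w * f * d' - w * f' * d'"
    and ed: "e' * d = d * e' - w * d * e' + w * d * e"
    and ed': "e * d' = d' * e + w * d' * e - w * d' * e'"
    and ef: "e * f' = - (f' * e) - w * h + w * h'"
    and ef': "e' * f = - (f * e') - w * h + w * h'"
    and ee: "e' * e = - (e * e')" "e * e = 0" "e' * e' = 0"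
    and ff: "f' * f = - (f * f')" "f * f = 0" "f' * f' = 0"
    and h_central: "x \<in> {d, d', e, e', f, f', h, h'} \<Longrightarrow> x * h = h * x"
      "x \<in> {d, d', e, e', f, f', h, h'} \<Longrightarrow> x * h' = h' * x"
begin

lemma w_left: "x * (w * y) = w * (x * y)"
  by (metis w_central mult.assoc)

lemma h_left: "x \<in> {d, d', e, e', f, f', h, h'} \<Longrightarrow> x * (h * y) = h * (x * y)"
  "x \<in> {d, d', e, e', f, f', h, h'} \<Longrightarrow> x * (h' * y) = h' * (x * y)"
  using h_central by (metis mult.assoc)+

lemmas basic = dd df df' ed ed' ef ef' ee ff

lemmas normal_order = basic basic[THEN mult_assoc_rule]
  w_central[of d] w_central[of d'] w_central[of e] w_central[of e'] w_central[of f] w_central[of f']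
  w_central[of h] w_central[of h']
  w_left[of d] w_left[of d'] w_left[of e] w_left[of e'] w_left[of f] w_left[of f']
  w_left[of h] w_left[of h']
  h_central[of d, simplified] h_central[of d', simplified] h_central[of e, simplified]
  h_central[of e', simplified] h_central[of f, simplified] h_central[of f', simplified]
  h_left[of d, simplified] h_left[of d', simplified] h_left[of e, simplified]
  h_left[of e', simplified] h_left[of f, simplified] h_left[of f', simplified]
  h_central(1)[of h', simplified] h_left(1)[of h', simplified]

definition "tu i j = (case (i, j) of (I1, I1) \<Rightarrow> d | (I1, I2) \<Rightarrow> d * e | (I2, I1) \<Rightarrow> f * d | (I2, I2) \<Rightarrow> f * d * e + h * d)"
definition "tv i j = (case (i, j) of (I1, I1) \<Rightarrow> d' | (I1, I2) \<Rightarrow> d' * e' | (I2, I1) \<Rightarrow> f' * d' | (I2, I2) \<Rightarrow> f' * d' * e' + h' * d')"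

text \<open>In each of the sixteen cases both sides have the same normally ordered form;
  \<open>h * d\<close> plays the role of d_2.\<close>

lemma rtt: "tu i j * tv k l - (-1) ^ ((par i + par j) * (par k + par l)) * tv k l * tu i j
   = w * ((-1) ^ (par i * par j + par i * par k + par j * par k) * (tu k j * tv i l - tv k j * tu i l))"
  apply (cases i; cases j; cases k; cases l)
  apply (simp_all add: tu_def tv_def par_def algebra_simps normal_order)
  done
end

section \<open>RTT relations: coefficients and generating series\<close>

definition rtt_family :: "(idx \<Rightarrow> idx \<Rightarrow> nat \<Rightarrow> 'a::ring_1) \<Rightarrow> bool" where
  "rtt_family t \<longleftrightarrow> (\<forall>i j. t i j 0 = (if i = j then 1 else 0)) \<and>
     (\<forall>i j k l r s. r > 0 \<longrightarrow> s > 0 \<longrightarrow>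
       t i j r * t k l s - (-1) ^ ((par i + par j) * (par k + par l)) * t k l s * t i j r
       = (-1) ^ (par i * par j + par i * par k + par j * par k) *
         (\<Sum>n<min r s. t k j n * t i l (r + s - 1 - n) - t k j (r + s - 1 - n) * t i l n))"

text \<open>Both sums have the same summand and their ranges differ by at most one index, the
  smaller of r and s. For r = s the ranges agree and the right side is zero as well.\<close>

lemma telescope_min:
  fixes p q :: "nat \<Rightarrow> 'a::ring_1"
  defines "G \<equiv> \<lambda>r s. \<Sum>n<min r s. p n * q (r + s - 1 - n) - p (r + s - 1 - n) * q n"
  shows "G (Suc r) s - G r (Suc s) = p r * q s - p s * q r"
proof -
  define g where "g n = p n * q (r + s - n) - p (r + s - n) * q n" for n
  have G: "G (Suc r) s = sum g {..<min (Suc r) s}" "G r (Suc s) = sum g {..<min r (Suc s)}"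
    by (simp_all add: G_def g_def)
  consider "r < s" | "r = s" | "s < r" by linarith
  then show ?thesis
  proof cases
    case 1
    then have m: "min (Suc r) s = Suc r" "min r (Suc s) = r" by auto
    show ?thesis unfolding G m by (simp add: g_def)
  next
    case 2
    then have "min (Suc r) s = min r (Suc s)" "p r * q s - p s * q r = 0" by auto
    then show ?thesis unfolding G by simp
  next
    case 3
    then have m: "min (Suc r) s = s" "min r (Suc s) = Suc s" by auto
    show ?thesis unfolding G m by (simp add: g_def)
  qed
qed

text \<open>Starting from the trivial row r = 0, the differences determine the truncated sums by
  recursion on r; \<open>telescope_min\<close> evaluates the differences.\<close>

lemma rtt_coeff_iff:
  fixes a b p q :: "nat \<Rightarrow> 'a::ring_1" and \<sigma> \<tau> :: 'a
  assumes 0: "\<And>s. a 0 * b s = \<sigma> * b s * a 0" "\<And>r. a r * b 0 = \<sigma> * b 0 * a r"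
  shows "(\<forall>r>0. \<forall>s>0. a r * b s - \<sigma> * b s * a r
      = \<tau> * (\<Sum>n<min r s. p n * q (r + s - 1 - n) - p (r + s - 1 - n) * q n))
    \<longleftrightarrow> (\<forall>r s. (a (Suc r) * b s - \<sigma> * b s * a (Suc r)) - (a r * b (Suc s) - \<sigma> * b (Suc s) * a r)
      = \<tau> * (p r * q s - p s * q r))" (is "?A \<longleftrightarrow> ?B")
proof -
  define G where "G r s = (\<Sum>n<min r s. p n * q (r + s - 1 - n) - p (r + s - 1 - n) * q n)" for r s
  define X where "X r s = a r * b s - \<sigma> * b s * a r" for r s
  have G: "G (Suc r) s - G r (Suc s) = p r * q s - p s * q r" for r s
    unfolding G_def by (rule telescope_min)
  have X0: "X 0 s = 0" "X r 0 = 0" for r s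
    using 0 by (simp_all add: X_def)
  have G0: "G 0 s = 0" "G r 0 = 0" for r s
    by (simp_all add: G_def)
  have "(\<forall>r>0. \<forall>s>0. X r s = \<tau> * G r s) \<longleftrightarrow> (\<forall>r s. X (Suc r) s - X r (Suc s) = \<tau> * (p r * q s - p s * q r))"
  proof safe
    fix r s
    assume "\<forall>r>0. \<forall>s>0. X r s = \<tau> * G r s"
    then have "X r s = \<tau> * G r s" for r s
      by (cases "r = 0 \<or> s = 0") (auto simp: X0 G0)
    then show "X (Suc r) s - X r (Suc s) = \<tau> * (p r * q s - p s * q r)"
      by (simp add: G[symmetric] right_diff_distrib)
  next
    fix r s :: nat
    assume a: "\<forall>r s. X (Suc r) s - X r (Suc s) = \<tau> * (p r * q s - p s * q r)"
    have "\<forall>s. X r s = \<tau> * G r s"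
    proof (induction r)
      case (Suc r)
      have "X (Suc r) s = X r (Suc s) + \<tau> * (p r * q s - p s * q r)" for s
        using a by (metis add.commute diff_add_cancel)
      also have "\<dots> s = \<tau> * G (Suc r) s" for s
        using Suc G[of r s] by (simp add: diff_eq_eq distrib_left[symmetric] add.commute)
      finally show ?case by blast
    qed (simp add: X0 G0)
    then show "X r s = \<tau> * G r s" by blast
  qed
  then show ?thesis
    by (simp only: X_def G_def)
qed

text \<open>Clearing 1/(u - v) yields the difference form of the relations. The edge conditions hold
  because \<open>t i j 0\<close> is 0 or 1, and the Koszul sign is trivial when it is 1.\<close>

lemma rtt_family_iff:
  fixes t :: "idx \<Rightarrow> idx \<Rightarrow> nat \<Rightarrow> 'a::ring_1"
  assumes t0: "\<And>i j. t i j 0 = (if i = j then 1 else 0)"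
  shows "rtt_family t \<longleftrightarrow> (\<forall>i j k l.
    useries (t i j) * vseries (t k l)
      - (-1) ^ ((par i + par j) * (par k + par l)) * vseries (t k l) * useries (t i j)
    = wser * ((-1) ^ (par i * par j + par i * par k + par j * par k) *
       (useries (t k j) * vseries (t i l) - vseries (t k j) * useries (t i l))))"
proof -
  have sgn: "(-1) ^ n = (1::'b::ring_1) \<or> (-1) ^ n = (-1::'b)" for n :: nat
    by (cases "even n") auto
  have "(\<forall>r>0. \<forall>s>0. t i j r * t k l s - (-1) ^ ((par i + par j) * (par k + par l)) * t k l s * t i j r
       = (-1) ^ (par i * par j + par i * par k + par j * par k) *
         (\<Sum>n<min r s. t k j n * t i l (r + s - 1 - n) - t k j (r + s - 1 - n) * t i l n)) \<longleftrightarrow>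
     useries (t i j) * vseries (t k l)
      - (-1) ^ ((par i + par j) * (par k + par l)) * vseries (t k l) * useries (t i j)
    = wser * ((-1) ^ (par i * par j + par i * par k + par j * par k) *
       (useries (t k j) * vseries (t i l) - vseries (t k j) * useries (t i l)))" (is "?A \<longleftrightarrow> ?X = wser * ?Y") for i j k l
  proof -
    let ?\<sigma> = "(-1) ^ ((par i + par j) * (par k + par l)) :: 'a"
    let ?\<tau> = "(-1) ^ (par i * par j + par i * par k + par j * par k) :: 'a"
    have 1: "t i j 0 * t k l s = ?\<sigma> * t k l s * t i j 0" for s
      by (cases i; cases j) (auto simp: t0 par_def)
    have 2: "t i j r * t k l 0 = ?\<sigma> * t k l 0 * t i j r" for r
      by (cases k; cases l) (auto simp: t0 par_def)
    have X: "coeff2 ?X r s = t i j r * t k l s - ?\<sigma> * t k l s * t i j r" for r s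
      by (cases "even ((par i + par j) * (par k + par l))") (simp_all add: coeff2_simps)
    have Y: "coeff2 ?Y r s = ?\<tau> * (t k j r * t i l s - t k j s * t i l r)" for r s
      by (cases "even (par i * par j + par i * par k + par j * par k)") (simp_all add: coeff2_simps)
    have vX: "vpower ?X"
      by (cases "even ((par i + par j) * (par k + par l))") (auto intro!: vpower_intros simp del: add_uminus_conv_diff simp: diff_minus_eq_add)
    have vY: "vpower ?Y"
      by (cases "even (par i * par j + par i * par k + par j * par k)") (auto intro!: vpower_intros)
    have "?X = wser * ?Y \<longleftrightarrow> (\<forall>r s. (t i j (Suc r) * t k l s - ?\<sigma> * t k l s * t i j (Suc r))
        - (t i j r * t k l (Suc s) - ?\<sigma> * t k l (Suc s) * t i j r)
      = ?\<tau> * (t k j r * t i l s - t k j s * t i l r))"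
      unfolding eq_wser_mult_coeff2[OF vX vY] X Y using 1 2 by simp
    then show ?thesis
      using rtt_coeff_iff[where a = "t i j" and b = "t k l" and p = "t k j" and q = "t i l" and \<sigma> = ?\<sigma> and \<tau> = ?\<tau>, OF 1 2]
      by simp
  qed
  then show ?thesis
    unfolding rtt_family_def using t0 by auto
qed

section \<open>From the RTT relations to relations between the Gauss factors\<close>

lemma eq_wser_mult_self:
  assumes "X = wser * X"
  shows "X = 0"
proof (rule fps_ext)
  fix n
  show "fps_nth X n = fps_nth 0 n"
  proof (induction n rule: less_induct)
    case (less n)
    have "fps_nth X n = (\<Sum>i=0..n. fps_nth wser i * fps_nth X (n - i))"
      by (subst assms) (simp add: fps_mult_nth)
    \<comment> \<open>The term i = 0 vanishes because 1/(u - v) starts with u^{-1}; the other terms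
      contain lower coefficients of \<open>X\<close>.\<close>
    also have "\<dots> = 0"
    proof (rule sum.neutral, rule ballI)
      fix i
      assume "i \<in> {0..n}"
      then show "fps_nth wser i * fps_nth X (n - i) = 0"
        using less[of "n - i"] by (cases "i = 0") (auto simp: wser_def)
    qed
    finally show ?case by simp
  qed
qed

text \<open>Exchanging u and v is no substitution in this ring, as the expansion of 1/(u - v) is
  asymmetric. In coefficient form, available because both brackets are power series in u^{-1} and
  v^{-1}, the relation is symmetric up to sign.\<close>

lemma wser_relation_swap:
  assumes "useries A * vseries B - vseries B * useries A = wser * (useries P * vseries Q - vseries P * useries Q)"
  shows "vseries A * useries B - useries B * vseries A = - (wser * (vseries P * useries Q - useries P * vseries Q))"
proof -
  have *: "vpower (useries A * vseries B - vseries B * useries A)"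
    "vpower (useries P * vseries Q - vseries P * useries Q)"
    "vpower (vseries A * useries B - useries B * vseries A)"
    "vpower (useries P * vseries Q - vseries P * useries Q)" for A B P Q :: "nat \<Rightarrow> 'a"
    by (intro vpower_intros)+
  have "vseries A * useries B - useries B * vseries A = wser * (useries P * vseries Q - vseries P * useries Q)"
    using assms unfolding eq_wser_mult_coeff2[OF *(1,2)] eq_wser_mult_coeff2[OF *(3,4)] coeff2_simps
    by (metis minus_diff_eq)
  then show ?thesis by (simp add: right_diff_distrib)
qed

text \<open>The RTT relations with t_11 = d, t_12 = d e, t_21 = f d and t_22 = f d e + d_2 inserted;
  \<open>di\<close> is the inverse of \<open>d\<close>, and \<open>r12'\<close> is
  \<open>r12\<close> with u and v exchanged.\<close>

locale rtt_series =
  fixes w d d' di di' e e' f f' d2 d2' :: "'b::ring_1"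
  assumes w_central: "x * w = w * x"
    and dd: "d' * d = d * d'"
    and inv: "d * di = 1" "di * d = 1" "d' * di' = 1" "di' * d' = 1"
    and r12: "d * (d' * e') - d' * e' * d = w * (d * (d' * e') - d' * (d * e))"
    and r12': "d' * (d * e) - d * e * d' = - (w * (d' * (d * e) - d * (d' * e')))"
    and r21: "d * (f' * d') - f' * d' * d = w * (f * d * d' - f' * d' * d)"
    and r22: "d * (f' * d' * e' + d2') - (f' * d' * e' + d2') * d = w * (f * d * (d' * e') - f' * d' * (d * e))"
    and r1221: "d * e * (f' * d') + f' * d' * (d * e)
      = - (w * ((f * d * e + d2) * d' - (f' * d' * e' + d2') * d))"
begin

lemmas cancel = inv inv[THEN mult_assoc_rule]

lemma w_left: "x * (w * y) = w * (x * y)"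
  by (metis w_central mult.assoc)

lemmas w_rules =
  w_central[of d] w_central[of d'] w_central[of e] w_central[of e'] w_central[of f] w_central[of f']
  w_central[of di] w_central[of di'] w_left[of di] w_left[of di'] w_central[of d2] w_central[of d2']
  w_left[of d] w_left[of d'] w_left[of e] w_left[of e'] w_left[of f] w_left[of f']
  w_left[of d2] w_left[of d2']

text \<open>The relation between t_11 and t_12, with d(v) cancelled on the left; \<open>df\<close>
  cancels it on the right instead.\<close>

lemma ed: "e' * d = d * e' - w * d * e' + w * d * e"
proof -
  have "di' * (d * (d' * e') - d' * e' * d) = di' * (w * (d * (d' * e') - d' * (d * e)))"
    by (simp only: r12)
  moreover have "di' * (d * (d' * x)) = d * x" for x
    by (simp add: dd[symmetric, THEN mult_assoc_rule] cancel mult.assoc)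
  ultimately have "d * e' - e' * d = w * (d * e') - w * (d * e)"
    by (simp add: right_diff_distrib cancel w_rules mult.assoc)
  then show ?thesis by (simp add: algebra_simps)
qed

lemma ed': "e * d' = d' * e + w * d' * e - w * d' * e'"
proof -
  have "di * (d' * (d * e) - d * e * d') = di * (- (w * (d' * (d * e) - d * (d' * e'))))"
    by (simp only: r12')
  moreover have "di * (d' * (d * x)) = d' * x" for x
    by (simp add: dd[THEN mult_assoc_rule] cancel mult.assoc)
  ultimately have "d' * e - e * d' = - (w * (d' * e)) + w * (d' * e')"
    by (simp add: right_diff_distrib cancel w_rules mult.assoc)
  then show ?thesis by (simp add: algebra_simps)
qed

lemma df: "d * f' = f' * d - w * f' * d + w * f * d"
proof -
  have "(d * (f' * d') - f' * d' * d) * di' = w * (f * d * d' - f' * d' * d) * di'"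
    by (simp only: r21)
  moreover have "d' * (d * di') = d"
    by (simp add: inv dd[THEN mult_assoc_rule] mult.assoc)
  ultimately have "d * f' - f' * d = w * (f * d) - w * (f' * d)"
    by (simp add: left_diff_distrib right_diff_distrib inv w_rules mult.assoc)
  then show ?thesis by (simp add: algebra_simps)
qed

lemmas basic = dd df ed ed'
lemmas normal_order = basic basic[THEN mult_assoc_rule] w_rules

text \<open>After normal ordering, the terms with f d e cancel and the commutator with d_2
  remains.\<close>

lemma d_d2': "d * d2' = d2' * d"
proof -
  show ?thesis using r22 by (simp add: algebra_simps normal_order)
qed

text \<open>Between d(u) and d(v) the anticommutator can be read off from the relation of t_12 and
  t_21. Cancelling the outer factors afterwards turns d_2 into h = d^{-1} d_2.\<close>

lemma ef_conj: "d * (e * f' + f' * e) * d' = - (w * (d2 * d' - d2' * d))"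
proof -
  have "d * e * (f' * d') = - (w * ((f * d * e + d2) * d' - (f' * d' * e' + d2') * d)) - f' * d' * (d * e)"
    unfolding r1221[symmetric] by simp
  moreover have "d * (e * f' + f' * e) * d' = d * e * (f' * d') + d * f' * (e * d')"
    by (simp add: algebra_simps)
  ultimately show ?thesis
    by (simp add: algebra_simps normal_order)
qed

lemma ef:
  assumes "d' * d2' = d2' * d'"
  shows "e * f' + f' * e = - (w * (di * d2 - di' * d2'))"
proof -
  have 1: "d2' * di' = di' * d2'"
  proof -
    have "d2' * di' = di' * (d' * d2') * di'" by (simp add: cancel mult.assoc)
    then show ?thesis unfolding assms by (simp add: inv mult.assoc)
  qed
  have 2: "di * (d2' * (d * x)) = d2' * x" for x
    by (simp add: d_d2'[symmetric, THEN mult_assoc_rule] cancel mult.assoc)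
  have "e * f' + f' * e = di * (d * (e * f' + f' * e) * d') * di'"
    by (simp add: cancel mult.assoc)
  also have "\<dots> = - (w * (di * d2 - di' * d2'))"
    unfolding ef_conj by (simp add: algebra_simps w_rules cancel 1 2)
  finally show ?thesis .
qed

end

section \<open>Drinfeld generators of an RTT family\<close>

lemma eq_wser_mult_coeff2D:
  assumes "X = wser * Y" "vpower X" "vpower Y"
  shows "coeff2 X (Suc r) s - coeff2 X r (Suc s) = coeff2 Y r s"
  using assms eq_wser_mult_coeff2 by blast

text \<open>The assumption \<open>two_torsion\<close> carries p > 2: several arguments below show
  that an element equals its own negative and conclude that it is zero.\<close>

locale yangian =
  fixes t :: "idx \<Rightarrow> idx \<Rightarrow> nat \<Rightarrow> 'a::ring_1"
  assumes rtt: "rtt_family t"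
    and two_torsion: "x + x = 0 \<Longrightarrow> x = (0::'a)"
begin

definition "d = t I1 I1"
definition "e = smul (sinv d) (t I1 I2)"
definition "f = smul (t I2 I1) (sinv d)"
definition "d2 = (\<lambda>n. t I2 I2 n - smul (smul f d) e n)"
definition "h = smul (sinv d) d2"

lemma t_0: "t i j 0 = (if i = j then 1 else 0)"
  using rtt by (simp add: rtt_family_def)

lemma d_0: "d 0 = 1" and e_0: "e 0 = 0" and f_0: "f 0 = 0" and d2_0: "d2 0 = 1" and h_0: "h 0 = 1"
  by (simp_all add: d_def e_def f_def d2_def h_def smul_nth_0 t_0)

lemma rtt_coeff: "r > 0 \<Longrightarrow> s > 0 \<Longrightarrow>
    t i j r * t k l s - (-1) ^ ((par i + par j) * (par k + par l)) * t k l s * t i j r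
    = (-1) ^ (par i * par j + par i * par k + par j * par k) *
      (\<Sum>n<min r s. t k j n * t i l (r + s - 1 - n) - t k j (r + s - 1 - n) * t i l n)"
  using rtt unfolding rtt_family_def by blast

lemma t12: "t I1 I2 = smul d e"
  unfolding e_def by (simp add: smul_assoc[symmetric] smul_sinv_right d_0)

lemma t21: "t I2 I1 = smul f d"
  unfolding f_def by (simp add: smul_assoc smul_sinv_left d_0)

lemma t22: "t I2 I2 = (\<lambda>n. smul (smul f d) e n + d2 n)"
  by (simp add: d2_def)

lemma d2_eq: "d2 = smul d h"
  unfolding h_def by (simp add: smul_assoc[symmetric] smul_sinv_right d_0)

lemma rtt_series_eq: "useries (t i j) * vseries (t k l)
      - (-1) ^ ((par i + par j) * (par k + par l)) * vseries (t k l) * useries (t i j)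
    = wser * ((-1) ^ (par i * par j + par i * par k + par j * par k) *
       (useries (t k j) * vseries (t i l) - vseries (t k j) * useries (t i l)))"
  using rtt rtt_family_iff[of t] t_0 by blast

lemma useries_t: "useries (t I1 I1) = useries d" "useries (t I1 I2) = useries d * useries e"
    "useries (t I2 I1) = useries f * useries d" "useries (t I2 I2) = useries f * useries d * useries e + useries d2"
  and vseries_t: "vseries (t I1 I1) = vseries d" "vseries (t I1 I2) = vseries d * vseries e"
    "vseries (t I2 I1) = vseries f * vseries d" "vseries (t I2 I2) = vseries f * vseries d * vseries e + vseries d2"
  by (simp_all add: t12 t21 t22 d_def[symmetric] useries_smul vseries_smul useries_add vseries_add)

lemma dd_series: "vseries d * useries d = useries d * vseries d"
proof -
  have "useries d * vseries d - vseries d * useries d = 0"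
    using rtt_series_eq[of I1 I1 I1 I1] by (intro eq_wser_mult_self) (simp add: par_def d_def)
  then show ?thesis by simp
qed

lemma swapped: "vseries d * (useries d * useries e) - useries d * useries e * vseries d
    = - (wser * (vseries d * (useries d * useries e) - useries d * (vseries d * vseries e)))"
proof -
  have "useries d * (vseries d * vseries e) - vseries d * vseries e * useries d
    = wser * (useries d * (vseries d * vseries e) - vseries d * (useries d * useries e))"
    using rtt_series_eq[of I1 I1 I1 I2] by (simp add: par_def useries_t vseries_t)
  from wser_relation_swap[where A = d and P = d and B = "smul d e" and Q = "smul d e", unfolded useries_smul vseries_smul, OF this]
  show ?thesis
    by (simp add: mult.assoc algebra_simps)
qed

lemma r1221_series: "useries d * useries e * (vseries f * vseries d) + vseries f * vseries d * (useries d * useries e)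
    = - (wser * ((useries f * useries d * useries e + useries d2) * vseries d
       - (vseries f * vseries d * vseries e + vseries d2) * useries d))"
  using rtt_series_eq[of I1 I2 I2 I1] by (simp add: par_def useries_t vseries_t right_diff_distrib)

sublocale rtt_series wser "useries d" "vseries d" "useries (sinv d)" "vseries (sinv d)"
  "useries e" "vseries e" "useries f" "vseries f" "useries d2" "vseries d2"
proof
  show "x * wser = wser * x" for x :: "'a fls fps" by (rule wser_central)
  show "useries d * useries (sinv d) = 1" "useries (sinv d) * useries d = 1"
    "vseries d * vseries (sinv d) = 1" "vseries (sinv d) * vseries d = 1"
    by (simp_all add: smul_sinv_left smul_sinv_right d_0 useries_smul[symmetric] vseries_smul[symmetric])
qed (use rtt_series_eq[of I1 I1 I1 I2] rtt_series_eq[of I1 I1 I2 I1] rtt_series_eq[of I1 I1 I2 I2]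
      in \<open>simp_all add: par_def useries_t vseries_t dd_series r1221_series swapped\<close>)

lemma d_d2: "d r * d2 s = d2 s * d r"
  using arg_cong[OF d_d2', of "\<lambda>X. coeff2 X r s"] by (simp add: coeff2_simps)

lemma smul_d_d2: "smul d d2 = smul d2 d"
  by (rule smul_commute) (rule d_d2)

text \<open>At s = 0 the series f(u) d(u) contributes a further term, hence the restriction on
  s.\<close>

lemma d_f:
  assumes "s > 0"
  shows "d (Suc r) * f s = f s * d (Suc r) + d r * f (Suc s) - f (Suc s) * d r - f s * d r"
proof -
  have "useries d * vseries f - vseries f * useries d = wser * (useries (smul f d) - vseries f * useries d)"
    using df by (simp add: useries_smul algebra_simps)
  then have "coeff2 (useries d * vseries f - vseries f * useries d) (Suc r) s
     - coeff2 (useries d * vseries f - vseries f * useries d) r (Suc s)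
     = coeff2 (useries (smul f d) - vseries f * useries d) r s"
    by (rule eq_wser_mult_coeff2D) (intro vpower_intros)+
  then show ?thesis
    using assms by (simp add: coeff2_simps algebra_simps)
qed

text \<open>The series h(v) - h(u) has no mixed coefficients, so for positive indices the
  anticommutator depends only on r + s. The row r = 0, where e_0 = 0, fixes its value.\<close>

lemma e_f:
  assumes "r > 0" "s > 0"
  shows "e r * f s + f s * e r = h (r + s - 1)"
proof -
  have "vseries d * vseries d2 = vseries d2 * vseries d"
    by (simp add: vseries_smul[symmetric] smul_d_d2)
  from ef[OF this] have "useries e * vseries f + vseries f * useries e = wser * (vseries h - useries h)"
    by (simp add: h_def useries_smul vseries_smul algebra_simps)
  then have "coeff2 (useries e * vseries f + vseries f * useries e) (Suc r) s
     - coeff2 (useries e * vseries f + vseries f * useries e) r (Suc s) = coeff2 (vseries h - useries h) r s" for r s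
    by (rule eq_wser_mult_coeff2D) (intro vpower_intros)+
  then have step: "(e (Suc r) * f s + f s * e (Suc r)) - (e r * f (Suc s) + f (Suc s) * e r)
      = (if r = 0 then h s else 0) - (if s = 0 then h r else 0)" for r s
    by (simp add: coeff2_simps)
  have "\<forall>s>0. e (Suc r) * f s + f s * e (Suc r) = h (r + s)" for r
  proof (induction r)
    case 0
    show ?case using step[of 0] by (simp add: e_0)
  next
    case (Suc r)
    show ?case
    proof (intro allI impI)
      fix s :: nat
      assume "s > 0"
      then show "e (Suc (Suc r)) * f s + f s * e (Suc (Suc r)) = h (Suc r + s)"
        using step[of "Suc r" s] Suc[rule_format, of "Suc s"] by simp
    qed
  qed
  then show ?thesis
    using assms by (cases r) auto
qed

text \<open>Unfolding \<open>d_f\<close> down to d_0 = 1. In generating form, f acquires the factor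
  1 - 1/(u - x) when d(u) passes it, x raising the index of f.\<close>

lemma d_f_sum:
  assumes "s > 0"
  shows "d n * f s = f s * d n - (\<Sum>i<n. f (s + i) * d (n - 1 - i))"
  using assms
proof (induction n arbitrary: s)
  case (Suc n)
  have "(\<Sum>i<Suc n. f (s + i) * d (Suc n - 1 - i)) = f s * d n + (\<Sum>i<n. f (Suc s + i) * d (n - 1 - i))"
    by (subst sum.lessThan_Suc_shift) simp
  then show ?case
    using d_f[OF Suc.prems, of n] Suc.IH[of "Suc s"] by (simp add: algebra_simps)
qed (simp add: d_0)

definition "E r s = f r * f s + f s * f r"

lemma E_sym: "E r s = E s r"
  by (simp add: E_def add.commute)

lemma f_1: "f 1 = t I2 I1 1"
  by (simp add: f_def smul_def t_0)

lemma d_f_f: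
  assumes "r > 0" "s > 0"
  shows "d (Suc n) * (f r * f s) = f r * f s * d (Suc n) - (\<Sum>i<Suc n. (f (r + i) * f s + f r * f (s + i)) * d (n - i))
     + (\<Sum>i<Suc n. \<Sum>j<Suc n - 1 - i. f (r + i) * f (s + j) * d (n - i - 1 - j))"
proof -
  have d_Suc: "d (Suc n) * f s = f s * d (Suc n) - (\<Sum>i<Suc n. f (s + i) * d (n - i))" if "s > 0" for s
    using d_f_sum[OF that, of "Suc n"] by simp
  have "d (Suc n) * (f r * f s) = (f r * d (Suc n) - (\<Sum>i<Suc n. f (r + i) * d (n - i))) * f s"
    by (simp only: d_Suc[OF assms(1)] mult.assoc[symmetric])
  also have "\<dots> = f r * (f s * d (Suc n) - (\<Sum>i<Suc n. f (s + i) * d (n - i)))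
     - (\<Sum>i<Suc n. f (r + i) * (f s * d (n - i) - (\<Sum>j<n - i. f (s + j) * d (n - i - 1 - j))))"
    by (simp only: d_Suc[OF assms(2)] d_f_sum[OF assms(2), of "n - i" for i] left_diff_distrib sum_distrib_right mult.assoc)
  finally show ?thesis
    by (simp add: algebra_simps sum.distrib sum_subtractf sum_distrib_left del: sum.lessThan_Suc)
qed

text \<open>Symmetrising \<open>d_f_f\<close> in r and s turns all products of two f into
  anticommutators, because the double sum is symmetric in its two indices.\<close>

lemma E_step:
  assumes "r > 0" "s > 0"
  shows "d (Suc n) * E r s = E r s * d (Suc n) - (\<Sum>i<Suc n. (E (r + i) s + E r (s + i)) * d (n - i))
     + (\<Sum>i<Suc n. \<Sum>j<Suc n - 1 - i. E (r + i) (s + j) * d (n - i - 1 - j))"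
proof -
  have "(\<Sum>i<Suc n. \<Sum>j<Suc n - 1 - i. f (s + i) * f (r + j) * d (n - i - 1 - j))
      = (\<Sum>i<Suc n. \<Sum>j<Suc n - 1 - i. f (s + j) * f (r + i) * d (n - i - 1 - j))"
    by (subst sum_triangle_swap) (simp add: add.commute del: sum.lessThan_Suc)
  then show ?thesis
    unfolding E_def distrib_left[of "d (Suc n)"] d_f_f[OF assms] d_f_f[OF assms(2,1)]
    by (simp add: algebra_simps sum.distrib del: sum.lessThan_Suc)
qed

text \<open>Induction on N = r + s. When all anticommutators of smaller total index vanish, moving d
  past one of them leaves E_{r+n,s} + E_{r,s+n} = 0. For r = s = 1 and by symmetry this reads 2
  E_{1,N-1} = 0, and the same identity carries the vanishing to every E_{r,s} with r + s =
  N.\<close>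

lemma f_f: "f r * f s + f s * f r = 0"
proof -
  have "r > 0 \<Longrightarrow> s > 0 \<Longrightarrow> r + s = N \<Longrightarrow> E r s = 0" for r s N
  proof (induction N arbitrary: r s rule: less_induct)
    case (less N)
    have step: "E (r + n) s + E r (s + n) = 0" if rs: "r > 0" "s > 0" and N: "r + s + n = N" "n > 0" for r s n
    proof -
      have E_zero: "E r s = 0"
        using less.IH[of "r + s" r s] rs N by auto
      have "E (r + i) s = 0" "E r (s + i) = 0" if "i < n" for i
        using less.IH[of "r + s + i" "r + i" s] less.IH[of "r + s + i" r "s + i"] that rs N by auto
      moreover have "E (r + i) (s + j) = 0" if "i + j < n" for i j
        using less.IH[of "r + s + i + j" "r + i" "s + j"] that rs N by auto
      ultimately have "0 = - (E (r + n) s + E r (s + n))"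
        using E_step[OF rs, of n] E_zero N(2) by (simp add: d_0)
      then show ?thesis by (metis neg_0_equal_iff_equal)
    qed
    show ?case
    proof (cases "N = 2")
      case True
      then have rs: "r = 1" "s = 1" using less.prems by auto
      \<comment> \<open>The right side of this RTT relation vanishes because t_21^{(0)} = 0.\<close>
      have "t I2 I1 1 * t I2 I1 1 + t I2 I1 1 * t I2 I1 1 = 0"
        using rtt_coeff[of 1 1 I2 I1 I2 I1] by (simp add: par_def t_0)
      then show ?thesis unfolding rs E_def f_1 .
    next
      case False
      then have "N > 2" using less.prems by linarith
      then have "E (1 + (N - 2)) 1 + E 1 (1 + (N - 2)) = 0"
        by (intro step) auto
      moreover have "1 + (N - 2) = N - 1" using \<open>N > 2\<close> by simp
      moreover have "E (N - 1) 1 = E 1 (N - 1)" by (rule E_sym)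
      ultimately have "E 1 (N - 1) + E 1 (N - 1) = 0" by metis
      then have e1: "E 1 (N - 1) = 0" by (rule two_torsion)
      show ?thesis
      proof (cases "r = 1")
        case True
        then have "s = N - 1" using less.prems by simp
        then show ?thesis unfolding True using e1 by simp
      next
        case False
        then have "E (1 + (r - 1)) s + E 1 (s + (r - 1)) = 0"
          using less.prems by (intro step) auto
        moreover have "s + (r - 1) = N - 1" "1 + (r - 1) = r" using less.prems by auto
        ultimately have "E r s + E 1 (N - 1) = 0" by metis
        then show ?thesis unfolding e1 by simp
      qed
    qed
  qed
  then have "E r s = 0" if "r > 0" "s > 0" using that by blast
  then show ?thesis
    by (cases "r = 0 \<or> s = 0") (auto simp: f_0 E_def)
qed

text \<open>With h written as the anticommutator of e_r and f_s, its commutator with f_u changes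
  sign when s and u are exchanged, since the f anticommute. For s = u = 1 it is therefore its own
  negative, and every other case reduces to u = 1.\<close>

lemma h_f: "h n * f s = f s * h n"
proof -
  define X where "X n s = h n * f s - f s * h n" for n s
  have X: "X (r + s - 1) u = - X (r + u - 1) s" if "r > 0" "s > 0" "u > 0" for r s u
  proof -
    have a: "f u * f s = - (f s * f u)" for u s
      using f_f[of u s] by (simp add: eq_neg_iff_add_eq_0)
    have "X (r + s - 1) u = e r * f s * f u + f s * e r * f u - f u * e r * f s - f u * f s * e r"
      unfolding X_def e_f[OF that(1,2), symmetric] by (simp add: algebra_simps)
    moreover have "X (r + u - 1) s = e r * f u * f s + f u * e r * f s - f s * e r * f u - f s * f u * e r"
      unfolding X_def e_f[OF that(1,3), symmetric] by (simp add: algebra_simps)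
    moreover have "e r * f s * f u = - (e r * f u * f s)"
      using a[of s u] by (simp add: mult.assoc)
    moreover have "f u * f s * e r = - (f s * f u * e r)"
      by (simp add: a[of u s])
    moreover have "x = - x'" if "x = y + z - z' - v" "x' = y' + z' - z - v'" "y = - y'" "v = - v'"
      for x x' y y' z z' v v' :: 'a
      unfolding that by (simp add: algebra_simps)
    ultimately show ?thesis by blast
  qed
  have X1: "X m 1 = 0" if "m > 0" for m
  proof (rule two_torsion)
    have "X m 1 = - X m 1" using X[of m 1 1] that by simp
    then show "X m 1 + X m 1 = 0" by (metis add.right_inverse)
  qed
  have "X n s = 0"
  proof (cases "n = 0 \<or> s = 0")
    case False
    then have "X n s = - X (n + s - 1) 1"
      using X[of n 1 s] by simp
    then show ?thesis using X1[of "n + s - 1"] False by simp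
  qed (auto simp: X_def h_0 f_0)
  then show ?thesis by (simp add: X_def)
qed

end

section \<open>Highest weight modules\<close>

text \<open>The module is the ring modulo the left ideal \<open>K\<close>, with the class of 1 as
  highest weight vector. The locale serves twice: for the Verma module, and with \<open>K\<close>
  replaced by its largest submodule. \<open>gen_induct\<close> says that scalars and the t_ij
  generate the ring.\<close>

locale highest_weight = yangian t for t :: "idx \<Rightarrow> idx \<Rightarrow> nat \<Rightarrow> 'a::ring_1" +
  fixes sc :: "'k::field \<Rightarrow> 'a" and K :: "'a set" and lam1 lam2 :: "nat \<Rightarrow> 'k"
  assumes sc_add: "sc (c + c') = sc c + sc c'"
    and sc_mult: "sc (c * c') = sc c * sc c'"
    and sc_1: "sc 1 = 1"
    and sc_central: "sc c * x = x * sc c"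
    and K_zero: "0 \<in> K"
    and K_add: "x \<in> K \<Longrightarrow> y \<in> K \<Longrightarrow> x + y \<in> K"
    and K_mult: "x \<in> K \<Longrightarrow> a * x \<in> K"
    and gen_induct: "(\<And>c. P (sc c)) \<Longrightarrow> (\<And>x y. P x \<Longrightarrow> P y \<Longrightarrow> P (x + y)) \<Longrightarrow>
      (\<And>i j r x. P x \<Longrightarrow> P (t i j r * x)) \<Longrightarrow> P x"
    and lam_0: "lam1 0 = 1" "lam2 0 = 1"
    and e_K: "e r \<in> K"
    and d_K: "d r - sc (lam1 r) \<in> K"
    and d2_K: "d2 r - sc (lam2 r) \<in> K"
begin

lemma sc_0: "sc 0 = 0"
  using sc_add[of 0 0] by simp

lemma sc_minus: "sc (- x) = - sc x"
  using sc_add[of x "- x"] by (simp add: sc_0 eq_neg_iff_add_eq_0 add.commute)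

lemma sc_sum: "sc (sum g I) = (\<Sum>i\<in>I. sc (g i))"
  by (induction I rule: infinite_finite_induct) (auto simp: sc_0 sc_add)

lemma sc_left: "x * (sc c * y) = sc c * (x * y)"
  by (metis sc_central mult.assoc)

lemma K_minus: "x \<in> K \<Longrightarrow> - x \<in> K"
  using K_mult[of x "- 1"] by simp

definition eqK :: "'a \<Rightarrow> 'a \<Rightarrow> bool" (infix "\<approx>" 50) where
  "x \<approx> y \<longleftrightarrow> x - y \<in> K"

lemma eqK_refl: "x \<approx> x"
  by (simp add: eqK_def K_zero)

lemma eqK_trans [trans]: "x \<approx> y \<Longrightarrow> y \<approx> z \<Longrightarrow> x \<approx> z"
  using K_add[of "x - y" "y - z"] by (simp add: eqK_def)

lemma eqK_mult: "x \<approx> y \<Longrightarrow> a * x \<approx> a * y"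
  using K_mult[of "x - y" a] by (simp add: eqK_def right_diff_distrib)

lemma eqK_minus: "x \<approx> y \<Longrightarrow> - x \<approx> - y"
  using K_minus[of "x - y"] by (simp add: eqK_def)

lemma eqK_sum: "(\<And>i. i \<in> I \<Longrightarrow> g i \<approx> g' i) \<Longrightarrow> sum g I \<approx> sum g' I"
proof (induction I rule: infinite_finite_induct)
  case (insert i I)
  then have "g i - g' i + (sum g I - sum g' I) \<in> K"
    by (intro K_add) (auto simp: eqK_def)
  then show ?case using insert.hyps by (simp add: eqK_def algebra_simps)
qed (simp_all add: eqK_refl)

text \<open>Congruences may only be multiplied from the left, so the central scalar b is moved in
  front of \<open>x\<close> before \<open>x\<close> itself is replaced.\<close>

lemma eqK_sc_mult:
  assumes "x \<approx> sc a" "y \<approx> sc b"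
  shows "x * y \<approx> sc (a * b)"
proof -
  have "x * y \<approx> x * sc b" by (rule eqK_mult) fact
  also have "x * sc b = sc b * x" by (simp add: sc_central)
  also have "\<dots> \<approx> sc b * sc a" by (rule eqK_mult) fact
  also have "\<dots> = sc a * sc b" by (rule sc_central)
  also have "\<dots> = sc (a * b)" by (simp add: sc_mult)
  finally show ?thesis .
qed

lemma eqK_smul:
  assumes "\<And>n. A n \<approx> sc (a n)" "\<And>n. B n \<approx> sc (b n)"
  shows "smul A B n \<approx> sc (smul a b n)"
  unfolding smul_def sc_sum by (intro eqK_sum eqK_sc_mult assms)

lemma eqK_sinv:
  assumes "\<And>n. A n \<approx> sc (a n)"
  shows "sinv A n \<approx> sc (sinv a n)"
proof (induction n rule: less_induct)
  case (less n)
  show ?case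
  proof (cases "n = 0")
    case True
    then show ?thesis by (simp add: sc_1 eqK_refl)
  next
    case False
    have "(\<Sum>m\<in>{1..n}. A m * sinv A (n - m)) \<approx> (\<Sum>m\<in>{1..n}. sc (a m * sinv a (n - m)))"
      by (intro eqK_sum eqK_sc_mult assms less) auto
    then show ?thesis
      using False by (simp add: sinv.simps[of _ n] sc_minus sc_sum eqK_minus)
  qed
qed

definition "hlam = smul (sinv lam1) lam2"

lemma d_1: "d n \<approx> sc (lam1 n)"
  using d_K by (simp add: eqK_def)

lemma h_1: "h n \<approx> sc (hlam n)"
  unfolding h_def hlam_def by (intro eqK_smul eqK_sinv d_1) (simp add: eqK_def d2_K)

section \<open>Linear spans modulo the left ideal\<close>

inductive_set kspan :: "'a set \<Rightarrow> 'a set" for X where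
  zero: "0 \<in> kspan X"
| add: "x \<in> kspan X \<Longrightarrow> y \<in> kspan X \<Longrightarrow> x + y \<in> kspan X"
| scale_base: "x \<in> X \<Longrightarrow> sc c * x \<in> kspan X"

lemma kspan_base: "x \<in> X \<Longrightarrow> x \<in> kspan X"
  using kspan.scale_base[of x X 1] by (simp add: sc_1)

lemma kspan_scale: "y \<in> kspan X \<Longrightarrow> sc c * y \<in> kspan X"
  by (induction rule: kspan.induct)
    (auto simp: distrib_left mult.assoc[symmetric] sc_mult[symmetric] intro: kspan.intros)

lemma kspan_mult:
  assumes "y \<in> kspan X" "\<And>x. x \<in> X \<Longrightarrow> a * x \<in> kspan Y"
  shows "a * y \<in> kspan Y"
  using assms(1) by induction (auto simp: distrib_left sc_left intro: kspan.intros assms(2) kspan_scale)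

lemma kspan_minus: "y \<in> kspan X \<Longrightarrow> - y \<in> kspan X"
  using kspan_scale[of y X "- 1"] by (simp add: sc_minus sc_1)

lemma kspan_mono: "y \<in> kspan X \<Longrightarrow> X \<subseteq> kspan Y \<Longrightarrow> y \<in> kspan Y"
  by (induction rule: kspan.induct) (auto intro: kspan.intros kspan_scale)

lemma kspan_prod:
  assumes "x \<in> kspan X" "y \<in> kspan Y" "\<And>a b. a \<in> X \<Longrightarrow> b \<in> Y \<Longrightarrow> a * b \<in> kspan Z"
  shows "x * y \<in> kspan Z"
  using assms(1)
proof induction
  case (scale_base a c)
  have "a * y \<in> kspan Z"
    using assms(2) by (rule kspan_mult) (use scale_base assms(3) in auto)
  then show ?case by (simp add: mult.assoc kspan_scale)
qed (auto simp: distrib_right intro: kspan.intros)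

lemma kspan_finite:
  assumes "finite X" "y \<in> kspan X"
  shows "\<exists>c. y = (\<Sum>x\<in>X. sc (c x) * x)"
  using assms(2)
proof induction
  case zero
  show ?case by (rule exI[of _ "\<lambda>_. 0"]) (simp add: sc_0)
next
  case (add x y)
  then obtain c c' where "x = (\<Sum>x\<in>X. sc (c x) * x)" "y = (\<Sum>x\<in>X. sc (c' x) * x)" by blast
  then show ?case
    by (intro exI[of _ "\<lambda>x. c x + c' x"]) (simp add: sc_add distrib_right sum.distrib)
next
  case (scale_base x c)
  have "(\<Sum>y\<in>X. sc (if y = x then c else 0) * y) = (\<Sum>y\<in>X. if y = x then sc c * x else 0)"
    by (intro sum.cong) (auto simp: sc_0)
  then show ?case
    using scale_base assms(1) by (intro exI[of _ "\<lambda>y. if y = x then c else 0"]) simp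
qed

text \<open>The preimage in the ring of the span that \<open>X\<close> generates in the quotient
  module.\<close>

definition cosp :: "'a set \<Rightarrow> 'a set" where
  "cosp X = {z. \<exists>y\<in>kspan X. z \<approx> y}"

lemma cosp_kspan: "y \<in> kspan X \<Longrightarrow> y \<in> cosp X"
  unfolding cosp_def using eqK_refl by blast

lemma cosp_base: "y \<in> X \<Longrightarrow> y \<in> cosp X"
  by (intro cosp_kspan kspan_base)

lemma cosp_K: "z \<in> K \<Longrightarrow> z \<in> cosp X"
  unfolding cosp_def using kspan.zero[of X] by (auto simp: eqK_def intro!: bexI[of _ 0])

lemma cosp_eqK: "x \<approx> y \<Longrightarrow> y \<in> cosp X \<Longrightarrow> x \<in> cosp X"
  unfolding cosp_def using eqK_trans by blast

lemma cosp_add: "x \<in> cosp X \<Longrightarrow> y \<in> cosp X \<Longrightarrow> x + y \<in> cosp X"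
proof -
  assume "x \<in> cosp X" "y \<in> cosp X"
  then obtain x' y' where "x' \<in> kspan X" "y' \<in> kspan X" "x - x' \<in> K" "y - y' \<in> K"
    by (auto simp: cosp_def eqK_def)
  then show ?thesis
    using K_add[of "x - x'" "y - y'"]
    by (auto simp: cosp_def eqK_def algebra_simps intro!: bexI[of _ "x' + y'"] kspan.add)
qed

lemma cosp_mult:
  assumes "z \<in> cosp X" "\<And>x. x \<in> X \<Longrightarrow> a * x \<in> cosp Y"
  shows "a * z \<in> cosp Y"
proof -
  have scale: "sc c * y \<in> cosp Y" if "y \<in> cosp Y" for c y
    using that kspan_scale eqK_mult unfolding cosp_def by blast
  obtain y where y: "y \<in> kspan X" "z \<approx> y" using assms(1) by (auto simp: cosp_def)
  from y(1) have "a * y \<in> cosp Y"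
    by induction (auto simp: distrib_left sc_left intro: cosp_add assms(2) scale cosp_K K_zero)
  then show ?thesis using eqK_mult[OF y(2)] by (rule cosp_eqK[rotated])
qed

lemma cosp_scale: "z \<in> cosp X \<Longrightarrow> sc c * z \<in> cosp X"
  by (erule cosp_mult) (auto intro: cosp_kspan kspan.scale_base)

lemma cosp_minus: "z \<in> cosp X \<Longrightarrow> - z \<in> cosp X"
  using cosp_scale[of z X "- 1"] by (simp add: sc_minus sc_1)

lemma cosp_diff: "x \<in> cosp X \<Longrightarrow> y \<in> cosp X \<Longrightarrow> x - y \<in> cosp X"
  using cosp_add[OF _ cosp_minus] by fastforce

lemma cosp_sum: "(\<And>i. i \<in> I \<Longrightarrow> g i \<in> cosp X) \<Longrightarrow> sum g I \<in> cosp X"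
  by (induction I rule: infinite_finite_induct) (auto intro: cosp_add cosp_K K_zero)

lemma cosp_mono: "z \<in> cosp X \<Longrightarrow> X \<subseteq> cosp Y \<Longrightarrow> z \<in> cosp Y"
  using cosp_mult[of z X 1 Y] by auto

definition fm :: "nat list \<Rightarrow> 'a" where
  "fm rs = prod_list (map f rs)"

lemma fm_simps [simp]: "fm [] = 1" "fm (r # rs) = f r * fm rs" "fm (rs @ ss) = fm rs * fm ss"
  by (simp_all add: fm_def)

lemma h_fm: "h n * fm rs = fm rs * h n"
proof (induction rs)
  case (Cons r rs)
  have "h n * (f r * fm rs) = f r * (h n * fm rs)"
    by (simp add: mult.assoc[symmetric] h_f)
  then show ?case using Cons by (simp add: mult.assoc)
qed simp

text \<open>A set of vectors on which d, e and h act within its f-span spans a submodule, since the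
  commutation relations move the generators past the f-monomials.\<close>
lemma cosp_left_ideal:
  fixes V :: "'a set"
  defines "X \<equiv> {fm rs * v | rs v. v \<in> V}"
  assumes base: "\<And>n v. v \<in> V \<Longrightarrow> d n * v \<in> cosp X" "\<And>n v. v \<in> V \<Longrightarrow> e n * v \<in> cosp X"
      "\<And>n v. v \<in> V \<Longrightarrow> h n * v \<in> cosp X"
    and z: "z \<in> cosp X"
  shows "a * z \<in> cosp X"
proof -
  have "f r * x \<in> X" if "x \<in> X" for x r
    using that unfolding X_def by (auto simp: mult.assoc[symmetric]) (metis fm_simps(2))
  then have f_closed: "f r * z \<in> cosp X" if "z \<in> cosp X" for z r
    using that by (rule_tac cosp_mult) (auto intro: cosp_base)
  have fm_closed: "fm rs * z \<in> cosp X" if "z \<in> cosp X" for z rs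
    using that by (induction rs) (auto simp: mult.assoc f_closed)
  have h_X: "h n * (fm rs * v) \<in> cosp X" if "v \<in> V" for n rs v
    using fm_closed[OF base(3)[OF that], of rs n] by (simp add: mult.assoc[symmetric] h_fm)
  have d_X: "d n * (fm rs * v) \<in> cosp X" if "v \<in> V" for n rs v
  proof (induction rs arbitrary: n)
    case (Cons s rs)
    show ?case
    proof (cases "s = 0")
      case False
      have "d n * (fm (s # rs) * v) = (d n * f s) * (fm rs * v)"
        by (simp add: mult.assoc)
      also have "\<dots> = f s * (d n * (fm rs * v)) - (\<Sum>i<n. f (s + i) * (d (n - 1 - i) * (fm rs * v)))"
        using False by (simp add: d_f_sum left_diff_distrib sum_distrib_right mult.assoc)
      also have "\<dots> \<in> cosp X"
        by (intro cosp_diff cosp_sum f_closed Cons)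
      finally show ?thesis .
    qed (simp add: f_0 cosp_K K_zero)
  qed (simp add: base that)
  have e_X: "e n * (fm rs * v) \<in> cosp X" if "v \<in> V" for n rs v
  proof (induction rs)
    case (Cons s rs)
    show ?case
    proof (cases "s = 0 \<or> n = 0")
      case False
      then have "e n * f s = h (n + s - 1) - f s * e n"
        using e_f[of n s] by (simp add: eq_diff_eq)
      then have "e n * (fm (s # rs) * v) = h (n + s - 1) * (fm rs * v) - f s * (e n * (fm rs * v))"
        by (simp add: mult.assoc[symmetric]) (simp add: left_diff_distrib mult.assoc)
      also have "\<dots> \<in> cosp X"
        by (intro cosp_diff f_closed Cons h_X that)
      finally show ?thesis .
    qed (auto simp: f_0 e_0 cosp_K K_zero)
  qed (simp add: base that)
  have closed: "d n * z \<in> cosp X" "e n * z \<in> cosp X" "h n * z \<in> cosp X" if "z \<in> cosp X" for z n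
    using that by (auto intro!: cosp_mult[OF that] simp: X_def) (use d_X e_X h_X X_def in auto)
  have "smul A B n * z \<in> cosp X" if "z \<in> cosp X" "\<And>z n. z \<in> cosp X \<Longrightarrow> A n * z \<in> cosp X"
    "\<And>z n. z \<in> cosp X \<Longrightarrow> B n * z \<in> cosp X" for A B z n
    unfolding smul_def sum_distrib_right mult.assoc by (intro cosp_sum that)
  note smul_closed = this[rotated]
  \<comment> \<open>By the Gauss decomposition the t_ij are polynomial in the coefficients of d, e,
    f and h.\<close>
  have t_closed: "t i j r * z \<in> cosp X" if "z \<in> cosp X" for i j r z
  proof -
    have "t I1 I1 r * z \<in> cosp X"
      unfolding d_def[symmetric] using that by (rule closed)
    moreover have "t I1 I2 r * z \<in> cosp X"
      unfolding t12 by (intro smul_closed closed that)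
    moreover have "t I2 I1 r * z \<in> cosp X"
      unfolding t21 by (intro smul_closed closed f_closed that)
    moreover have "t I2 I2 r * z \<in> cosp X"
      unfolding t22 d2_eq distrib_right by (intro cosp_add smul_closed closed f_closed that)
    ultimately show ?thesis by (cases i; cases j) auto
  qed
  have "\<forall>z\<in>cosp X. a * z \<in> cosp X"
    by (rule gen_induct[of "\<lambda>a. \<forall>z\<in>cosp X. a * z \<in> cosp X"])
      (auto simp: distrib_right mult.assoc intro: cosp_scale cosp_add t_closed)
  then show ?thesis using z by blast
qed

text \<open>The highest weight vector alone satisfies the conditions of
  \<open>cosp_left_ideal\<close>: on it d and h are scalar and e is zero.\<close>

lemma span_fm: "z \<in> cosp (range fm)"
proof -
  have X: "{fm rs * v | rs v. v \<in> {1}} = range fm" by auto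
  have "1 \<in> range fm" by (metis fm_simps(1) rangeI)
  then have 1: "sc c \<in> cosp (range fm)" for c
    using cosp_scale[OF cosp_base[of 1 "range fm"], of c] by simp
  have "z * 1 \<in> cosp (range fm)"
    unfolding X[symmetric]
    by (rule cosp_left_ideal; unfold X)
      (auto intro: cosp_eqK[OF d_1 1] cosp_eqK[OF h_1 1] cosp_K e_K cosp_base simp: range_eqI[of _ fm "[]"])
  then show ?thesis by simp
qed

abbreviation "pos_monomials \<equiv> fm ` {rs. rs \<noteq> []}"

text \<open>When 1 is not in \<open>K\<close>, this is the complement of the highest weight line
  spanned by the nonempty f-monomials.\<close>

abbreviation "M0 \<equiv> cosp pos_monomials"

section \<open>Nilpotency and the largest proper submodule\<close>

lemma f_fm_mem: "r \<in> set rs \<Longrightarrow> f r * fm rs = 0"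
proof (induction rs)
  case (Cons s rs)
  have sq: "f r * f r = 0"
    using f_f[of r r] by (rule two_torsion)
  show ?case
  proof (cases "r = s")
    case True
    then show ?thesis using sq by (simp add: mult.assoc[symmetric])
  next
    case False
    have "f r * f s = - (f s * f r)"
      using f_f[of r s] by (simp add: eq_neg_iff_add_eq_0)
    then have "f r * fm (s # rs) = - (f s * (f r * fm rs))"
      by (simp add: mult.assoc[symmetric])
    then show ?thesis using Cons False by simp
  qed
qed simp

lemma fm_not_distinct: "\<not> distinct rs \<Longrightarrow> fm rs = 0"
  by (induction rs) (auto simp: f_fm_mem)

text \<open>Only finitely many f_r occur in the element, say with r < m. Its k-th power consists of
  monomials of length at least k, and beyond length m some factor repeats.\<close>

lemma kspan_pos_nilpotent:
  assumes "y \<in> kspan pos_monomials"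
  shows "\<exists>n. y ^ n = 0"
proof -
  define X where "X m k = fm ` {rs. k \<le> length rs \<and> set rs \<subseteq> {..<m}}" for m k :: nat
  have mono: "y \<in> kspan (X m' k)" if "y \<in> kspan (X m k)" "m \<le> m'" for y m m' k
    using that(1) by (rule kspan_mono) (use that(2) in \<open>auto simp: X_def intro!: kspan_base imageI\<close>)
  from assms obtain m where m: "y \<in> kspan (X m 1)"
  proof (induction arbitrary: thesis)
    case (add x y)
    obtain m m' where "x \<in> kspan (X m 1)" "y \<in> kspan (X m' 1)"
      using add.IH by metis
    then have "x + y \<in> kspan (X (max m m') 1)"
      by (intro kspan.add; elim mono) auto
    then show ?case by (rule add.prems)
  next
    case (scale_base x c)
    then obtain rs where rs: "x = fm rs" "rs \<noteq> []" by auto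
    have "x \<in> X (Suc (Max (set rs))) 1"
      unfolding X_def rs(1) using rs(2) by (intro imageI) (auto simp: less_Suc_eq_le Suc_le_eq)
    then have "sc c * x \<in> kspan (X (Suc (Max (set rs))) 1)"
      by (rule kspan.scale_base)
    then show ?case by (rule scale_base.prems)
  qed (use kspan.zero in blast)
  have "y ^ k \<in> kspan (X m k)" for k
  proof (induction k)
    case 0
    have "1 \<in> X m 0" unfolding X_def by (intro image_eqI[of _ _ "[]"]) auto
    then show ?case by (simp add: kspan_base)
  next
    case (Suc k)
    have "y * y ^ k \<in> kspan (X m (Suc k))"
    proof (rule kspan_prod[OF m Suc])
      fix a b
      assume "a \<in> X m 1" "b \<in> X m k"
      then obtain rs ss where "a = fm rs" "b = fm ss" "1 \<le> length rs" "k \<le> length ss" "set rs \<union> set ss \<subseteq> {..<m}"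
        by (auto simp: X_def)
      then have "a * b \<in> X m (Suc k)"
        unfolding X_def by (intro image_eqI[of _ _ "rs @ ss"]) auto
      then show "a * b \<in> kspan (X m (Suc k))" by (rule kspan_base)
    qed
    then show ?case by simp
  qed
  moreover have "X m (Suc m) \<subseteq> {0}"
  proof -
    have "fm rs = 0" if "Suc m \<le> length rs" "set rs \<subseteq> {..<m}" for rs
    proof (rule fm_not_distinct)
      have "card (set rs) \<le> m" using card_mono[OF _ that(2)] by simp
      then show "\<not> distinct rs" using that(1) distinct_card[of rs] by auto
    qed
    then show ?thesis by (auto simp: X_def)
  qed
  moreover have "z = 0" if "z \<in> kspan (X m (Suc m))" for z
    using that by induction (use \<open>X m (Suc m) \<subseteq> {0}\<close> in auto)
  ultimately show ?thesis by blast
qed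

text \<open>The f-monomials span an exterior algebra, whose augmentation ideal is nil; hence an element
  outside \<open>M0\<close> is invertible modulo \<open>K\<close>.\<close>
lemma proper_subset_M0:
  assumes N: "K \<subseteq> N" "is_left_ideal N" "1 \<notin> N"
  shows "N \<subseteq> M0"
proof
  fix x
  assume x: "x \<in> N"
  have N_add: "a \<in> N \<Longrightarrow> b \<in> N \<Longrightarrow> a + b \<in> N" and N_mult: "a \<in> N \<Longrightarrow> b * a \<in> N" for a b
    using N(2) by (auto simp: is_left_ideal_def)
  obtain z where z: "z \<in> kspan (range fm)" "x \<approx> z"
    using span_fm[of x] by (auto simp: cosp_def)
  have "\<exists>c. \<exists>y\<in>kspan pos_monomials. z = sc c + y"
    using z(1)
  proof induction
    case zero
    show ?case by (intro exI[of _ 0] bexI[of _ 0]) (auto simp: sc_0 intro: kspan.zero)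
  next
    case (add x y)
    then obtain c c' x' y' where "x = sc c + x'" "y = sc c' + y'"
      and xy: "x' \<in> kspan pos_monomials" "y' \<in> kspan pos_monomials" by blast
    then have "x + y = sc (c + c') + (x' + y')" by (simp add: sc_add algebra_simps)
    then show ?case using kspan.add[OF xy] by blast
  next
    case (scale_base x c)
    then obtain rs where rs: "x = fm rs" by auto
    show ?case
    proof (cases "rs = []")
      case True
      then show ?thesis using kspan.zero by (intro exI[of _ c] bexI[of _ 0]) (auto simp: rs)
    next
      case False
      then have "sc c * x \<in> kspan pos_monomials"
        by (intro kspan.scale_base) (auto simp: rs)
      then show ?thesis by (intro exI[of _ 0] bexI[of _ "sc c * x"]) (auto simp: sc_0)
    qed
  qed
  then obtain c y where y: "y \<in> kspan pos_monomials" "z = sc c + y" by blast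
  show "x \<in> M0"
  proof (cases "c = 0")
    case True
    then show ?thesis using y z(2) by (auto simp: cosp_def sc_0)
  next
    case False
    have "z - x \<in> N"
      using z(2) N(1) K_minus[of "x - z"] by (auto simp: eqK_def)
    then have "x + (z - x) \<in> N" using x by (intro N_add)
    then have "sc (inverse c) * z \<in> N" by (simp add: N_mult)
    \<comment> \<open>Chosen so that z = c (1 - w). The sums 1 - w^k that follow arise by left
      multiplication only, as membership in a left ideal demands.\<close>
    moreover define w where "w = sc (- inverse c) * y"
    have "sc (inverse c) * z = 1 - w"
      unfolding y(2) w_def distrib_left sc_mult[symmetric] using False by (simp add: sc_1 sc_minus)
    ultimately have w1: "1 - w \<in> N" by simp
    have "1 - w ^ k \<in> N" for k
    proof (induction k)
      case 0
      show ?case using N(2) by (simp add: is_left_ideal_def)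
    next
      case (Suc k)
      have "(1 - w) + w * (1 - w ^ k) \<in> N" by (intro N_add N_mult w1 Suc)
      then show ?case by (simp add: algebra_simps)
    qed
    moreover obtain k where "w ^ k = 0"
      using kspan_pos_nilpotent[of w] kspan_scale[OF y(1)] by (auto simp: w_def)
    ultimately have "1 \<in> N" by (metis diff_zero)
    then show ?thesis using N(3) by simp
  qed
qed

text \<open>The elements none of whose left multiples has a component along the highest weight
  vector: the largest left ideal inside \<open>M0\<close>.\<close>

definition "rad = {x. \<forall>a. a * x \<in> M0}"

lemma rad_left_ideal: "is_left_ideal rad"
  unfolding is_left_ideal_def rad_def
  by (auto simp: distrib_left mult.assoc[symmetric] intro: cosp_add cosp_K K_zero)

lemma rad_subset: "rad \<subseteq> M0"
  unfolding rad_def by (auto dest: spec[of _ 1])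

lemma K_subset_rad: "K \<subseteq> rad"
  unfolding rad_def by (auto intro: cosp_K K_mult)

lemma one_notin_M0:
  assumes "1 \<notin> K"
  shows "1 \<notin> M0"
proof
  assume "1 \<in> M0"
  then obtain y where y: "y \<in> kspan pos_monomials" "1 - y \<in> K"
    by (auto simp: cosp_def eqK_def)
  have "1 - y ^ k \<in> K" for k
  proof (induction k)
    case (Suc k)
    have "(1 - y) + y * (1 - y ^ k) \<in> K" by (intro K_add K_mult y Suc)
    then show ?case by (simp add: algebra_simps)
  qed (simp add: K_zero)
  moreover obtain k where "y ^ k = 0" using kspan_pos_nilpotent[OF y(1)] by blast
  ultimately have "1 \<in> K" by (metis diff_zero)
  with assms show False ..
qed

text \<open>Modulo \<open>K\<close>, e_s sends the combination of the f_r to exactly this sum as a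
  scalar; a nonzero scalar would put 1 into \<open>M0\<close>.\<close>

lemma rad_dependence:
  assumes "1 \<notin> K" and rad: "(\<Sum>r=1..m. sc (c r) * f r) \<in> rad" and "s > 0"
  shows "(\<Sum>r=1..m. c r * hlam (r + s - 1)) = 0"
proof (rule ccontr)
  let ?x = "\<Sum>r=1..m. c r * hlam (r + s - 1)"
  assume nz: "?x \<noteq> 0"
  have "e s * (\<Sum>r=1..m. sc (c r) * f r) = (\<Sum>r=1..m. sc (c r) * (e s * f r))"
    by (simp add: sum_distrib_left sc_left)
  also have "\<dots> \<approx> (\<Sum>r=1..m. sc (c r) * sc (hlam (r + s - 1)))"
  proof (intro eqK_sum eqK_mult)
    fix r
    assume "r \<in> {1..m}"
    then have "e s * f r = h (r + s - 1) - f r * e s"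
      using e_f[of s r] assms(3) by (simp add: eq_diff_eq add.commute)
    moreover have "h (r + s - 1) - f r * e s \<approx> h (r + s - 1)"
      by (simp add: eqK_def K_minus K_mult e_K)
    ultimately show "e s * f r \<approx> sc (hlam (r + s - 1))"
      using h_1 eqK_trans by metis
  qed
  also have "\<dots> = sc ?x" by (simp add: sc_sum sc_mult)
  finally have "sc ?x - e s * (\<Sum>r=1..m. sc (c r) * f r) \<in> K"
    unfolding eqK_def using K_minus by fastforce
  then have 1: "sc ?x - e s * (\<Sum>r=1..m. sc (c r) * f r) \<in> M0" by (rule cosp_K)
  have 2: "e s * (\<Sum>r=1..m. sc (c r) * f r) \<in> M0" using rad by (simp add: rad_def)
  have "sc ?x \<in> M0" using cosp_add[OF 1 2] by simp
  then have "sc (inverse ?x) * sc ?x \<in> M0" by (rule cosp_scale)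
  then have "1 \<in> M0" using nz by (simp add: sc_mult[symmetric] sc_1)
  then show False using one_notin_M0[OF assms(1)] by simp
qed

text \<open>By the recurrence e kills each combination \<open>y s\<close> of f_s, ..., f_{s+n}
  modulo \<open>K\<close>, while d only shifts s and h commutes with it. These vectors generate a
  submodule inside \<open>M0\<close>, hence inside \<open>rad\<close>, so in the quotient f_{s+n} is
  expressed by lower f.\<close>

lemma rad_finite_codim:
  fixes c :: "nat \<Rightarrow> 'k" and n :: nat
  assumes rec: "\<And>m. m > 0 \<Longrightarrow> (\<Sum>j\<le>n. c j * hlam (m + j)) = 0" and c: "c n = 1"
  shows "\<exists>B. finite B \<and> (\<forall>x. \<exists>a. x - (\<Sum>b\<in>B. sc (a b) * b) \<in> rad)"
proof -
  define y where "y s = (\<Sum>j\<le>n. sc (c j) * f (s + j))" for s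
  define V where "V = y ` {0<..}"
  define X where "X = {fm rs * v | rs v. v \<in> V}"
  have yX: "y s \<in> X" if "s > 0" for s
    unfolding X_def V_def using that by (auto intro!: exI[of _ "[]"])
  have y_sc: "y s * u \<in> cosp X" if "s > 0" "u \<approx> sc a" for s u a
  proof -
    have "y s * u \<approx> sc a * y s"
      using eqK_mult[OF that(2), of "y s"] by (simp add: sc_central)
    then show ?thesis
      by (rule cosp_eqK) (intro cosp_scale cosp_base yX that)
  qed
  have d_y: "d m * v \<in> cosp X" if "v \<in> V" for m v
  proof -
    obtain s where s: "s > 0" "v = y s" using \<open>v \<in> V\<close> by (auto simp: V_def)
    have "d m * v = (\<Sum>j\<le>n. sc (c j) * (f (s + j) * d m)) - (\<Sum>j\<le>n. \<Sum>i<m. sc (c j) * (f (s + i + j) * d (m - 1 - i)))"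
      unfolding s(2) y_def sum_distrib_left sc_left
      using s(1) by (simp add: d_f_sum right_diff_distrib sum_distrib_left sum_subtractf add.commute add.left_commute)
    \<comment> \<open>The inner sums over j reassemble into \<open>y (s + i)\<close>.\<close>
    also have "\<dots> = y s * d m - (\<Sum>i<m. y (s + i) * d (m - 1 - i))"
      by (subst sum.swap) (simp add: y_def sum_distrib_right mult.assoc)
    also have "\<dots> \<in> cosp X"
      using s(1) by (intro cosp_diff cosp_sum y_sc[OF _ d_1]) auto
    finally show ?thesis .
  qed
  have e_y: "e m * v \<in> cosp X" if "v \<in> V" for m v
  proof (cases "m = 0")
    case False
    obtain s where s: "s > 0" "v = y s" using \<open>v \<in> V\<close> by (auto simp: V_def)
    have "e m * v = (\<Sum>j\<le>n. sc (c j) * (e m * f (s + j)))"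
      by (simp add: s(2) y_def sum_distrib_left sc_left)
    also have "\<dots> \<approx> (\<Sum>j\<le>n. sc (c j) * sc (hlam (m + s - 1 + j)))"
    proof (intro eqK_sum eqK_mult)
      fix j
      have "e m * f (s + j) = h (m + s - 1 + j) - f (s + j) * e m"
        using e_f[of m "s + j"] False s(1) by (simp add: eq_diff_eq add.assoc)
      moreover have "h (m + s - 1 + j) - f (s + j) * e m \<approx> h (m + s - 1 + j)"
        by (simp add: eqK_def K_minus K_mult e_K)
      ultimately show "e m * f (s + j) \<approx> sc (hlam (m + s - 1 + j))"
        using h_1 eqK_trans by metis
    qed
    also have "\<dots> = sc (\<Sum>j\<le>n. c j * hlam (m + s - 1 + j))"
      by (simp add: sc_sum sc_mult)
    \<comment> \<open>Both m and s are positive, so m + s - 1 > 0 and the recurrence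
      applies.\<close>
    also have "\<dots> = 0"
      using False s(1) by (subst rec) (auto simp: sc_0)
    finally show ?thesis by (intro cosp_K) (simp add: eqK_def)
  qed (simp add: e_0 cosp_K K_zero)
  have h_y: "h m * v \<in> cosp X" if "v \<in> V" for m v
  proof -
    obtain s where s: "s > 0" "v = y s" using \<open>v \<in> V\<close> by (auto simp: V_def)
    have "h m * v = y s * h m"
      unfolding s(2) y_def sum_distrib_left sum_distrib_right
      by (intro sum.cong refl) (simp add: sc_left h_f mult.assoc)
    then show ?thesis using y_sc[OF s(1) h_1] by simp
  qed
  have left: "a * z \<in> cosp X" if "z \<in> cosp X" for a z
    using that cosp_left_ideal[of V, folded X_def] d_y e_y h_y by blast
  have "X \<subseteq> M0"
  proof
    fix x
    assume "x \<in> X"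
    then obtain rs s where x: "x = fm rs * y s" by (auto simp: X_def V_def)
    have "x = (\<Sum>j\<le>n. sc (c j) * fm (rs @ [s + j]))"
      by (simp add: x y_def sum_distrib_left sc_left)
    also have "\<dots> \<in> M0"
      by (intro cosp_sum cosp_scale cosp_base imageI) simp
    finally show "x \<in> M0" .
  qed
  then have X_rad: "cosp X \<subseteq> rad"
    unfolding rad_def using left cosp_mono by blast
  \<comment> \<open>Used to move \<open>y s\<close> through a monomial until it meets the highest
    weight vector, where it is known to lie in the submodule.\<close>
  have y_anti: "y s * f r = - (f r * y s)" for s r
  proof -
    have "y s * f r + f r * y s = (\<Sum>j\<le>n. sc (c j) * (f (s + j) * f r + f r * f (s + j)))"
      by (simp add: y_def sum_distrib_left sum_distrib_right sum.distrib distrib_left sc_left mult.assoc)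
    then show ?thesis by (simp add: f_f eq_neg_iff_add_eq_0)
  qed
  have y_fm: "y s * fm rs \<in> cosp X" if "s > 0" for s rs
  proof (induction rs)
    case Nil
    then show ?case using that by (simp add: cosp_base yX)
  next
    case (Cons r rs)
    have "y s * fm (r # rs) = - (f r * (y s * fm rs))"
      by (simp add: mult.assoc[symmetric] y_anti)
    then show ?case using left[OF Cons, of "f r"] by (simp add: cosp_minus)
  qed
  define B where "B = fm ` {rs. set rs \<subseteq> {1..n} \<and> distinct rs}"
  have rad: "0 \<in> rad" "\<And>x y. x \<in> rad \<Longrightarrow> y \<in> rad \<Longrightarrow> x + y \<in> rad" "\<And>a x. x \<in> rad \<Longrightarrow> a * x \<in> rad"
    using rad_left_ideal by (auto simp: is_left_ideal_def)
  \<comment> \<open>The same span calculus, now in the quotient by \<open>rad\<close>.\<close>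
  interpret R: highest_weight t sc rad lam1 lam2
  proof unfold_locales
    show "P x" if "\<And>c. P (sc c)" "\<And>x y. P x \<Longrightarrow> P y \<Longrightarrow> P (x + y)" "\<And>i j r x. P x \<Longrightarrow> P (t i j r * x)" for P x
      using that by (rule gen_induct)
    show "e r \<in> rad" "d r - sc (lam1 r) \<in> rad" "d2 r - sc (lam2 r) \<in> rad" for r
      using K_subset_rad e_K d_K d2_K by auto
  qed (fact sc_add sc_mult sc_1 sc_central lam_0 rad)+
  have f_B: "f r * b \<in> R.cosp B" if "b \<in> B" for b r
  proof (induction r rule: less_induct)
    case (less r)
    obtain rs where rs: "b = fm rs" "set rs \<subseteq> {1..n}" "distinct rs" using \<open>b \<in> B\<close> by (auto simp: B_def)
    consider "r = 0" | "r \<in> {1..n}" | "r > n" by force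
    then show ?case
    proof cases
      case 1
      then show ?thesis by (simp add: f_0 R.cosp_K R.K_zero)
    next
      case 2
      show ?thesis
      proof (cases "r \<in> set rs")
        case True
        then show ?thesis by (simp add: rs f_fm_mem R.cosp_K R.K_zero)
      next
        case False
        then have "fm (r # rs) \<in> B" unfolding B_def using rs 2 by (intro imageI) auto
        then show ?thesis by (simp add: rs R.cosp_base)
      qed
    next
      case 3
      \<comment> \<open>As r > n, the index r - n is positive, and \<open>c n = 1\<close> makes f_r
        the leading term.\<close>
      have "y (r - n) = (\<Sum>j<n. sc (c j) * f (r - n + j)) + f r"
        unfolding y_def lessThan_Suc_atMost[symmetric] using 3 c by (simp add: sc_1)
      then have "f r * b = y (r - n) * b + (\<Sum>j<n. sc (- c j) * (f (r - n + j) * b))"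
        by (simp add: algebra_simps sum_distrib_right sc_minus sum_negf)
      also have "\<dots> \<in> R.cosp B"
        using 3 y_fm[of "r - n" rs] X_rad rs(1)
        by (intro R.cosp_add R.cosp_sum R.cosp_scale less R.cosp_K) auto
      finally show ?thesis .
    qed
  qed
  have f_C: "f r * z \<in> R.cosp B" if "z \<in> R.cosp B" for r z
    using that f_B by (rule R.cosp_mult)
  have fm_C: "fm rs \<in> R.cosp B" for rs
  proof (induction rs)
    case Nil
    have "fm [] \<in> B" unfolding B_def by (intro imageI) auto
    then show ?case by (intro R.cosp_base)
  qed (simp add: f_C)
  have all_C: "z \<in> R.cosp B" for z
    using R.span_fm[of z] fm_C by (auto intro: R.cosp_mono)
  have finB: "finite B"
    unfolding B_def by (intro finite_imageI) (rule finite_subset_distinct, simp)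
  have "\<exists>a. x - (\<Sum>b\<in>B. sc (a b) * b) \<in> rad" for x
  proof -
    obtain b where "b \<in> kspan B" "x - b \<in> rad"
      using all_C[of x] by (auto simp: R.cosp_def R.eqK_def)
    then show ?thesis using kspan_finite[OF finB] by metis
  qed
  then show ?thesis using finB by blast
qed

end

section \<open>Shifts of series\<close>

text \<open>The coefficient of u^{-n} in (u - j)^{-r}, with r = 0 included.\<close>

definition shift_coeff :: "nat \<Rightarrow> nat \<Rightarrow> nat \<Rightarrow> nat" where
  "shift_coeff j r n = (if n = 0 then (if r = 0 then 1 else 0)
     else if r = 0 \<or> n < r then 0 else ((n - 1) choose (n - r)) * j ^ (n - r))"

text \<open>Coefficients of (u - j) (u - j)^{-r-1} = (u - j)^{-r}.\<close>

lemma shift_coeff_Suc: "shift_coeff j (Suc r) (Suc n) = shift_coeff j r n + j * shift_coeff j (Suc r) n"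
proof (cases "n = 0 \<or> r = 0 \<or> n \<le> r")
  case True
  consider "n = 0" | "n > 0" "r = 0" | "n > 0" "r > 0" "n < r" | "n > 0" "r > 0" "n = r"
    using True by force
  then show ?thesis
    by cases (auto simp: shift_coeff_def power_eq_if)
next
  case False
  then obtain k where n: "n = Suc (r + k)" "r > 0"
    by (metis add_Suc_right less_natE not_le_imp_less neq0_conv)
  have "Suc n - Suc r = Suc k" "n - Suc r = k" "n - r = Suc k" using n by auto
  moreover have "(n choose Suc k) = ((n - 1) choose Suc k) + ((n - 1) choose k)"
    using n by simp
  ultimately show ?thesis
    using n by (simp add: shift_coeff_def algebra_simps)
qed

lemma shift_coeff_zero: "n < r \<Longrightarrow> shift_coeff j r n = 0"
  by (simp add: shift_coeff_def)

text \<open>Coefficient form of (u - j)^{-r} (u - j)^{-s} = (u - j)^{-r-s}.\<close>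

lemma shift_coeff_mult: "(\<Sum>i\<le>n. shift_coeff j r i * shift_coeff j s (n - i)) = shift_coeff j (r + s) n"
proof (induction r arbitrary: n)
  case 0
  have "(\<Sum>i\<le>n. shift_coeff j 0 i * shift_coeff j s (n - i)) = (\<Sum>i\<le>n. if i = 0 then shift_coeff j s n else 0)"
    by (intro sum.cong refl) (auto simp: shift_coeff_def)
  then show ?case by simp
next
  case (Suc r)
  show ?case
  proof (induction n)
    case 0
    show ?case by (simp add: shift_coeff_def)
  next
    case (Suc n)
    have "(\<Sum>i\<le>Suc n. shift_coeff j (Suc r) i * shift_coeff j s (Suc n - i))
      = (\<Sum>i\<le>n. shift_coeff j r i * shift_coeff j s (n - i)) + j * (\<Sum>i\<le>n. shift_coeff j (Suc r) i * shift_coeff j s (n - i))"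
      by (subst sum.atMost_Suc_shift)
        (simp add: shift_coeff_Suc shift_coeff_zero sum.distrib sum_distrib_left algebra_simps)
    then show ?case
      by (simp add: Suc.IH \<open>\<And>n. (\<Sum>i\<le>n. shift_coeff j r i * shift_coeff j s (n - i)) = shift_coeff j (r + s) n\<close> shift_coeff_Suc)
  qed
qed

lemma sshift_conv: "sshift (of_nat j) A n = (\<Sum>r\<le>n. of_nat (shift_coeff j r n) * A r)"
proof (cases "n = 0")
  case False
  have "(\<Sum>r\<le>n. of_nat (shift_coeff j r n) * A r) = (\<Sum>r\<in>{1..n}. of_nat (shift_coeff j r n) * A r)"
    by (rule sum.mono_neutral_right) (use False in \<open>auto simp: shift_coeff_def\<close>)
  also have "\<dots> = (\<Sum>r\<in>{1..n}. of_nat ((n - 1) choose (n - r)) * of_nat j ^ (n - r) * A r)"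
    by (intro sum.cong refl) (use False in \<open>auto simp: shift_coeff_def\<close>)
  finally show ?thesis using False by (simp add: sshift_def)
next
  case True
  show ?thesis unfolding True by (simp add: sshift_def shift_coeff_def)
qed

lemma sum_atMost_triangle:
  fixes g :: "nat \<Rightarrow> nat \<Rightarrow> 'a::comm_monoid_add"
  shows "(\<Sum>i\<le>n. \<Sum>j\<le>n - i. g i j) = (\<Sum>k\<le>n. \<Sum>i\<le>k. g i (k - i))"
proof -
  have "{(i, j). i + j \<le> n} = (SIGMA i:{..n}. {..n - i})" by auto
  then show ?thesis
    using sum.triangle_reindex_eq[of g n] by (simp add: sum.Sigma)
qed

text \<open>Substituting u - j is multiplicative even over a noncommutative ring, because the
  expansion coefficients are natural numbers and hence central.\<close>

lemma sshift_smul: "sshift (of_nat j) (smul A B) = smul (sshift (of_nat j) A) (sshift (of_nat j) B)"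
proof
  fix n
  have c: "of_nat k * (x * (of_nat l * y)) = of_nat (k * l) * (x * y)" for k l and x y :: 'a
    by (simp add: mult.assoc) (metis (no_types) mult.assoc mult_of_nat_commute)
  have ext: "sshift (of_nat j) A i = (\<Sum>r\<le>n. of_nat (shift_coeff j r i) * A r)" if "i \<le> n" for i and A :: "nat \<Rightarrow> 'a"
    unfolding sshift_conv by (rule sum.mono_neutral_left) (use that in \<open>auto simp: shift_coeff_zero\<close>)
  have "smul (sshift (of_nat j) A) (sshift (of_nat j) B) n
    = (\<Sum>i\<le>n. \<Sum>r\<le>n. \<Sum>s\<le>n. of_nat (shift_coeff j r i * shift_coeff j s (n - i)) * (A r * B s))"
    unfolding smul_def
    by (intro sum.cong refl) (simp add: ext sum_product mult.assoc c del: of_nat_mult)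
  also have "\<dots> = (\<Sum>r\<le>n. \<Sum>s\<le>n. \<Sum>i\<le>n. of_nat (shift_coeff j r i * shift_coeff j s (n - i)) * (A r * B s))"
    by (rule trans[OF sum.swap sum.cong[OF refl sum.swap]])
  also have "\<dots> = (\<Sum>r\<le>n. \<Sum>s\<le>n. of_nat (shift_coeff j (r + s) n) * (A r * B s))"
    by (simp only: sum_distrib_right[symmetric] of_nat_sum[symmetric] shift_coeff_mult)
  also have "\<dots> = (\<Sum>r\<le>n. \<Sum>s\<le>n - r. of_nat (shift_coeff j (r + s) n) * (A r * B s))"
  proof (rule sum.cong[OF refl], rule sum.mono_neutral_right)
    fix r
    assume "r \<in> {..n}"
    show "\<forall>s\<in>{..n} - {..n - r}. of_nat (shift_coeff j (r + s) n) * (A r * B s) = 0"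
      by (intro ballI, subst shift_coeff_zero) auto
  qed auto
  also have "\<dots> = (\<Sum>k\<le>n. \<Sum>r\<le>k. of_nat (shift_coeff j (r + (k - r)) n) * (A r * B (k - r)))"
    by (rule sum_atMost_triangle)
  also have "\<dots> = sshift (of_nat j) (smul A B) n"
    unfolding sshift_conv smul_def sum_distrib_left by (intro sum.cong refl) simp
  finally show "sshift (of_nat j) (smul A B) n = smul (sshift (of_nat j) A) (sshift (of_nat j) B) n" ..
qed

lemma sshift_sone: "sshift (of_nat j) sone = sone"
  by (rule ext) (auto simp: sshift_def sone_def)

text \<open>The series (u - x - 1)/(u - x), expanded in u^{-1}.\<close>
definition transfer_poly :: "nat \<Rightarrow> 'k::field poly" where
  "transfer_poly n = (if n = 0 then 1 else - monom 1 (n - 1))"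

text \<open>With x = \<open>monom 1 1\<close>, \<open>P k\<close> is (u - x - k)/u, so the series is
  P_1/P_0 and its shift by j is P_{j+1}/P_j. The product telescopes to P_p/P_0, and P_p = P_0
  because p = 0 in the field.\<close>

lemma sprod_shift_transfer_poly:
  assumes "of_nat p = (0 :: 'k::field)"
  shows "sprod_shift p (transfer_poly :: nat \<Rightarrow> 'k poly) = sone"
proof -
  define P :: "nat \<Rightarrow> 'k poly fps" where "P k = 1 - fps_const (monom 1 1 + of_nat k) * fps_X" for k
  define S where "S k = Abs_fps (sshift (of_nat k) (transfer_poly :: nat \<Rightarrow> 'k poly))" for k
  have P_nth: "fps_nth (P k) n = (if n = 0 then 1 else if n = 1 then - (monom 1 1 + of_nat k) else 0)" for k n
    by (auto simp: P_def)
  \<comment> \<open>The shift also affects the denominator u of \<open>P k\<close>; the factor 1 -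
    j/u restores it.\<close>
  have shiftP: "(1 - of_nat j * fps_X) * Abs_fps (sshift (of_nat j) (fps_nth (P k))) = P (k + j)" for j k
  proof (rule fps_ext)
    fix n
    have s: "sshift (of_nat j) (fps_nth (P k)) n = (if n = 0 then 1 else - ((monom 1 1 + of_nat k) * of_nat j ^ (n - 1)))" for n
    proof -
      have "(\<Sum>r\<in>{1..n}. of_nat ((n - 1) choose (n - r)) * of_nat j ^ (n - r) * fps_nth (P k) r)
        = (\<Sum>r\<in>{1..n}. if r = 1 then - ((monom 1 1 + of_nat k) * of_nat j ^ (n - 1)) else 0)"
        by (intro sum.cong refl) (auto simp: P_nth algebra_simps)
      then show ?thesis by (auto simp: sshift_def P_nth algebra_simps)
    qed
    show "fps_nth ((1 - of_nat j * fps_X) * Abs_fps (sshift (of_nat j) (fps_nth (P k)))) n = fps_nth (P (k + j)) n"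
      by (cases n) (auto simp: left_diff_distrib s P_nth mult.assoc fps_of_nat[symmetric] power_eq_if algebra_simps)
  qed
  have "P 0 * Abs_fps (transfer_poly :: nat \<Rightarrow> 'k poly) = P 1"
  proof (rule fps_ext)
    fix n
    show "fps_nth (P 0 * Abs_fps transfer_poly) n = fps_nth (P 1) n"
      by (cases n) (auto simp: P_def left_diff_distrib transfer_poly_def mult.assoc mult_monom)
  qed
  then have "smul (fps_nth (P 0)) transfer_poly = fps_nth (P 1)"
    by (simp add: fps_eq_iff[symmetric] Abs_fps_inject_iff[symmetric] Abs_fps_smul fps_nth_Abs_fps fps_nth_inverse)
  then have "Abs_fps (sshift (of_nat j) (fps_nth (P 0))) * S j = Abs_fps (sshift (of_nat j) (fps_nth (P 1)))" for j
    by (metis Abs_fps_smul S_def sshift_smul)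
  then have "(1 - of_nat j * fps_X) * Abs_fps (sshift (of_nat j) (fps_nth (P 0))) * S j
     = (1 - of_nat j * fps_X) * Abs_fps (sshift (of_nat j) (fps_nth (P 1)))" for j
    by (simp only: mult.assoc)
  then have step: "P j * S j = P (Suc j)" for j
    by (simp only: shiftP) simp
  have prod: "P 0 * prod_list (map S [0..<k]) = P k" for k
    by (induction k) (simp_all add: mult.assoc[symmetric] step)
  have "Abs_fps (foldr (\<lambda>j B. smul (sshift (of_nat j) transfer_poly) B) js (sone :: nat \<Rightarrow> 'k poly)) = prod_list (map S js)" for js
    by (induction js) (simp_all add: Abs_fps_sone Abs_fps_smul S_def)
  then have "Abs_fps (sprod_shift p (transfer_poly :: nat \<Rightarrow> 'k poly)) = prod_list (map S [0..<p])"
    unfolding sprod_shift_def by (simp add: sone_def[abs_def])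
  moreover have "P p = P 0"
    using assms by (simp add: P_def of_nat_poly)
  moreover have "P 0 \<noteq> 0"
    by (auto simp: P_def fps_eq_iff intro!: exI[of _ 0])
  ultimately have "Abs_fps (sprod_shift p (transfer_poly :: nat \<Rightarrow> 'k poly)) = 1"
    using prod[of p] by (simp add: mult_cancel_left2[symmetric])
  then show ?thesis
    by (simp add: Abs_fps_sone[symmetric] Abs_fps_inject_iff)
qed

section \<open>A Fock space realisation of the Verma module\<close>

text \<open>Antisymmetric multilinear functionals on k[x], given by their values on powers of x. On
  functionals, contraction is mere prefixing of a list entry.\<close>

definition alternating :: "(nat list \<Rightarrow> 'k::field) \<Rightarrow> bool" where
  "alternating \<phi> \<longleftrightarrow> (\<forall>u a b v. \<phi> (u @ a # b # v) = - \<phi> (u @ b # a # v))"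

lemma alternating_Cons: "alternating \<phi> \<Longrightarrow> alternating (\<lambda>v. \<phi> (y # v))"
  unfolding alternating_def by (metis append_Cons)

lemma alternating_swap:
  assumes "alternating \<phi>"
  shows "\<phi> (a # b # w) = - \<phi> (b # a # w)"
proof -
  have "\<phi> ([] @ a # b # w) = - \<phi> ([] @ b # a # w)"
    using assms unfolding alternating_def by blast
  then show ?thesis by simp
qed

text \<open>Creation operators: the contraction with \<open>y\<close> anticommutes with them up to the scalar
  \<open>L (m + y)\<close>.\<close>
primrec create :: "(nat \<Rightarrow> 'k::field) \<Rightarrow> nat \<Rightarrow> nat list \<Rightarrow> (nat list \<Rightarrow> 'k) \<Rightarrow> 'k" where
  "create L m [] = (\<lambda>\<phi>. 0)"
| "create L m (y # w) = (\<lambda>\<phi>. L (m + y) * \<phi> w - create L m w (\<lambda>v. \<phi> (y # v)))"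

text \<open>Multiplication by \<open>\<tau>(u) \<Prod>\<^sub>i (1 - 1/(u - x\<^sub>i))\<close>, where \<open>x\<^sub>i\<close> raises the i-th list entry by one.\<close>
primrec diag :: "(nat \<Rightarrow> 'k::field) \<Rightarrow> nat list \<Rightarrow> nat \<Rightarrow> (nat list \<Rightarrow> 'k) \<Rightarrow> 'k" where
  "diag \<tau> [] = (\<lambda>r \<phi>. \<tau> r * \<phi> [])"
| "diag \<tau> (y # w) = (\<lambda>r \<phi>. diag \<tau> w r (\<lambda>v. \<phi> (y # v)) - (\<Sum>i<r. diag \<tau> w (r - 1 - i) (\<lambda>v. \<phi> ((y + i) # v))))"

lemma create_add: "create L m w (\<lambda>v. \<phi> v + \<psi> v) = create L m w \<phi> + create L m w \<psi>"
  and create_scale: "create L m w (\<lambda>v. c * \<phi> v) = c * create L m w \<phi>"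
  by (induction w arbitrary: \<phi> \<psi>) (simp_all add: algebra_simps)

lemma create_minus: "create L m w (\<lambda>v. - \<phi> v) = - create L m w \<phi>"
  using create_scale[of L m w "- 1" \<phi>] by simp

lemma diag_add: "diag \<tau> w r (\<lambda>v. \<phi> v + \<psi> v) = diag \<tau> w r \<phi> + diag \<tau> w r \<psi>"
  by (induction w arbitrary: \<phi> \<psi> r) (simp_all add: algebra_simps sum.distrib)

lemma diag_scale: "diag \<tau> w r (\<lambda>v. c * \<phi> v) = c * diag \<tau> w r \<phi>"
  by (induction w arbitrary: \<phi> r) (simp_all add: algebra_simps sum_distrib_left)

lemma diag_minus: "diag \<tau> w r (\<lambda>v. - \<phi> v) = - diag \<tau> w r \<phi>"
  using diag_scale[of \<tau> w r "- 1" \<phi>] by simp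

lemma create_alternating:
  assumes "alternating \<phi>"
  shows "alternating (\<lambda>w. create L m w \<phi>)"
proof -
  have "create L m (u @ a # b # v) \<phi> = - create L m (u @ b # a # v) \<phi>" for u a b v
    using assms
  proof (induction u arbitrary: \<phi>)
    case Nil
    have *: "create L m (a # b # v) \<phi> = L (m + a) * \<phi> (b # v) - L (m + b) * \<phi> (a # v) + create L m v (\<lambda>w. \<phi> (a # b # w))"
      for a b by simp
    have "(\<lambda>w. \<phi> (a # b # w)) = (\<lambda>w. - \<phi> (b # a # w))"
      using alternating_swap[OF Nil] by blast
    from arg_cong[OF this, of "create L m v"]
    have "create L m v (\<lambda>w. \<phi> (a # b # w)) = - create L m v (\<lambda>w. \<phi> (b # a # w))"
      unfolding create_minus .
    then show ?case unfolding append_Nil *[of a b] *[of b a] by simp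
  next
    case (Cons y u)
    have "\<phi> (u @ a # b # v) = - \<phi> (u @ b # a # v)"
      using Cons.prems unfolding alternating_def by blast
    moreover have "create L m (u @ a # b # v) (\<lambda>v. \<phi> (y # v)) = - create L m (u @ b # a # v) (\<lambda>v. \<phi> (y # v))"
      by (rule Cons.IH[OF alternating_Cons[OF Cons.prems]])
    ultimately show ?case unfolding append_Cons create.simps by simp
  qed
  then show ?thesis unfolding alternating_def by blast
qed

text \<open>Expanding the factors of the two exchanged entries gives a sum over pairs of raises, and
  \<open>sum_triangle_swap\<close> interchanges the two raises.\<close>

lemma diag_alternating:
  assumes "alternating \<phi>"
  shows "alternating (\<lambda>w. diag \<tau> w r \<phi>)"
proof -
  have "diag \<tau> (u @ a # b # v) r \<phi> = - diag \<tau> (u @ b # a # v) r \<phi>" for u a b v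
    using assms
  proof (induction u arbitrary: \<phi> r)
    case Nil
    define D where "D k x y = diag \<tau> v k (\<lambda>w. \<phi> (x # y # w))" for k x y
    have D: "D k x y = - D k y x" for k x y
    proof -
      have "(\<lambda>w. \<phi> (x # y # w)) = (\<lambda>w. - \<phi> (y # x # w))"
        using alternating_swap[OF Nil] by blast
      from arg_cong[OF this, of "diag \<tau> v k"] show ?thesis
        unfolding D_def diag_minus .
    qed
    have exp: "diag \<tau> (a # b # v) r \<phi> = D r a b - (\<Sum>j<r. D (r - 1 - j) a (b + j))
       - (\<Sum>i<r. D (r - 1 - i) (a + i) b) + (\<Sum>i<r. \<Sum>j<r - 1 - i. D (r - 1 - i - 1 - j) (a + i) (b + j))" for a b
      by (simp add: D_def[symmetric] sum_subtractf)
    have "(\<Sum>i<r. \<Sum>j<r - 1 - i. D (r - 1 - i - 1 - j) (a + i) (b + j))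
      = - (\<Sum>i<r. \<Sum>j<r - 1 - i. D (r - 1 - i - 1 - j) (b + i) (a + j))"
    proof -
      have "r - 1 - i - 1 - j = r - 1 - j - 1 - i" for i j by simp
      then have "D (r - 1 - i - 1 - j) (a + i) (b + j) = - D (r - 1 - j - 1 - i) (b + j) (a + i)" for i j
        by (metis D)
      then have "(\<Sum>i<r. \<Sum>j<r - 1 - i. D (r - 1 - i - 1 - j) (a + i) (b + j))
        = (\<Sum>i<r. \<Sum>j<r - 1 - i. - D (r - 1 - j - 1 - i) (b + j) (a + i))"
        by (intro sum.cong refl)
      also have "\<dots> = (\<Sum>j<r. \<Sum>i<r - 1 - j. - D (r - 1 - j - 1 - i) (b + j) (a + i))"
        by (rule sum_triangle_swap)
      finally show ?thesis by (simp add: sum_negf)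
    qed
    moreover have "D r a b = - D r b a" by (rule D)
    moreover have "(\<Sum>j<r. D (r - 1 - j) a (b + j)) = (\<Sum>j<r. - D (r - 1 - j) (b + j) a)"
      by (intro sum.cong refl) (rule D)
    moreover have "(\<Sum>j<r. D (r - 1 - j) (a + j) b) = (\<Sum>j<r. - D (r - 1 - j) b (a + j))"
      by (intro sum.cong refl) (rule D)
    moreover have "x - y - z + v = - (x' - y' - z' + v')" if "v = - v'" "x = - x'" "y = - z'" "z = - y'"
      for x y z v x' y' z' v' :: 'a
      unfolding that by (simp add: algebra_simps)
    ultimately show ?case unfolding append_Nil exp sum_negf by blast
  next
    case (Cons y u)
    show ?case
      using Cons.IH[OF alternating_Cons[OF Cons.prems]] by (simp add: sum_negf)
  qed
  then show ?thesis unfolding alternating_def by blast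
qed

section \<open>Fock space and its ring of linear operators\<close>

typedef (overloaded) 'k fock = "{\<phi> :: nat list \<Rightarrow> 'k::field. alternating \<phi>}"
  morphisms coeff_at Abs_fock
  by (rule exI[of _ "\<lambda>_. 0"]) (simp add: alternating_def)

setup_lifting type_definition_fock

instantiation fock :: (field) ab_group_add
begin
lift_definition zero_fock :: "'a fock" is "\<lambda>_. 0" by (simp add: alternating_def)
lift_definition plus_fock :: "'a fock \<Rightarrow> 'a fock \<Rightarrow> 'a fock" is "\<lambda>x y w. x w + y w"
  unfolding alternating_def by (metis minus_add_distrib)
lift_definition minus_fock :: "'a fock \<Rightarrow> 'a fock \<Rightarrow> 'a fock" is "\<lambda>x y w. x w - y w"
  unfolding alternating_def by (metis minus_diff_minus)
lift_definition uminus_fock :: "'a fock \<Rightarrow> 'a fock" is "\<lambda>x w. - x w"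
  unfolding alternating_def by metis
instance
  by standard (transfer; simp add: fun_eq_iff algebra_simps)+
end

lift_definition fock_scale :: "'k::field \<Rightarrow> 'k fock \<Rightarrow> 'k fock" is "\<lambda>c x w. c * x w"
  unfolding alternating_def by (metis mult_minus_right)

lift_definition vacuum :: "'k::field fock" is "\<lambda>w. if w = [] then 1 else 0"
  by (simp add: alternating_def)

lemma vacuum_nonzero: "(vacuum :: 'k::field fock) \<noteq> 0"
  by transfer (auto simp: fun_eq_iff)

text \<open>The series and the RTT relations are formulated over a type of class
  \<open>ring_1\<close>, so the linear operators are made into such a type.\<close>

typedef (overloaded) 'k op = "{A :: 'k fock \<Rightarrow> 'k::field fock.
    (\<forall>x y. A (x + y) = A x + A y) \<and> (\<forall>c x. A (fock_scale c x) = fock_scale c (A x))}"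
  morphisms app Abs_op
  by (rule exI[of _ "\<lambda>x. x"]) simp

setup_lifting type_definition_op

lemma app_add: "app A (x + y) = app A x + app A y" and app_scale: "app A (fock_scale c x) = fock_scale c (app A x)"
  using app[of A] by auto

lemma fock_scale_simps: "fock_scale c 0 = 0" "fock_scale c (x + y) = fock_scale c x + fock_scale c y"
  "fock_scale c (- x) = - fock_scale c x" "fock_scale c (x - y) = fock_scale c x - fock_scale c y"
  "fock_scale c (fock_scale c' x) = fock_scale (c * c') x" "fock_scale 1 x = x" "fock_scale 0 x = 0"
  "fock_scale (c + c') x = fock_scale c x + fock_scale c' x"
  by (transfer; simp add: fun_eq_iff algebra_simps)+

instantiation op :: (field) ring_1
begin
lift_definition zero_op :: "'a op" is "\<lambda>_. 0" by (simp add: fock_scale_simps)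
lift_definition one_op :: "'a op" is "\<lambda>x. x" by simp
lift_definition plus_op :: "'a op \<Rightarrow> 'a op \<Rightarrow> 'a op" is "\<lambda>A B x. A x + B x"
  by (simp add: fock_scale_simps algebra_simps)
lift_definition minus_op :: "'a op \<Rightarrow> 'a op \<Rightarrow> 'a op" is "\<lambda>A B x. A x - B x"
  by (simp add: fock_scale_simps algebra_simps)
lift_definition uminus_op :: "'a op \<Rightarrow> 'a op" is "\<lambda>A x. - A x"
  by (simp add: fock_scale_simps algebra_simps)
lift_definition times_op :: "'a op \<Rightarrow> 'a op \<Rightarrow> 'a op" is "\<lambda>A B x. A (B x)"
  by simp
instance
proof
  show "(0::'a op) \<noteq> 1"
  proof
    assume "(0::'a op) = 1"
    then have "app (0::'a op) vacuum = app 1 vacuum" by simp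
    then show False by (simp add: zero_op.rep_eq one_op.rep_eq vacuum_nonzero[symmetric])
  qed
qed (transfer; simp add: fun_eq_iff algebra_simps)+
end

lift_definition opscal :: "'k::field \<Rightarrow> 'k op" is fock_scale
  by (simp add: fock_scale_simps mult.commute)

lift_definition fcontract :: "nat \<Rightarrow> 'k::field fock \<Rightarrow> 'k fock" is "\<lambda>y \<phi> w. \<phi> (y # w)"
  by (rule alternating_Cons)

lift_definition fcreate :: "(nat \<Rightarrow> 'k::field) \<Rightarrow> nat \<Rightarrow> 'k fock \<Rightarrow> 'k fock" is "\<lambda>L m \<phi> w. create L m w \<phi>"
  by (rule create_alternating)

lift_definition fdiag :: "(nat \<Rightarrow> 'k::field) \<Rightarrow> nat \<Rightarrow> 'k fock \<Rightarrow> 'k fock" is "\<lambda>\<tau> r \<phi> w. diag \<tau> w r \<phi>"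
  by (rule diag_alternating)

lift_definition contract :: "nat \<Rightarrow> 'k::field op" is fcontract
  by (intro conjI allI; transfer) auto

lift_definition creation :: "(nat \<Rightarrow> 'k::field) \<Rightarrow> nat \<Rightarrow> 'k op" is fcreate
  by (intro conjI allI; transfer) (auto simp: create_add create_scale)

lift_definition diagonal :: "(nat \<Rightarrow> 'k::field) \<Rightarrow> nat \<Rightarrow> 'k op" is fdiag
  by (intro conjI allI; transfer) (auto simp: diag_add diag_scale)

lemma opscal_simps: "opscal (c + c') = opscal c + opscal c'" "opscal (c * c') = opscal c * opscal c'"
  "opscal 1 = 1" "opscal 0 = 0"
  by (transfer; simp add: fun_eq_iff fock_scale_simps)+

lemma opscal_central: "opscal c * A = A * opscal c"
  by transfer (simp add: fun_eq_iff)

lemma coeff_at_simps: "coeff_at (x + y) w = coeff_at x w + coeff_at y w"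
  "coeff_at (x - y) w = coeff_at x w - coeff_at y w" "coeff_at (- x) w = - coeff_at x w"
  "coeff_at 0 w = 0" "coeff_at (fock_scale c x) w = c * coeff_at x w"
  by (transfer; simp)+

lemma app_simps: "app (A + B) x = app A x + app B x" "app (A - B) x = app A x - app B x"
  "app (- A) x = - app A x" "app 0 x = 0" "app 1 x = x" "app (A * B) x = app A (app B x)"
  "app (opscal c) x = fock_scale c x"
  by (transfer; simp)+

lemma coeff_at_contract: "coeff_at (app (contract y) \<phi>) w = coeff_at \<phi> (y # w)"
  by (simp add: contract.rep_eq fcontract.rep_eq)

lemma coeff_at_creation: "coeff_at (app (creation L m) \<phi>) w = create L m w (coeff_at \<phi>)"
  by (simp add: creation.rep_eq fcreate.rep_eq)

lemma coeff_at_diagonal: "coeff_at (app (diagonal \<tau> r) \<phi>) w = diag \<tau> w r (coeff_at \<phi>)"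
  by (simp add: diagonal.rep_eq fdiag.rep_eq)

lemma coeff_at_inject: "(\<And>w. coeff_at x w = coeff_at y w) \<Longrightarrow> x = y"
  by transfer auto

lemma op_eqI: "(\<And>\<phi> w. coeff_at (app A \<phi>) w = coeff_at (app B \<phi>) w) \<Longrightarrow> A = B"
  by (metis app_inject coeff_at_inject ext)

lemma coeff_at_sum: "coeff_at (app (sum g I) \<phi>) w = (\<Sum>i\<in>I. coeff_at (app (g i) \<phi>) w)"
  by (induction I rule: infinite_finite_induct) (auto simp: app_simps coeff_at_simps)

lemma contract_contract: "contract a * contract b = - (contract b * contract a)"
proof (rule op_eqI)
  fix \<phi> :: "'a fock" and w
  have "alternating (coeff_at \<phi>)" using coeff_at[of \<phi>] by simp
  then have "coeff_at \<phi> ([] @ a # b # w) = - coeff_at \<phi> ([] @ b # a # w)"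
    unfolding alternating_def by blast
  then show "coeff_at (app (contract a * contract b) \<phi>) w = coeff_at (app (- (contract b * contract a)) \<phi>) w"
    by (simp add: app_simps coeff_at_contract coeff_at_simps)
qed

lemma contract_creation: "contract y * creation L m = opscal (L (m + y)) - creation L m * contract y"
proof (rule op_eqI)
  fix \<phi> :: "'a fock" and w
  have "coeff_at (app (contract y) \<phi>) = (\<lambda>v. coeff_at \<phi> (y # v))"
    by (rule ext) (rule coeff_at_contract)
  then show "coeff_at (app (contract y * creation L m) \<phi>) w
      = coeff_at (app (opscal (L (m + y)) - creation L m * contract y) \<phi>) w"
    by (simp add: app_simps coeff_at_contract coeff_at_creation coeff_at_simps)
qed

lemma contract_diagonal: "contract y * diagonal \<tau> r
    = diagonal \<tau> r * contract y - (\<Sum>i<r. diagonal \<tau> (r - 1 - i) * contract (y + i))"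
proof (rule op_eqI)
  fix \<phi> :: "'a fock" and w
  have "coeff_at (app (contract y) \<phi>) = (\<lambda>v. coeff_at \<phi> (y # v))" for y
    by (rule ext) (rule coeff_at_contract)
  then show "coeff_at (app (contract y * diagonal \<tau> r) \<phi>) w
      = coeff_at (app (diagonal \<tau> r * contract y - (\<Sum>i<r. diagonal \<tau> (r - 1 - i) * contract (y + i))) \<phi>) w"
    by (simp add: app_simps coeff_at_contract coeff_at_diagonal coeff_at_simps coeff_at_sum)
qed

section \<open>Operator identities by induction on list length\<close>

definition vanishes :: "nat \<Rightarrow> 'k::field op \<Rightarrow> bool" where
  "vanishes n A \<longleftrightarrow> (\<forall>\<phi> w. length w < n \<longrightarrow> coeff_at (app A \<phi>) w = 0)"

lemma vanishes_0: "vanishes 0 A"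
  by (simp add: vanishes_def)

text \<open>An operator is determined by its coefficient at the empty list and by its composites
  with a contraction on the left. Identities follow by moving the contraction to the right, where
  \<open>vanishes_mult\<close> absorbs it.\<close>

lemma vanishes_Suc:
  "vanishes (Suc n) A \<longleftrightarrow> (\<forall>\<phi>. coeff_at (app A \<phi>) [] = 0) \<and> (\<forall>y. vanishes n (contract y * A))"
proof -
  have "(\<forall>w. length w < Suc n \<longrightarrow> P w) \<longleftrightarrow> P [] \<and> (\<forall>y w. length w < n \<longrightarrow> P (y # w))" for P :: "nat list \<Rightarrow> bool"
    by (metis Suc_less_eq length_Cons list.exhaust list.size(3) zero_less_Suc)
  from this[of "\<lambda>w. coeff_at (app A \<phi>) w = 0" for \<phi>] show ?thesis
    by (auto simp: vanishes_def app_simps coeff_at_contract)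
qed

lemma vanishes_zero: "vanishes n 0"
  and vanishes_add: "vanishes n A \<Longrightarrow> vanishes n B \<Longrightarrow> vanishes n (A + B)"
  and vanishes_diff: "vanishes n A \<Longrightarrow> vanishes n B \<Longrightarrow> vanishes n (A - B)"
  and vanishes_uminus: "vanishes n A \<Longrightarrow> vanishes n (- A)"
  and vanishes_mult: "vanishes n A \<Longrightarrow> vanishes n (A * B)"
  by (simp_all add: vanishes_def app_simps coeff_at_simps)

lemma vanishes_sum: "(\<And>i. i \<in> I \<Longrightarrow> vanishes n (g i)) \<Longrightarrow> vanishes n (sum g I)"
  by (induction I rule: infinite_finite_induct) (auto intro: vanishes_zero vanishes_add)

lemmas vanishes_intros = vanishes_zero vanishes_add vanishes_diff vanishes_uminus vanishes_mult vanishes_sum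

lemma vanishes_eqI: "(\<And>n. vanishes n (A - B)) \<Longrightarrow> A = B"
proof (rule op_eqI)
  fix \<phi> w
  assume "\<And>n. vanishes n (A - B)"
  from this[of "Suc (length w)"] show "coeff_at (app A \<phi>) w = coeff_at (app B \<phi>) w"
    by (auto simp: vanishes_def app_simps coeff_at_simps)
qed

text \<open>The anticommutator commutes with every contraction, since the scalar terms cancel, and
  it vanishes at the empty list.\<close>

lemma creation_anticommute: "creation L m * creation L m' = - (creation L m' * creation L m)"
proof -
  have "vanishes n (creation L m * creation L m' + creation L m' * creation L m)" for n
  proof (induction n)
    case (Suc n)
    have "contract y * (creation L m * creation L m' + creation L m' * creation L m)
      = (creation L m * creation L m' + creation L m' * creation L m) * contract y" for y
    proof -
      have "contract y * creation L m * creation L m' + contract y * creation L m' * creation L m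
        = (creation L m * creation L m' + creation L m' * creation L m) * contract y"
        by (simp add: contract_creation left_diff_distrib right_diff_distrib distrib_right mult.assoc opscal_central)
      then show ?thesis by (simp add: distrib_left mult.assoc)
    qed
    then show ?case
      using Suc by (simp add: vanishes_Suc vanishes_mult app_simps coeff_at_simps coeff_at_creation)
  qed (rule vanishes_0)
  then show ?thesis
    by (intro vanishes_eqI) simp
qed

lemma contract_diagonal2: "contract y * (diagonal \<tau> r * A)
    = diagonal \<tau> r * (contract y * A) - (\<Sum>i<r. diagonal \<tau> (r - 1 - i) * (contract (y + i) * A))"
  using arg_cong[OF contract_diagonal, of "\<lambda>B. B * A"]
  by (simp add: mult.assoc left_diff_distrib sum_distrib_right)

lemma vacuum_diagonal: "coeff_at (app (diagonal \<tau> r) \<phi>) [] = \<tau> r * coeff_at \<phi> []"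
  by (simp add: coeff_at_diagonal)

lemma vacuum_creation: "coeff_at (app (creation L m) \<phi>) [] = 0"
  by (simp add: coeff_at_creation)

lemma diagonal_0: "\<tau> 0 = 1 \<Longrightarrow> diagonal \<tau> 0 = 1"
proof -
  assume t: "\<tau> 0 = 1"
  have "vanishes n (diagonal \<tau> 0 - 1)" for n
  proof (induction n)
    case (Suc n)
    have "contract y * (diagonal \<tau> 0 - 1) = (diagonal \<tau> 0 - 1) * contract y" for y
      by (simp add: right_diff_distrib left_diff_distrib contract_diagonal)
    then show ?case using Suc t
      by (simp add: vanishes_Suc vanishes_mult app_simps coeff_at_simps vacuum_diagonal)
  qed (rule vanishes_0)
  then show ?thesis by (rule vanishes_eqI)
qed

text \<open>A contraction moved past the commutator leaves commutators of indices at most r and s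
  followed by contractions, so the induction treats all r and s at once.\<close>

lemma diagonal_commute: "diagonal \<tau> r * diagonal \<sigma> s = diagonal \<sigma> s * diagonal \<tau> r"
proof -
  define X where "X r s = diagonal \<tau> r * diagonal \<sigma> s - diagonal \<sigma> s * diagonal \<tau> r" for r s
  have "\<forall>r s. vanishes n (X r s)" for n
  proof (induction n)
    case (Suc n)
    have "contract y * X r s = X r s * contract y - (\<Sum>j<s. X r (s - 1 - j) * contract (y + j))
       - (\<Sum>i<r. X (r - 1 - i) s * contract (y + i))
       + (\<Sum>i<r. \<Sum>j<s. X (r - 1 - i) (s - 1 - j) * contract (y + i + j))" for y r s
    proof -
      have "(\<Sum>j<s. \<Sum>i<r. diagonal \<sigma> (s - 1 - j) * (diagonal \<tau> (r - 1 - i) * contract (y + j + i)))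
        = (\<Sum>i<r. \<Sum>j<s. diagonal \<sigma> (s - 1 - j) * (diagonal \<tau> (r - 1 - i) * contract (y + i + j)))"
        by (subst sum.swap, intro sum.cong refl) (simp add: add_ac)
      then show ?thesis
        unfolding X_def
        by (simp add: right_diff_distrib left_diff_distrib contract_diagonal2 contract_diagonal
          sum_subtractf sum_distrib_left mult.assoc)
    qed
    moreover have "coeff_at (app (X r s) \<phi>) [] = 0" for r s \<phi>
      by (simp add: X_def app_simps coeff_at_simps vacuum_diagonal)
    ultimately show ?case
      using Suc unfolding vanishes_Suc by (auto intro!: vanishes_intros)
  qed (simp add: vanishes_0)
  then show ?thesis
    by (intro vanishes_eqI) (simp add: X_def)
qed

text \<open>The defect \<open>X r\<close> again reproduces itself with indices at most r. The scalar
  terms cancel because L is evaluated at m + y: raising the list entry by i has the same effect as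
  raising m by i.\<close>

lemma diagonal_creation: "diagonal \<tau> r * creation L m
    = creation L m * diagonal \<tau> r - (\<Sum>i<r. creation L (m + i) * diagonal \<tau> (r - 1 - i))"
proof -
  define X where "X r = diagonal \<tau> r * creation L m - (creation L m * diagonal \<tau> r
    - (\<Sum>i<r. creation L (m + i) * diagonal \<tau> (r - 1 - i)))" for r
  have "\<forall>r. vanishes n (X r)" for n
  proof (induction n)
    case (Suc n)
    have step: "contract y * X r = - (X r * contract y) + (\<Sum>j<r. X (r - 1 - j) * contract (y + j))" for y r
    proof -
      have c2: "contract y * (creation L k * A) = opscal (L (k + y)) * A - creation L k * (contract y * A)" for k y A
        using arg_cong[OF contract_creation, of "\<lambda>B. B * A"] by (simp add: mult.assoc left_diff_distrib)
      have "(\<Sum>i<r. \<Sum>j<r - 1 - i. creation L (m + i) * (diagonal \<tau> (r - 1 - i - 1 - j) * contract (y + j)))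
         = (\<Sum>j<r. \<Sum>i<r - 1 - j. creation L (m + i) * (diagonal \<tau> (r - 1 - j - 1 - i) * contract (y + j)))"
        by (subst sum_triangle_swap) (simp add: add.commute)
      moreover have "(\<Sum>i<r. diagonal \<tau> (r - 1 - i) * opscal (L (m + (y + i)))) = (\<Sum>i<r. opscal (L (m + i + y)) * diagonal \<tau> (r - 1 - i))"
        by (intro sum.cong refl) (simp add: opscal_central add.assoc add.commute[of y])
      moreover have "contract y * X r = diagonal \<tau> r * opscal (L (m + y)) - diagonal \<tau> r * (creation L m * contract y)
        - ((\<Sum>i<r. diagonal \<tau> (r - 1 - i) * opscal (L (m + (y + i))))
            - (\<Sum>i<r. diagonal \<tau> (r - 1 - i) * (creation L m * contract (y + i))))
        - (opscal (L (m + y)) * diagonal \<tau> r - creation L m * (diagonal \<tau> r * contract y)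
            + (\<Sum>j<r. creation L m * (diagonal \<tau> (r - 1 - j) * contract (y + j))))
        + ((\<Sum>i<r. opscal (L (m + i + y)) * diagonal \<tau> (r - 1 - i))
            - (\<Sum>i<r. creation L (m + i) * (diagonal \<tau> (r - 1 - i) * contract y))
            + (\<Sum>i<r. \<Sum>j<r - 1 - i. creation L (m + i) * (diagonal \<tau> (r - 1 - i - 1 - j) * contract (y + j))))"
        unfolding X_def
        by (simp add: right_diff_distrib contract_diagonal2 contract_diagonal c2 contract_creation
          sum_subtractf sum_distrib_left del: opscal_central)
      moreover have "- (X r * contract y) + (\<Sum>j<r. X (r - 1 - j) * contract (y + j))
        = - (diagonal \<tau> r * (creation L m * contract y)) + creation L m * (diagonal \<tau> r * contract y)
           - (\<Sum>i<r. creation L (m + i) * (diagonal \<tau> (r - 1 - i) * contract y))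
          + ((\<Sum>j<r. diagonal \<tau> (r - 1 - j) * (creation L m * contract (y + j)))
             - (\<Sum>j<r. creation L m * (diagonal \<tau> (r - 1 - j) * contract (y + j)))
             + (\<Sum>j<r. \<Sum>i<r - 1 - j. creation L (m + i) * (diagonal \<tau> (r - 1 - j - 1 - i) * contract (y + j))))"
        unfolding X_def
        by (simp add: right_diff_distrib left_diff_distrib sum_distrib_right sum_subtractf sum.distrib mult.assoc)
      moreover have "diagonal \<tau> r * opscal (L (m + y)) = opscal (L (m + y)) * diagonal \<tau> r"
        by (rule opscal_central[symmetric])
      ultimately show ?thesis by (simp only:) (simp add: algebra_simps)
    qed
    have "coeff_at (app (X r) \<phi>) [] = 0" for r \<phi>
      by (simp add: X_def app_simps coeff_at_simps coeff_at_sum vacuum_diagonal vacuum_creation)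
    then show ?case
      unfolding vanishes_Suc step using Suc by (auto intro!: vanishes_intros)
  qed (simp add: vanishes_0)
  then show ?thesis
    by (intro vanishes_eqI) (simp add: X_def)
qed

section \<open>Symbol calculus for operator series\<close>

definition contract_poly :: "'k::field poly \<Rightarrow> 'k op" where
  "contract_poly a = (\<Sum>j\<le>degree a. opscal (coeff a j) * contract j)"

lemma contract_poly_conv:
  assumes "degree a \<le> N"
  shows "contract_poly a = (\<Sum>j\<le>N. opscal (coeff a j) * contract j)"
  unfolding contract_poly_def
  by (rule sum.mono_neutral_left) (use assms in \<open>auto simp: coeff_eq_0 opscal_simps\<close>)

lemma contract_poly_add: "contract_poly (a + b) = contract_poly a + contract_poly b"
proof -
  let ?N = "max (degree a) (degree b)"
  have "degree (a + b) \<le> ?N" by (rule degree_add_le) auto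
  then show ?thesis
    by (simp add: contract_poly_conv[of _ ?N] opscal_simps distrib_right sum.distrib)
qed

lemma contract_poly_0: "contract_poly 0 = 0"
  by (simp add: contract_poly_def opscal_simps)

lemma contract_poly_sum: "contract_poly (sum g I) = (\<Sum>i\<in>I. contract_poly (g i))"
  by (induction I rule: infinite_finite_induct) (auto simp: contract_poly_0 contract_poly_add)

lemma contract_poly_monom: "contract_poly (monom c j) = opscal c * contract j"
proof -
  have "contract_poly (monom c j) = (\<Sum>i\<le>j. opscal (coeff (monom c j) i) * contract i)"
    by (rule contract_poly_conv) (rule degree_monom_le)
  also have "\<dots> = (\<Sum>i\<le>j. if i = j then opscal c * contract j else 0)"
    by (intro sum.cong refl) (auto simp: opscal_simps)
  finally show ?thesis by simp
qed

lemma contract_poly_uminus: "contract_poly (- a) = - contract_poly a"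
  using contract_poly_add[of a "- a"] by (simp add: contract_poly_0 eq_neg_iff_add_eq_0 add.commute)

lemma contract_poly_of_nat: "contract_poly (of_nat n * a) = of_nat n * contract_poly a"
  by (induction n) (auto simp: contract_poly_0 contract_poly_add distrib_right)

lemma poly_monom_induct:
  assumes "\<And>c j. P (monom c j)" "\<And>a b. P a \<Longrightarrow> P b \<Longrightarrow> P (a + b)"
  shows "P (a :: 'k::comm_monoid_add poly)"
proof -
  have "P (\<Sum>i\<le>n. monom (coeff a i) i)" for n
    by (induction n) (auto intro: assms)
  then show ?thesis by (metis poly_as_sum_of_monoms)
qed

text \<open>The operator series \<open>X\<close> acts on the i-th list entry as multiplication by \<open>\<alpha>\<close>, and on the
  vacuum coefficient as multiplication by \<open>\<tau>\<close>; this determines \<open>X\<close>.\<close>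
definition has_symbol :: "(nat \<Rightarrow> 'k::field op) \<Rightarrow> (nat \<Rightarrow> 'k poly) \<Rightarrow> (nat \<Rightarrow> 'k) \<Rightarrow> bool" where
  "has_symbol X \<alpha> \<tau> \<longleftrightarrow>
     (\<forall>a n. contract_poly a * X n = smul X (\<lambda>i. contract_poly (\<alpha> i * a)) n) \<and>
     (\<forall>n \<phi>. coeff_at (app (X n) \<phi>) [] = \<tau> n * coeff_at \<phi> [])"

lemma has_symbolD: "has_symbol X \<alpha> \<tau> \<Longrightarrow> smul (\<lambda>i. if i = 0 then contract_poly a else 0) X = smul X (\<lambda>i. contract_poly (\<alpha> i * a))"
  by (rule ext) (simp add: smul_const_left has_symbol_def)

lemma has_symbol_vacuum: "has_symbol X \<alpha> \<tau> \<Longrightarrow> coeff_at (app (X n) \<phi>) [] = \<tau> n * coeff_at \<phi> []"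
  by (simp add: has_symbol_def)

lemma has_symbolI:
  assumes "\<And>a. smul (\<lambda>i. if i = 0 then contract_poly a else 0) X = smul X (\<lambda>i. contract_poly (\<alpha> i * a))"
    and "\<And>n \<phi>. coeff_at (app (X n) \<phi>) [] = \<tau> n * coeff_at \<phi> []"
  shows "has_symbol X \<alpha> \<tau>"
  unfolding has_symbol_def using assms(2) by (simp add: assms(1)[symmetric] smul_const_left)

text \<open>The symbol prescribes how contractions move to the right and \<tau> prescribes the empty
  list, so \<open>vanishes_Suc\<close> applies. This reduces b_i(u) = 1 in the model to identities
  between commutative series.\<close>

lemma has_symbol_unique:
  assumes "has_symbol X \<alpha> \<tau>" "has_symbol Y \<alpha> \<tau>"
  shows "X = Y"
proof
  fix n
  have "\<forall>n. vanishes k (X n - Y n)" for k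
  proof (induction k)
    case (Suc k)
    have "contract y * (X n - Y n) = (\<Sum>m\<le>n. (X m - Y m) * contract_poly (\<alpha> (n - m) * monom 1 y))" for y n
    proof -
      have eq: "contract y = contract_poly (monom 1 y)"
        by (simp add: contract_poly_monom opscal_simps)
      show ?thesis
        unfolding eq using assms unfolding has_symbol_def smul_def
        by (simp add: right_diff_distrib left_diff_distrib sum_subtractf)
    qed
    then show ?case
      using Suc assms unfolding vanishes_Suc
      by (auto intro!: vanishes_sum vanishes_mult simp: app_simps coeff_at_simps has_symbol_vacuum)
  qed (simp add: vanishes_0)
  then show "X n = Y n" by (intro vanishes_eqI) blast
qed

lemma has_symbol_sone: "has_symbol sone sone sone"
proof (rule has_symbolI)
  fix a :: "'a poly"
  show "smul (\<lambda>i. if i = 0 then contract_poly a else 0) sone = smul sone (\<lambda>i. contract_poly (sone i * a))"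
    by (auto simp: sone_def contract_poly_0)
qed (auto simp: sone_def app_simps coeff_at_simps)

lemma vacuum_smul:
  assumes "\<And>n \<phi>. coeff_at (app (X n) \<phi>) [] = \<tau> n * coeff_at \<phi> []"
    and "\<And>n \<phi>. coeff_at (app (Y n) \<phi>) [] = \<sigma> n * coeff_at \<phi> []"
  shows "coeff_at (app (smul X Y n) \<phi>) [] = smul \<tau> \<sigma> n * coeff_at \<phi> []"
  using assms by (simp add: smul_def coeff_at_sum app_simps sum_distrib_right mult.assoc)

text \<open>Contraction with a series of polynomials: this is what the second factor of a product
  meets once the first has been passed.\<close>

lemma has_symbol_contract_mult:
  assumes "has_symbol X \<alpha> \<tau>"
  shows "smul (\<lambda>i. contract_poly (\<gamma> i * a)) X = smul X (\<lambda>i. contract_poly (smul \<gamma> \<alpha> i * a))"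
proof
  fix n
  have "contract_poly b * X m = (\<Sum>j\<le>m. X (m - j) * contract_poly (\<alpha> j * b))" for b m
    using assms by (simp add: has_symbol_def smul_rev[of X])
  then have "smul (\<lambda>i. contract_poly (\<gamma> i * a)) X n
    = (\<Sum>i\<le>n. \<Sum>j\<le>n - i. X (n - i - j) * contract_poly (\<alpha> j * (\<gamma> i * a)))"
    by (simp add: smul_def)
  also have "\<dots> = (\<Sum>k\<le>n. \<Sum>i\<le>k. X (n - i - (k - i)) * contract_poly (\<alpha> (k - i) * (\<gamma> i * a)))"
    by (rule sum_atMost_triangle)
  also have "\<dots> = (\<Sum>k\<le>n. X (n - k) * contract_poly (smul \<gamma> \<alpha> k * a))"
    by (intro sum.cong refl)
      (auto simp: smul_def sum_distrib_right contract_poly_sum sum_distrib_left mult_ac intro!: sum.cong)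
  finally show "smul (\<lambda>i. contract_poly (\<gamma> i * a)) X n = smul X (\<lambda>i. contract_poly (smul \<gamma> \<alpha> i * a)) n"
    by (simp add: smul_rev[of X])
qed

lemma has_symbol_smul:
  assumes X: "has_symbol X \<alpha> \<tau>" and Y: "has_symbol Y \<beta> \<sigma>"
  shows "has_symbol (smul X Y) (smul \<alpha> \<beta>) (smul \<tau> \<sigma>)"
proof (rule has_symbolI)
  fix a :: "'a poly"
  show "smul (\<lambda>i. if i = 0 then contract_poly a else 0) (smul X Y) = smul (smul X Y) (\<lambda>i. contract_poly (smul \<alpha> \<beta> i * a))"
    by (simp only: smul_assoc[symmetric] has_symbolD[OF X])
      (simp only: smul_assoc has_symbol_contract_mult[OF Y])
qed (rule vacuum_smul; rule has_symbol_vacuum; fact)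

lemma sshift_const: "sshift (of_nat j) (\<lambda>i. if i = 0 then x else 0) = (\<lambda>i. if i = 0 then x else 0)"
  by (rule ext) (auto simp: sshift_def intro!: sum.neutral)

lemma has_symbol_sshift:
  assumes X: "has_symbol X \<alpha> \<tau>"
  shows "has_symbol (sshift (of_nat j) X) (sshift (of_nat j) \<alpha>) (sshift (of_nat j) \<tau>)"
proof (rule has_symbolI)
  fix a :: "'a poly"
  have *: "sshift (of_nat j) (\<lambda>i. contract_poly (\<alpha> i * a)) = (\<lambda>i. contract_poly (sshift (of_nat j) \<alpha> i * a))"
    by (rule ext) (simp add: sshift_conv sum_distrib_right contract_poly_sum mult.assoc contract_poly_of_nat)
  show "smul (\<lambda>i. if i = 0 then contract_poly a else 0) (sshift (of_nat j) X)
     = smul (sshift (of_nat j) X) (\<lambda>i. contract_poly (sshift (of_nat j) \<alpha> i * a))"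
    using arg_cong[OF has_symbolD[OF X, of a], of "sshift (of_nat j)"]
    by (simp only: sshift_smul sshift_const *)
next
  fix n and \<phi> :: "'a fock"
  have "coeff_at (app (of_nat k * A) \<phi>) [] = of_nat k * coeff_at (app A \<phi>) []" for k A
    by (induction k) (auto simp: app_simps coeff_at_simps distrib_right)
  then show "coeff_at (app (sshift (of_nat j) X n) \<phi>) [] = sshift (of_nat j) \<tau> n * coeff_at \<phi> []"
    by (simp add: sshift_conv coeff_at_sum has_symbol_vacuum[OF X] sum_distrib_right mult.assoc)
qed

lemma has_symbol_sprod_shift:
  assumes X: "has_symbol X \<alpha> \<tau>"
  shows "has_symbol (sprod_shift p X) (sprod_shift p \<alpha>) (sprod_shift p \<tau>)"
proof -
  have "has_symbol (foldr (\<lambda>j B. smul (sshift (of_nat j) X) B) js sone)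
     (foldr (\<lambda>j B. smul (sshift (of_nat j) \<alpha>) B) js sone) (foldr (\<lambda>j B. smul (sshift (of_nat j) \<tau>) B) js sone)" for js
    by (induction js) (auto intro: has_symbol_sone has_symbol_smul has_symbol_sshift[OF X])
  then show ?thesis by (simp add: sprod_shift_def sone_def[abs_def])
qed

text \<open>The rule for X is applied to the contraction with \<alpha>^{-1} a, and the result is
  multiplied by X^{-1} on both sides.\<close>

lemma has_symbol_sinv:
  assumes X: "has_symbol X \<alpha> \<tau>" and 0: "X 0 = 1" "\<alpha> 0 = 1" "\<tau> 0 = 1"
  shows "has_symbol (sinv X) (sinv \<alpha>) (sinv \<tau>)"
proof (rule has_symbolI)
  fix a :: "'a poly"
  let ?c = "\<lambda>i. if i = 0 then contract_poly a else 0"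
  let ?E = "\<lambda>i. contract_poly (sinv \<alpha> i * a)"
  have "smul ?E X = smul X ?c"
    unfolding has_symbol_contract_mult[OF X] smul_sinv_left[of \<alpha>, OF 0(2)]
    by (rule arg_cong[where f = "smul X"]) (auto simp: sone_def contract_poly_0)
  then have "smul (sinv X) (smul (smul ?E X) (sinv X)) = smul (sinv X) (smul (smul X ?c) (sinv X))"
    by simp
  moreover have "smul (sinv X) (smul (smul ?E X) (sinv X)) = smul (sinv X) ?E"
    by (simp add: smul_assoc smul_sinv_right[of X, OF 0(1)])
  moreover have "smul (sinv X) (smul (smul X ?c) (sinv X)) = smul (smul (smul (sinv X) X) ?c) (sinv X)"
    by (simp only: smul_assoc)
  ultimately show "smul ?c (sinv X) = smul (sinv X) ?E"
    by (simp add: smul_sinv_left[of X, OF 0(1)])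
next
  fix n \<phi>
  show "coeff_at (app (sinv X n) \<phi>) [] = sinv \<tau> n * coeff_at \<phi> []"
  proof (induction n rule: less_induct)
    case (less n)
    show ?case
    proof (cases "n = 0")
      case False
      have "(\<Sum>m\<in>{1..n}. coeff_at (app (X m * sinv X (n - m)) \<phi>) []) = (\<Sum>m\<in>{1..n}. \<tau> m * (sinv \<tau> (n - m) * coeff_at \<phi> []))"
        by (intro sum.cong refl) (auto simp: app_simps has_symbol_vacuum[OF X] less)
      then show ?thesis
        using False by (simp add: sinv.simps[of _ n] app_simps coeff_at_simps coeff_at_sum sum_distrib_right mult.assoc)
    qed (simp add: app_simps)
  qed
qed

lemma has_symbol_diagonal:
  assumes "\<tau> 0 = 1"
  shows "has_symbol (diagonal \<tau>) transfer_poly \<tau>"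
proof -
  have "contract_poly a * diagonal \<tau> n = smul (diagonal \<tau>) (\<lambda>i. contract_poly (transfer_poly i * a)) n" for a n
  proof (induction a rule: poly_monom_induct)
    case (1 c j)
    have "smul (diagonal \<tau>) (\<lambda>i. contract_poly (transfer_poly i * monom c j)) n
      = (\<Sum>m\<le>n. diagonal \<tau> (n - m) * contract_poly (transfer_poly m * monom c j))"
      by (rule smul_rev)
    also have "\<dots> = diagonal \<tau> n * contract_poly (monom c j)
       - (\<Sum>i<n. diagonal \<tau> (n - 1 - i) * contract_poly (monom c (j + i)))"
      by (cases n)
        (simp_all add: lessThan_Suc_atMost[symmetric] sum.lessThan_Suc_shift transfer_poly_def mult_monom contract_poly_uminus
          sum_negf add.commute del: sum.lessThan_Suc)
    also have "\<dots> = opscal c * (contract j * diagonal \<tau> n)"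
    proof -
      have "diagonal \<tau> k * (opscal c * A) = opscal c * (diagonal \<tau> k * A)" for k A
        by (metis opscal_central mult.assoc)
      then show ?thesis
        by (simp add: contract_poly_monom contract_diagonal right_diff_distrib sum_distrib_left)
    qed
    finally show ?case by (simp add: contract_poly_monom mult.assoc)
  next
    case (2 a b)
    then show ?case
      by (simp add: contract_poly_add distrib_left distrib_right smul_def sum.distrib)
  qed
  then show ?thesis by (simp add: has_symbol_def vacuum_diagonal)
qed

lemma vpower_eqI:
  assumes "vpower X" "vpower Y" "\<And>r s. coeff2 X r s = coeff2 Y r s"
  shows "X = Y"
proof (intro fps_ext fls_eqI)
  fix n k
  show "fls_nth (fps_nth X n) k = fls_nth (fps_nth Y n) k"
  proof (cases "k < 0")
    case True
    then show ?thesis using assms(1,2) by (simp add: vpower_def)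
  next
    case False
    then show ?thesis using assms(3)[of n "nat k"] by (simp add: coeff2_def)
  qed
qed

lemma central_series:
  assumes "\<And>n x. H n * x = x * H n"
  shows "useries A * useries H = useries H * useries A" "vseries A * vseries H = vseries H * vseries A"
    "vseries A * useries H = useries H * vseries A" "useries A * vseries H = vseries H * useries A"
proof -
  have "smul A H = smul H A" by (rule smul_commute) (metis assms)
  then show "useries A * useries H = useries H * useries A" "vseries A * vseries H = vseries H * vseries A"
    by (simp_all add: useries_smul[symmetric] vseries_smul[symmetric])
  show "vseries A * useries H = useries H * vseries A" "useries A * vseries H = vseries H * useries A"
    by (rule vpower_eqI; (intro vpower_intros)?; simp add: coeff2_simps assms)+
qed

text \<open>Reversing the convolution sum negates A(u)^2.\<close>

lemma anticommuting_square:
  fixes A :: "nat \<Rightarrow> 'a::ring_1"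
  assumes "\<And>i j. A i * A j = - (A j * A i)" and "\<And>x. x + x = 0 \<Longrightarrow> x = (0::'a)"
  shows "smul A A n = 0"
proof (rule assms(2))
  have "smul A A n = (\<Sum>m\<le>n. A (n - m) * A m)"
    by (rule smul_rev)
  also have "\<dots> = (\<Sum>m\<le>n. - (A m * A (n - m)))"
    by (intro sum.cong refl assms(1))
  finally show "smul A A n + smul A A n = 0"
    by (simp add: smul_def sum_negf eq_neg_iff_add_eq_0)
qed

section \<open>The Drinfeld generators on Fock space\<close>

locale fock_model =
  fixes lam1 lam2 :: "nat \<Rightarrow> 'k::field"
  assumes two: "(2::'k) \<noteq> 0"
    and lam_0: "lam1 0 = 1" "lam2 0 = 1"
begin

definition hl :: "nat \<Rightarrow> 'k" where "hl = smul (sinv lam1) lam2"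
definition d :: "nat \<Rightarrow> 'k op" where "d = diagonal lam1"
text \<open>Generators start at index 1 and list entries at 0, whence the shifts by one here and in
  \<open>f\<close>. They make the anticommutator of e_r and f_s equal to
  \<open>hl (r + s - 1)\<close>.\<close>

definition e :: "nat \<Rightarrow> 'k op" where "e n = (if n = 0 then 0 else contract (n - 1))"
definition f :: "nat \<Rightarrow> 'k op" where "f n = (if n = 0 then 0 else creation (\<lambda>k. hl (Suc k)) (n - 1))"
definition h :: "nat \<Rightarrow> 'k op" where "h n = opscal (hl n)"

definition t :: "idx \<Rightarrow> idx \<Rightarrow> nat \<Rightarrow> 'k op" where
  "t i j = (case (i, j) of (I1, I1) \<Rightarrow> d | (I1, I2) \<Rightarrow> smul d e | (I2, I1) \<Rightarrow> smul f d
     | (I2, I2) \<Rightarrow> (\<lambda>n. smul (smul f d) e n + smul h d n))"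

lemma d_0: "d 0 = 1" and e_0: "e 0 = 0" and f_0: "f 0 = 0" and hl_0: "hl 0 = 1" and h_0: "h 0 = 1"
  by (simp_all add: d_def e_def f_def hl_def h_def diagonal_0 lam_0 smul_nth_0 opscal_simps)

lemma two_torsion: "x + x = 0 \<Longrightarrow> x = (0::'k op)"
proof -
  assume a: "x + x = 0"
  have "1 / 2 + 1 / 2 = (1::'k)"
    using two by (simp add: field_simps)
  then have "opscal (1 / 2) + opscal (1 / 2) = (1 :: 'k op)"
    by (metis opscal_simps(1,3))
  then have "x = (opscal (1 / 2) + opscal (1 / 2)) * x" by simp
  also have "\<dots> = opscal (1 / 2) * (x + x)"
    by (simp add: distrib_left distrib_right)
  finally show "x = 0" using a by simp
qed

lemma d_d: "d r * d s = d s * d r"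
  unfolding d_def by (rule diagonal_commute)

lemma e_e: "e r * e s = - (e s * e r)"
  by (auto simp: e_def intro: contract_contract)

lemma f_f: "f r * f s = - (f s * f r)"
  by (auto simp: f_def intro: creation_anticommute)

lemma h_comm: "h n * x = x * h n"
  unfolding h_def by (rule opscal_central)

lemma e_f: "e r * f s + f s * e r = (if r = 0 \<or> s = 0 then 0 else h (r + s - 1))"
proof (cases "r = 0 \<or> s = 0")
  case False
  then have "Suc (s - 1 + (r - 1)) = r + s - 1" by auto
  then show ?thesis using False
    by (simp add: e_def f_def h_def contract_creation)
qed (auto simp: e_0 f_0)

lemma d_f: "s > 0 \<Longrightarrow> d r * f s = f s * d r - (\<Sum>i<r. f (s + i) * d (r - 1 - i))"
  using diagonal_creation[of lam1 r "\<lambda>k. hl (Suc k)" "s - 1"] by (simp add: d_def f_def)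

lemma e_d: "s > 0 \<Longrightarrow> e s * d r = d r * e s - (\<Sum>i<r. d (r - 1 - i) * e (s + i))"
  using contract_diagonal[of "s - 1" lam1 r] by (simp add: d_def e_def)

text \<open>This supplies the row s = 0 of \<open>df_series\<close>, where f_0 = 0 and the whole
  coefficient of f(u) d(u) appears.\<close>

lemma d_f_1: "d r * f 1 - f 1 * d r = - smul f d r"
proof -
  have "smul f d r = (\<Sum>i<r. f (1 + i) * d (r - 1 - i))"
    unfolding smul_def
    by (cases r) (simp_all add: f_0 lessThan_Suc_atMost[symmetric] sum.lessThan_Suc_shift del: sum.lessThan_Suc)
  then show ?thesis using d_f[of 1 r] by simp
qed

lemma e_1_d: "e 1 * d r - d r * e 1 = - smul d e r"
proof -
  have "smul d e r = (\<Sum>i\<le>r. d (r - i) * e i)"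
    by (rule smul_rev)
  also have "\<dots> = (\<Sum>i<r. d (r - 1 - i) * e (1 + i))"
    by (cases r) (simp_all add: e_0 lessThan_Suc_atMost[symmetric] sum.lessThan_Suc_shift del: sum.lessThan_Suc)
  finally show ?thesis using e_d[of 1 r] by simp
qed

lemma d_f_step: "s > 0 \<Longrightarrow> d (Suc r) * f s - f s * d (Suc r) - (d r * f (Suc s) - f (Suc s) * d r) = - (f s * d r)"
  by (simp add: d_f sum.lessThan_Suc_shift del: sum.lessThan_Suc)

lemma e_d_step: "s > 0 \<Longrightarrow> e s * d (Suc r) - d (Suc r) * e s - (e (Suc s) * d r - d r * e (Suc s)) = - (d r * e s)"
  using e_d[of s "Suc r"] e_d[of "Suc s" r]
  by (simp add: sum.lessThan_Suc_shift[of _ r] del: sum.lessThan_Suc)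

lemma df_series: "useries d * vseries f - vseries f * useries d = wser * (useries (smul f d) - vseries f * useries d)"
  unfolding eq_wser_mult_coeff2[OF vpower_diff[OF vpower_uv vpower_vu] vpower_diff[OF vpower_u vpower_vu]] coeff2_simps
proof (intro conjI allI)
  fix r s
  show "d (Suc r) * f s - f s * d (Suc r) - (d r * f (Suc s) - f (Suc s) * d r) = (if s = 0 then smul f d r else 0) - f s * d r"
    using d_f_step[of s r] d_f_1[of r] by (cases s) (auto simp: f_0)
qed (simp_all add: d_0 f_0)

lemma df_series': "vseries d * useries f - useries f * vseries d = wser * (useries f * vseries d - vseries (smul f d))"
  unfolding eq_wser_mult_coeff2[OF vpower_diff[OF vpower_vu vpower_uv] vpower_diff[OF vpower_uv vpower_v]] coeff2_simps
proof (intro conjI allI)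
  fix r s
  show "d s * f (Suc r) - f (Suc r) * d s - (d (Suc s) * f r - f r * d (Suc s)) = f r * d s - (if r = 0 then smul f d s else 0)"
    using d_f_step[of r s] d_f_1[of s] by (cases r) (auto simp: f_0 algebra_simps)
qed (simp_all add: d_0 f_0)

lemma ed_series: "vseries e * useries d - useries d * vseries e = wser * (useries (smul d e) - useries d * vseries e)"
  unfolding eq_wser_mult_coeff2[OF vpower_diff[OF vpower_vu vpower_uv] vpower_diff[OF vpower_u vpower_uv]] coeff2_simps
proof (intro conjI allI)
  fix r s
  show "e s * d (Suc r) - d (Suc r) * e s - (e (Suc s) * d r - d r * e (Suc s)) = (if s = 0 then smul d e r else 0) - d r * e s"
    using e_d_step[of s r] e_1_d[of r] by (cases s) (auto simp: e_0)
qed (simp_all add: d_0 e_0)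

lemma ed_series': "useries e * vseries d - vseries d * useries e = wser * (vseries d * useries e - vseries (smul d e))"
  unfolding eq_wser_mult_coeff2[OF vpower_diff[OF vpower_uv vpower_vu] vpower_diff[OF vpower_vu vpower_v]] coeff2_simps
proof (intro conjI allI)
  fix r s
  show "e (Suc r) * d s - d s * e (Suc r) - (e r * d (Suc s) - d (Suc s) * e r) = d s * e r - (if r = 0 then smul d e s else 0)"
    using e_d_step[of r s] e_1_d[of s] by (cases r) (auto simp: e_0 algebra_simps)
qed (simp_all add: d_0 e_0)

lemma ef_series: "useries e * vseries f + vseries f * useries e = wser * (vseries h - useries h)"
  unfolding eq_wser_mult_coeff2[OF vpower_add[OF vpower_uv vpower_vu] vpower_diff[OF vpower_v vpower_u]] coeff2_simps e_f
  by (auto simp: h_0)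

lemma ef_series': "vseries e * useries f + useries f * vseries e = wser * (vseries h - useries h)"
  unfolding eq_wser_mult_coeff2[OF vpower_add[OF vpower_vu vpower_uv] vpower_diff[OF vpower_v vpower_u]] coeff2_simps e_f
  by (auto simp: h_0 add.commute)

lemma square_zero: "smul e e = (\<lambda>n. 0)" "smul f f = (\<lambda>n. 0)"
  by (rule ext, rule anticommuting_square, rule e_e, erule two_torsion)
    (rule ext, rule anticommuting_square, rule f_f, erule two_torsion)

lemma useries_zero: "useries (\<lambda>n. 0) = 0" "vseries (\<lambda>n. 0) = 0"
  using useries_add[of "\<lambda>n. 0" "\<lambda>n. 0"] vseries_add[of "\<lambda>n. 0" "\<lambda>n. 0"] by simp_all

sublocale gauss_series wser "useries d" "vseries d" "useries e" "vseries e" "useries f" "vseries f" "useries h" "vseries h"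
proof
  show "x * wser = wser * x" for x :: "'k op fls fps" by (rule wser_central)
  show "vseries d * useries d = useries d * vseries d"
    by (rule vpower_eqI; (intro vpower_intros)?) (simp add: coeff2_simps d_d)
  show "vseries e * useries e = - (useries e * vseries e)"
    by (rule vpower_eqI; (intro vpower_intros)?) (simp add: coeff2_simps, rule e_e)
  show "vseries f * useries f = - (useries f * vseries f)"
    by (rule vpower_eqI; (intro vpower_intros)?) (simp add: coeff2_simps, rule f_f)
  show "useries e * useries e = 0" "vseries e * vseries e = 0" "useries f * useries f = 0" "vseries f * vseries f = 0"
    by (simp_all add: useries_smul[symmetric] vseries_smul[symmetric] square_zero useries_zero)
  show "useries d * vseries f = vseries f * useries d - wser * vseries f * useries d + wser * useries f * useries d"
    using df_series by (simp add: useries_smul algebra_simps)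
  show "vseries d * useries f = useries f * vseries d + wser * useries f * vseries d - wser * vseries f * vseries d"
    using df_series' by (simp add: vseries_smul algebra_simps)
  show "vseries e * useries d = useries d * vseries e - wser * useries d * vseries e + wser * useries d * useries e"
    using ed_series by (simp add: useries_smul algebra_simps)
  show "useries e * vseries d = vseries d * useries e + wser * vseries d * useries e - wser * vseries d * vseries e"
    using ed_series' by (simp add: vseries_smul algebra_simps)
  show "useries e * vseries f = - (vseries f * useries e) - wser * useries h + wser * vseries h"
    using ef_series by (simp add: algebra_simps)
  show "vseries e * useries f = - (useries f * vseries e) - wser * useries h + wser * vseries h"
    using ef_series' by (simp add: algebra_simps)
  fix x
  assume "x \<in> {useries d, vseries d, useries e, vseries e, useries f, vseries f, useries h, vseries h}"
  then show "x * useries h = useries h * x" "x * vseries h = vseries h * x"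
    using central_series[of h, OF h_comm] by auto
qed

lemma t_0: "t i j 0 = (if i = j then 1 else 0)"
  by (cases i; cases j) (simp_all add: t_def smul_nth_0 d_0 e_0 f_0 h_0)

lemma t_rtt: "rtt_family t"
proof -
  have "useries (t i j) = tu i j" "vseries (t i j) = tv i j" for i j
    by (cases i; cases j;
        simp add: t_def tu_def tv_def useries_smul vseries_smul useries_add vseries_add)+
  then show ?thesis
    using rtt unfolding rtt_family_iff[of t, OF t_0] by simp
qed

text \<open>Uniqueness of the Gauss decomposition: the operators from which \<open>t\<close> was
  built are recovered from it.\<close>

lemma gauss_e: "smul (sinv (t I1 I1)) (t I1 I2) = e"
  by (simp add: t_def smul_assoc[symmetric] smul_sinv_left d_0)

lemma gauss_f: "smul (t I2 I1) (sinv (t I1 I1)) = f"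
  by (simp add: t_def smul_assoc smul_sinv_right d_0)

lemma gauss_d2: "(\<lambda>n. t I2 I2 n - smul (smul f (t I1 I1)) e n) = smul h d"
  by (simp add: t_def)

lemma d_symbol: "has_symbol d transfer_poly lam1"
  unfolding d_def by (rule has_symbol_diagonal) (rule lam_0)

lemma h_symbol: "has_symbol h sone hl"
proof -
  have "contract_poly a * h n = smul h (\<lambda>i. contract_poly (sone i * a)) n" for a n
  proof -
    have "smul h (\<lambda>i. contract_poly (sone i * a)) n = (\<Sum>m\<le>n. if m = n then h n * contract_poly a else 0)"
      unfolding smul_def by (intro sum.cong refl) (auto simp: sone_def contract_poly_0)
    then show ?thesis using h_comm[of n "contract_poly a"] by simp
  qed
  then show ?thesis by (simp add: has_symbol_def h_def app_simps coeff_at_simps)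
qed

text \<open>As \<open>h\<close> is scalar, multiplying by it only changes the vacuum series, from
  \<lambda>_1 to \<lambda>_2.\<close>

lemma d2_symbol: "has_symbol (smul h d) transfer_poly lam2"
proof -
  have "smul hl lam1 = lam2"
  proof -
    have "smul hl lam1 = smul lam1 hl" by (rule smul_commute) (rule mult.commute)
    then show ?thesis by (simp add: hl_def smul_assoc[symmetric] smul_sinv_right lam_0)
  qed
  then show ?thesis
    using has_symbol_smul[OF h_symbol d_symbol] by simp
qed

lemma app_vacuum_e: "app (e n) vacuum = 0"
proof -
  have "app (contract y) vacuum = (0 :: 'k fock)" for y
    by (rule coeff_at_inject) (simp add: coeff_at_contract coeff_at_simps vacuum.rep_eq)
  then show ?thesis by (simp add: e_def app_simps)
qed

text \<open>A coefficient at a nonempty list is a contraction followed by evaluation; moved to the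
  right through \<open>X n\<close>, the contraction kills the vacuum.\<close>

lemma app_vacuum_symbol:
  fixes X :: "nat \<Rightarrow> 'k op"
  assumes "has_symbol X \<alpha> \<tau>"
  shows "app (X n) vacuum = fock_scale (\<tau> n) vacuum"
proof (rule coeff_at_inject)
  fix w :: "nat list"
  have e0: "app (contract_poly a) vacuum = (0 :: 'k fock)" for a
  proof (induction a rule: poly_monom_induct)
    case (1 c j)
    show ?case using app_vacuum_e[of "Suc j"]
      by (simp add: contract_poly_monom app_simps e_def) (simp add: fock_scale_simps)
  qed (simp add: contract_poly_add app_simps)
  have zero: "app A 0 = (0 :: 'k fock)" for A
    using app_add[of A 0 0] by simp
  show "coeff_at (app (X n) vacuum) w = coeff_at (fock_scale (\<tau> n) vacuum) w"
  proof (cases w)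
    case Nil
    then show ?thesis by (simp add: has_symbol_vacuum[OF assms] coeff_at_simps)
  next
    case (Cons y v)
    have "coeff_at (app (X n) vacuum) w = coeff_at (app (contract_poly (monom 1 y) * X n) vacuum) v"
      by (simp add: Cons contract_poly_monom app_simps coeff_at_contract coeff_at_simps fock_scale_simps)
    also have "\<dots> = 0"
    proof -
      have app_sum: "app (sum g I) (vacuum :: 'k fock) = (\<Sum>i\<in>I. app (g i) vacuum)" for g and I :: "nat set"
        by (induction I rule: infinite_finite_induct) (auto simp: app_simps)
      have "contract_poly (monom 1 y) * X n = (\<Sum>m\<le>n. X m * contract_poly (\<alpha> (n - m) * monom 1 y))"
        using assms by (simp add: has_symbol_def smul_def)
      then have "app (contract_poly (monom 1 y) * X n) vacuum = 0"
        by (simp only: app_sum) (simp add: app_simps e0 zero)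
      then show ?thesis by (simp add: coeff_at_simps)
    qed
    finally show ?thesis by (simp add: Cons coeff_at_simps vacuum.rep_eq)
  qed
qed

end

section \<open>The super Yangian as a quotient of the free algebra\<close>

locale unital_hom =
  fixes \<phi> :: "'a::ring_1 \<Rightarrow> 'b::ring_1"
  assumes add: "\<phi> (x + y) = \<phi> x + \<phi> y"
    and mult: "\<phi> (x * y) = \<phi> x * \<phi> y"
    and one: "\<phi> 1 = 1"
begin

lemma zero: "\<phi> 0 = 0"
  using add[of 0 0] by simp

lemma uminus: "\<phi> (- x) = - \<phi> x"
  using add[of x "- x"] by (simp add: zero eq_neg_iff_add_eq_0 add.commute)

lemma minus: "\<phi> (x - y) = \<phi> x - \<phi> y"
  using add[of x "- y"] by (simp add: uminus)

lemma sum: "\<phi> (sum g I) = (\<Sum>i\<in>I. \<phi> (g i))"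
  by (induction I rule: infinite_finite_induct) (auto simp: zero add)

lemma of_nat: "\<phi> (of_nat n) = of_nat n"
  by (induction n) (auto simp: zero add one)

lemma power: "\<phi> (x ^ n) = \<phi> x ^ n"
  by (induction n) (auto simp: one mult)

lemma smul: "(\<lambda>n. \<phi> (smul A B n)) = smul (\<lambda>n. \<phi> (A n)) (\<lambda>n. \<phi> (B n))"
  by (simp add: smul_def fun_eq_iff sum mult)

lemma sinv: "(\<lambda>n. \<phi> (sinv A n)) = sinv (\<lambda>n. \<phi> (A n))"
proof
  fix n
  show "\<phi> (sinv A n) = sinv (\<lambda>n. \<phi> (A n)) n"
  proof (induction n rule: less_induct)
    case (less n)
    have "(\<Sum>m\<in>{1..n}. \<phi> (A m) * \<phi> (sinv A (n - m))) = (\<Sum>m\<in>{1..n}. \<phi> (A m) * sinv (\<lambda>n. \<phi> (A n)) (n - m))"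
      by (intro sum.cong refl) (use less in auto)
    then show ?case
      by (simp add: sinv.simps[of _ n] one uminus sum mult)
  qed
qed

lemma sshift: "(\<lambda>n. \<phi> (sshift (of_nat j) A n)) = sshift (of_nat j) (\<lambda>n. \<phi> (A n))"
  by (simp add: sshift_conv fun_eq_iff sum mult of_nat)

lemma sprod_shift: "(\<lambda>n. \<phi> (sprod_shift p A n)) = sprod_shift p (\<lambda>n. \<phi> (A n))"
proof -
  have "(\<lambda>n. \<phi> (foldr (\<lambda>j B. smul (sshift (of_nat j) A) B) js sone n))
      = foldr (\<lambda>j B. smul (sshift (of_nat j) (\<lambda>n. \<phi> (A n))) B) js sone" for js
    by (induction js) (simp_all add: sone_def[abs_def] zero one smul sshift fun_eq_iff if_distrib[of \<phi>])
  then show ?thesis by (simp add: sprod_shift_def sone_def[abs_def])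
qed

end

lemma hom_rtt_rel:
  fixes \<phi> :: "'c::ring_1 free \<Rightarrow> 'b::ring_1"
  assumes "unital_hom \<phi>"
  shows "\<phi> (rtt_rel i j k l r s) = \<phi> (tt i j r) * \<phi> (tt k l s)
    - (-1) ^ ((par i + par j) * (par k + par l)) * \<phi> (tt k l s) * \<phi> (tt i j r)
    - (-1) ^ (par i * par j + par i * par k + par j * par k) *
      (\<Sum>n<min r s. \<phi> (tt k j n) * \<phi> (tt i l (r + s - 1 - n)) - \<phi> (tt k j (r + s - 1 - n)) * \<phi> (tt i l n))"
proof -
  interpret unital_hom \<phi> by fact
  show ?thesis
    by (simp add: rtt_rel_def minus mult power uminus one sum)
qed

lemma tt_0: "tt i j 0 = (if i = j then 1 else 0)"
  by (simp add: tt_def)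

lemma hom_rtt_family_iff:
  fixes \<phi> :: "'c::ring_1 free \<Rightarrow> 'b::ring_1"
  assumes "unital_hom \<phi>"
  shows "rtt_family (\<lambda>i j r. \<phi> (tt i j r)) \<longleftrightarrow> (\<forall>i j k l r s. r > 0 \<longrightarrow> s > 0 \<longrightarrow> \<phi> (rtt_rel i j k l r s) = 0)"
proof -
  interpret unital_hom \<phi> by fact
  show ?thesis
    unfolding rtt_family_def hom_rtt_rel[OF assms] by (simp add: tt_0 one zero)
qed

lemma free_induct [case_names single add]:
  fixes x :: "'k::ring_1 free"
  assumes "\<And>w c. P (Poly_Mapping.single w c)" "\<And>x y. P x \<Longrightarrow> P y \<Longrightarrow> P (x + y)"
  shows "P x"
proof (induction x rule: update_induct)
  case const
  show ?case using assms(1)[of 0 0] by simp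
next
  case (update f a b)
  have "Poly_Mapping.update a b f = f + Poly_Mapping.single a b"
    using update(1) by (intro poly_mapping_eqI) (auto simp: lookup_update lookup_add lookup_single when_def in_keys_iff)
  then show ?case using update assms by metis
qed

lemma scal_mult_single: "scal c * Poly_Mapping.single w a = Poly_Mapping.single w (c * a)"
  by (simp add: scal_def mult_single)

lemma scal_central: "scal c * x = x * scal (c :: 'k::comm_ring_1)"
  by (induction x rule: free_induct) (simp_all add: scal_def mult_single mult.commute distrib_left distrib_right)

lemma scal_add: "scal (c + c') = scal c + scal c'" and scal_mult: "scal (c * c') = scal c * scal c'"
  and scal_1: "scal 1 = 1" and scal_0: "scal 0 = 0"
  by (simp_all add: scal_def single_add mult_single)

lemma word_induct: "P 0 \<Longrightarrow> (\<And>i j n w. P w \<Longrightarrow> P (Word [T i j n] + w)) \<Longrightarrow> P w"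
proof -
  assume P: "P 0" "\<And>i j n w. P w \<Longrightarrow> P (Word [T i j n] + w)"
  have "P (Word gs)" for gs
  proof (induction gs)
    case Nil
    show ?case using P(1) by (simp add: zero_word_def)
  next
    case (Cons g gs)
    then show ?case using P(2)[of "Word gs"] by (cases g) simp
  qed
  then show ?thesis by (cases w) simp
qed

lemma free_generated:
  fixes x :: "'k::comm_ring_1 free"
  assumes "\<And>c. P (scal c)" "\<And>x y. P x \<Longrightarrow> P y \<Longrightarrow> P (x + y)" "\<And>i j r x. P x \<Longrightarrow> P (tt i j r * x)"
  shows "P x"
proof (induction x rule: free_induct)
  case (single w c)
  show ?case
  proof (induction w rule: word_induct)
    case 1
    show ?case using assms(1)[of c] by (simp add: scal_def)
  next
    case (2 i j n w)
    have "Poly_Mapping.single (Word [T i j n] + w) c = tt i j (Suc n) * Poly_Mapping.single w c"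
      by (simp add: tt_def mult_single)
    then show ?case using assms(3)[OF 2, of i j "Suc n"] by simp
  qed
qed (rule assms(2))

definition word_val :: "(gen \<Rightarrow> 'b::monoid_mult) \<Rightarrow> word \<Rightarrow> 'b" where
  "word_val g w = (case w of Word gs \<Rightarrow> prod_list (map g gs))"

lemma word_val_add: "word_val g (v + w) = word_val g v * word_val g w"
  by (cases v; cases w) (simp add: word_val_def)

lemma word_val_0: "word_val g 0 = 1"
  by (simp add: word_val_def zero_word_def)

definition free_eval :: "('k::zero \<Rightarrow> 'b::ring_1) \<Rightarrow> (gen \<Rightarrow> 'b) \<Rightarrow> (word \<Rightarrow>\<^sub>0 'k) \<Rightarrow> 'b" where
  "free_eval s g x = (\<Sum>w\<in>Poly_Mapping.keys x. s (Poly_Mapping.lookup x w) * word_val g w)"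

locale scalar_hom =
  fixes s :: "'k::field \<Rightarrow> 'b::ring_1"
  assumes s_add: "s (c + c') = s c + s c'" and s_mult: "s (c * c') = s c * s c'" and s_1: "s 1 = 1"
    and s_central: "s c * x = x * s c"
begin

lemma s_0: "s 0 = 0"
  using s_add[of 0 0] by simp

lemma eval_single: "free_eval s g (Poly_Mapping.single w c) = s c * word_val g w"
  by (simp add: free_eval_def s_0)

lemma eval_add: "free_eval s g (x + y) = free_eval s g x + free_eval s g y"
  unfolding free_eval_def
  by (rule setsum_keys_plus_distrib) (simp_all add: s_0 s_add distrib_right)

lemma eval_hom: "unital_hom (free_eval s g)"
proof
  show "free_eval s g 1 = 1"
    using eval_single[of g 0 1] by (simp add: word_val_0 s_1)
  show "free_eval s g (x * y) = free_eval s g x * free_eval s g y" for x y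
  proof (induction x rule: free_induct)
    case (single w c)
    show ?case
    proof (induction y rule: free_induct)
      case (single w' c')
      have "s c * s c' * (word_val g w * word_val g w') = s c * word_val g w * (s c' * word_val g w')"
        by (metis s_central mult.assoc)
      then show ?case by (simp add: mult_single eval_single s_mult word_val_add)
    qed (simp add: distrib_left eval_add)
  qed (simp add: distrib_right eval_add)
qed (rule eval_add)

lemma eval_scal: "free_eval s g (scal c) = s c"
  by (simp add: scal_def eval_single word_val_0)

lemma eval_tt: "free_eval s g (tt i j r) = (if r = 0 then (if i = j then 1 else 0) else g (T i j (r - 1)))"
proof -
  interpret unital_hom "free_eval s g" by (rule eval_hom)
  show ?thesis by (simp add: tt_def one zero eval_single word_val_def s_1)
qed

end

definition rtt_ideal :: "'k::ring_1 free set" where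
  "rtt_ideal = two_sided_ideal {rtt_rel i j k l r s | i j k l r s. r > 0 \<and> s > 0}"

lemma rtt_ideal_closed:
  "0 \<in> rtt_ideal" "x \<in> rtt_ideal \<Longrightarrow> y \<in> rtt_ideal \<Longrightarrow> x + y \<in> rtt_ideal"
  "x \<in> rtt_ideal \<Longrightarrow> a * x * b \<in> rtt_ideal"
  unfolding rtt_ideal_def by (auto intro: two_sided_ideal.intros)

lemma rtt_ideal_uminus: "x \<in> rtt_ideal \<Longrightarrow> - x \<in> rtt_ideal"
  using rtt_ideal_closed(3)[of x "- 1" 1] by simp

lemma rtt_ideal_left: "x \<in> rtt_ideal \<Longrightarrow> a * x \<in> rtt_ideal" and rtt_ideal_right: "x \<in> rtt_ideal \<Longrightarrow> x * a \<in> rtt_ideal"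
  using rtt_ideal_closed(3)[of x a 1] rtt_ideal_closed(3)[of x 1 a] by simp_all

lemma hom_two_sided_ideal:
  assumes "unital_hom \<phi>" "\<And>x. x \<in> R \<Longrightarrow> \<phi> x = 0" "x \<in> two_sided_ideal R"
  shows "\<phi> x = 0"
proof -
  interpret unital_hom \<phi> by fact
  show ?thesis
    using assms(3) by induction (auto simp: assms(2) zero add mult)
qed

text \<open>Sending every generator to 0 kills the relations: for r, s > 0 each product in them has
  a factor of positive index, since r + s - 1 - n > 0 for n < min r s.\<close>

lemma one_notin_rtt_ideal: "(1 :: 'k::field free) \<notin> rtt_ideal"
proof
  assume 1: "(1 :: 'k free) \<in> rtt_ideal"
  interpret s: scalar_hom "\<lambda>c. c :: 'k" by standard (simp_all add: mult.commute)
  let ?\<phi> = "free_eval (\<lambda>c. c :: 'k) (\<lambda>g. 0)"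
  interpret h: unital_hom ?\<phi> by (rule s.eval_hom)
  have z: "?\<phi> (tt i j n) = 0" if "n > 0" for i j n
    using that by (simp add: s.eval_tt)
  have "?\<phi> (rtt_rel i j k l r s) = 0" if "r > 0" "s > 0" for i j k l r s
    unfolding hom_rtt_rel[OF s.eval_hom] using that by (subst sum.neutral) (auto simp: z)
  then have "?\<phi> 1 = 0"
    using hom_two_sided_ideal[OF s.eval_hom _ 1[unfolded rtt_ideal_def]] by blast
  then show False by (simp add: h.one)
qed

\<comment> \<open>Only the RTT relations are divided out, so this is the full super Yangian; the
  elements b_i^{(rp)} enter through the left ideal of the Verma module.\<close>
quotient_type (overloaded) 'k yang = "'k::field free" / "\<lambda>x y. x - y \<in> rtt_ideal"
proof (rule equivpI)
  show "reflp (\<lambda>x y :: 'k free. x - y \<in> rtt_ideal)"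
    by (rule reflpI) (simp add: rtt_ideal_closed(1))
  show "symp (\<lambda>x y :: 'k free. x - y \<in> rtt_ideal)"
  proof (rule sympI)
    fix x y :: "'k free"
    assume "x - y \<in> rtt_ideal"
    from rtt_ideal_uminus[OF this] show "y - x \<in> rtt_ideal" by simp
  qed
  show "transp (\<lambda>x y :: 'k free. x - y \<in> rtt_ideal)"
  proof (rule transpI)
    fix x y z :: "'k free"
    assume "x - y \<in> rtt_ideal" "y - z \<in> rtt_ideal"
    from rtt_ideal_closed(2)[OF this] show "x - z \<in> rtt_ideal" by simp
  qed
qed

instantiation yang :: (field) ring_1
begin
lift_definition zero_yang :: "'a yang" is 0 .
lift_definition one_yang :: "'a yang" is 1 .
lift_definition plus_yang :: "'a yang \<Rightarrow> 'a yang \<Rightarrow> 'a yang" is "(+)"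
proof -
  fix a b c d :: "'a free"
  assume "a - b \<in> rtt_ideal" "c - d \<in> rtt_ideal"
  from rtt_ideal_closed(2)[OF this] show "a + c - (b + d) \<in> rtt_ideal" by (simp add: algebra_simps)
qed
lift_definition minus_yang :: "'a yang \<Rightarrow> 'a yang \<Rightarrow> 'a yang" is "(-)"
proof -
  fix a b c d :: "'a free"
  assume "a - b \<in> rtt_ideal" "c - d \<in> rtt_ideal"
  then have "(a - b) + - (c - d) \<in> rtt_ideal" by (intro rtt_ideal_closed rtt_ideal_uminus)
  then show "a - c - (b - d) \<in> rtt_ideal" by (simp add: algebra_simps)
qed
lift_definition uminus_yang :: "'a yang \<Rightarrow> 'a yang" is uminus
proof -
  fix a b :: "'a free"
  assume "a - b \<in> rtt_ideal"
  from rtt_ideal_uminus[OF this] show "- a - - b \<in> rtt_ideal" by simp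
qed
lift_definition times_yang :: "'a yang \<Rightarrow> 'a yang \<Rightarrow> 'a yang" is "(*)"
proof -
  fix a b c d :: "'a free"
  assume "a - b \<in> rtt_ideal" "c - d \<in> rtt_ideal"
  then have "(a - b) * c + b * (c - d) \<in> rtt_ideal"
    by (intro rtt_ideal_closed(2) rtt_ideal_left rtt_ideal_right)
  then show "a * c - b * d \<in> rtt_ideal" by (simp add: algebra_simps)
qed
instance
proof
  show "(0 :: 'a yang) \<noteq> 1"
  proof transfer
    show "(0 :: 'a free) - 1 \<notin> rtt_ideal"
    proof
      assume "(0 :: 'a free) - 1 \<in> rtt_ideal"
      from rtt_ideal_uminus[OF this] have "(1 :: 'a free) \<in> rtt_ideal" by simp
      then show False by (rule notE[OF one_notin_rtt_ideal])
    qed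
  qed
qed (transfer, simp add: algebra_simps rtt_ideal_closed(1))+
end

lemma abs_hom: "unital_hom (abs_yang :: 'k::field free \<Rightarrow> 'k yang)"
  by standard (simp_all add: plus_yang.abs_eq times_yang.abs_eq one_yang.abs_eq)

lemma abs_yang_eq_iff: "abs_yang x = abs_yang y \<longleftrightarrow> x - y \<in> rtt_ideal"
  using yang.abs_eq_iff by blast

lemma abs_yang_surj: "\<exists>x. y = abs_yang x"
  by (metis Quotient_yang Quotient_abs_rep)

lemma yang_rtt_family: "rtt_family (\<lambda>i j r. abs_yang (tt i j r) :: 'k::field yang)"
proof -
  interpret unital_hom "abs_yang :: 'k free \<Rightarrow> 'k yang" by (rule abs_hom)
  have "abs_yang (rtt_rel i j k l r s) = (abs_yang 0 :: 'k yang)" if "r > 0" "s > 0" for i j k l r s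
    unfolding abs_yang_eq_iff rtt_ideal_def diff_0_right
    by (rule two_sided_ideal.gen) (use that in blast)
  then show ?thesis
    unfolding hom_rtt_family_iff[OF abs_hom] by (simp add: zero)
qed

section \<open>The parity automorphism\<close>

definition flip :: "'k::field free \<Rightarrow> 'k free" where
  "flip = free_eval scal (\<lambda>g. (-1) ^ gpar g * Poly_Mapping.single (Word [g]) 1)"

lemma scalar_hom_scal: "scalar_hom (scal :: 'k::field \<Rightarrow> 'k free)"
  by standard (rule scal_add scal_mult scal_1 scal_central)+

lemma flip_hom: "unital_hom (flip :: 'k::field free \<Rightarrow> 'k free)"
  unfolding flip_def by (rule scalar_hom.eval_hom[OF scalar_hom_scal])

lemma flip_scal: "flip (scal c) = scal c"
  unfolding flip_def by (rule scalar_hom.eval_scal[OF scalar_hom_scal])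

lemma flip_tt: "flip (tt i j r) = (-1) ^ (par i + par j) * tt i j r"
  unfolding flip_def scalar_hom.eval_tt[OF scalar_hom_scal]
  by (cases i; cases j) (auto simp: tt_def gpar_def par_def)

lemma flip_single: "flip (Poly_Mapping.single w c) = (-1) ^ wpar w * Poly_Mapping.single w c"
proof -
  have "word_val (\<lambda>g. (-1) ^ gpar g * Poly_Mapping.single (Word [g]) 1) (Word gs)
     = (-1) ^ sum_list (map gpar gs) * Poly_Mapping.single (Word gs) (1::'a)" for gs
  proof (induction gs)
    case Nil
    show ?case by (simp add: word_val_0 zero_word_def[symmetric])
  next
    case (Cons g gs)
    have "word_val (\<lambda>g. (-1) ^ gpar g * Poly_Mapping.single (Word [g]) 1) (Word (g # gs))
      = (-1) ^ gpar g * Poly_Mapping.single (Word [g]) 1 * ((-1) ^ sum_list (map gpar gs) * Poly_Mapping.single (Word gs) (1::'a))"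
      using Cons by (simp add: word_val_def)
    also have "\<dots> = (-1) ^ (gpar g + sum_list (map gpar gs)) * (Poly_Mapping.single (Word [g]) 1 * Poly_Mapping.single (Word gs) 1)"
      by (cases "even (gpar g)"; cases "even (sum_list (map gpar gs))") simp_all
    finally show ?case by (simp add: mult_single)
  qed
  moreover have "(-1 :: 'a free) ^ (n mod 2) = (-1) ^ n" for n
    by (cases "even n") (auto simp: even_iff_mod_2_eq_zero odd_iff_mod_2_eq_one)
  ultimately show ?thesis
    unfolding flip_def scalar_hom.eval_single[OF scalar_hom_scal]
    by (cases w; cases "even (wpar w)") (simp_all add: wpar_def scal_mult_single mult.assoc[symmetric])
qed

definition even_part :: "'k::ring_1 free \<Rightarrow> 'k free" where
  "even_part x = Abs_poly_mapping (\<lambda>w. if wpar w = 0 then Poly_Mapping.lookup x w else 0)"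

lemma lookup_even_part: "Poly_Mapping.lookup (even_part x) w = (if wpar w = 0 then Poly_Mapping.lookup x w else 0)"
proof -
  have "finite {w. (if wpar w = 0 then Poly_Mapping.lookup x w else 0) \<noteq> 0}"
    by (rule finite_subset[OF _ finite_keys[of x]]) (auto simp: in_keys_iff)
  then show ?thesis by (simp add: even_part_def)
qed

text \<open>Where 2 is invertible, this shows that a left ideal stable under \<open>flip\<close> is
  graded.\<close>

lemma even_part_flip: "even_part x + even_part x = x + flip x"
proof (induction x rule: free_induct)
  case (single w c)
  have "wpar w = 0 \<or> wpar w = 1"
    by (cases w) (auto simp: wpar_def)
  moreover have "even_part (Poly_Mapping.single w c) = (if wpar w = 0 then Poly_Mapping.single w c else 0)"
    by (rule poly_mapping_eqI) (auto simp: lookup_even_part lookup_single when_def)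
  ultimately show ?case by (auto simp: flip_single)
next
  case (add x y)
  have "even_part (x + y) = even_part x + even_part y"
    by (rule poly_mapping_eqI) (simp add: lookup_even_part lookup_add)
  then show ?case
    using add unital_hom.add[OF flip_hom, of x y] by (simp add: algebra_simps)
qed

lemma flip_flip: "flip (flip x) = x"
proof (induction x rule: free_induct)
  case (single w c)
  interpret unital_hom "flip :: 'a free \<Rightarrow> 'a free" by (rule flip_hom)
  show ?case by (cases "even (wpar w)") (simp_all add: flip_single uminus)
qed (simp add: unital_hom.add[OF flip_hom])

lemma flip_rtt_rel: "flip (rtt_rel i j k l r s) = (-1) ^ (par i + par j + par k + par l) * (rtt_rel i j k l r s :: 'k::field free)"
  unfolding hom_rtt_rel[OF flip_hom] flip_tt
  by (cases i; cases j; cases k; cases l) (simp_all add: rtt_rel_def par_def sum_negf[symmetric])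

lemma flip_rtt_ideal: "x \<in> rtt_ideal \<Longrightarrow> flip x \<in> rtt_ideal"
  unfolding rtt_ideal_def
proof (induction rule: two_sided_ideal.induct)
  case (gen x)
  then obtain i j k l r s where x: "x = rtt_rel i j k l r s" "r > 0" "s > 0" by blast
  then have "x \<in> rtt_ideal" unfolding rtt_ideal_def by (intro two_sided_ideal.gen) blast
  then have "(-1) ^ (par i + par j + par k + par l) * x \<in> rtt_ideal"
    by (rule rtt_ideal_left)
  then show ?case unfolding x flip_rtt_rel rtt_ideal_def .
qed (auto simp: unital_hom.zero[OF flip_hom] unital_hom.add[OF flip_hom] unital_hom.mult[OF flip_hom] intro: two_sided_ideal.intros)

section \<open>Baby Verma modules\<close>

lemma smul_uminus: "smul (\<lambda>n. - A n) B = (\<lambda>n. - smul A B n)" "smul A (\<lambda>n. - B n) = (\<lambda>n. - smul A B n)"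
  by (simp_all add: smul_def sum_negf fun_eq_iff)

text \<open>Needed because b_2 is built from the inverse of d_2: over a commutative ring the two
  shifted products are inverse to each other, factor by factor.\<close>

lemma sprod_shift_sinv:
  fixes A :: "nat \<Rightarrow> 'a::comm_ring_1"
  assumes "A 0 = 1" "sprod_shift p A = sone"
  shows "sprod_shift p (sinv A) = sone"
proof -
  have "smul (foldr (\<lambda>j. smul (sshift (of_nat j) A)) js sone) (foldr (\<lambda>j. smul (sshift (of_nat j) (sinv A))) js sone) = sone" for js
  proof (induction js)
    case (Cons j js)
    let ?X = "foldr (\<lambda>j. smul (sshift (of_nat j) A)) js sone"
    let ?Y = "foldr (\<lambda>j. smul (sshift (of_nat j) (sinv A))) js sone"
    have "smul (smul (sshift (of_nat j) A) ?X) (smul (sshift (of_nat j) (sinv A)) ?Y)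
      = smul (smul (sshift (of_nat j) A) (sshift (of_nat j) (sinv A))) (smul ?X ?Y)"
      by (simp add: Abs_fps_inject_iff[symmetric] Abs_fps_smul mult_ac)
    also have "\<dots> = sone"
      unfolding Cons sshift_smul[symmetric] by (simp add: smul_sinv_right assms(1) sshift_sone)
    finally show ?case by simp
  qed simp
  from this[of "[0..<p]"] show ?thesis
    using assms(2) by (simp add: sprod_shift_def sone_def[abs_def, symmetric])
qed

lemma two_sided_ideal_mono: "x \<in> two_sided_ideal R \<Longrightarrow> R \<subseteq> S \<Longrightarrow> x \<in> two_sided_ideal S"
  by (induction rule: two_sided_ideal.induct) (auto intro: two_sided_ideal.intros)

lemma flip_dser1: "(\<lambda>n. flip (dser1 n)) = dser1"
  by (simp add: dser1_def tser_def flip_tt par_def fun_eq_iff)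

lemma flip_eser: "(\<lambda>n. flip (eser n)) = (\<lambda>n. - eser n :: 'k::field free)"
proof -
  interpret unital_hom "flip :: 'k free \<Rightarrow> 'k free" by (rule flip_hom)
  show ?thesis
    by (simp add: eser_def smul sinv flip_dser1) (simp add: tser_def flip_tt par_def smul_uminus)
qed

lemma flip_fser: "(\<lambda>n. flip (fser n)) = (\<lambda>n. - fser n :: 'k::field free)"
proof -
  interpret unital_hom "flip :: 'k free \<Rightarrow> 'k free" by (rule flip_hom)
  show ?thesis
    by (simp add: fser_def smul sinv flip_dser1) (simp add: tser_def flip_tt par_def smul_uminus)
qed

lemma flip_dser2: "(\<lambda>n. flip (dser2 n)) = (dser2 :: nat \<Rightarrow> 'k::field free)"
proof -
  interpret unital_hom "flip :: 'k free \<Rightarrow> 'k free" by (rule flip_hom)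
  have "(\<lambda>n. flip (smul (smul fser dser1) eser n)) = (smul (smul fser dser1) eser :: nat \<Rightarrow> 'k free)"
    by (simp add: smul flip_dser1 flip_fser flip_eser smul_uminus)
  from fun_cong[OF this] show ?thesis
    by (simp add: dser2_def minus fun_eq_iff tser_def flip_tt par_def)
qed

text \<open>All relations are homogeneous: the RTT relations acquire a sign, and the b_i are even
  because d_1 and d_2 are.\<close>

lemma flip_restricted:
  assumes "x \<in> two_sided_ideal (restricted_rels p)"
  shows "flip x \<in> two_sided_ideal (restricted_rels p :: 'k::field free set)"
  using assms
proof induction
  case (gen x)
  interpret unital_hom "flip :: 'k free \<Rightarrow> 'k free" by (rule flip_hom)
  have b: "flip (bser1 p n) = (bser1 p n :: 'k free)" "flip (bser2 p n) = (bser2 p n :: 'k free)" for n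
    using fun_cong[OF sprod_shift[of p dser1], of n] fun_cong[OF sprod_shift[of p "sinv dser2"], of n]
    by (simp_all add: bser1_def bser2_def sinv flip_dser1 flip_dser2)
  from gen consider i j k l r s where "x = rtt_rel i j k l r s" | n where "x = bser1 p n" | n where "x = bser2 p n"
    unfolding restricted_rels_def by blast
  then have "\<exists>n. flip x = (-1) ^ n * x * 1"
  proof cases
    case 1
    show ?thesis unfolding 1 flip_rtt_rel by simp blast
  qed (auto simp: b intro!: exI[of _ 0])
  then show ?case
    using two_sided_ideal.mult[OF two_sided_ideal.gen[OF gen]] by metis
qed (auto simp: unital_hom.zero[OF flip_hom] unital_hom.add[OF flip_hom] unital_hom.mult[OF flip_hom] intro: two_sided_ideal.intros)

lift_definition flip_yang :: "'k::field yang \<Rightarrow> 'k yang" is flip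
  using flip_rtt_ideal unital_hom.minus[OF flip_hom] by metis

lemma flip_yang_abs: "flip_yang (abs_yang x) = abs_yang (flip x)"
  by (rule flip_yang.abs_eq)

lemma flip_yang_hom: "unital_hom (flip_yang :: 'k::field yang \<Rightarrow> 'k yang)"
proof -
  interpret F: unital_hom "flip :: 'k free \<Rightarrow> 'k free" by (rule flip_hom)
  interpret A: unital_hom "abs_yang :: 'k free \<Rightarrow> 'k yang" by (rule abs_hom)
  show ?thesis
  proof
    fix x y :: "'k yang"
    obtain x' y' where xy: "x = abs_yang x'" "y = abs_yang y'" using abs_yang_surj by metis
    show "flip_yang (x + y) = flip_yang x + flip_yang y" "flip_yang (x * y) = flip_yang x * flip_yang y"
      unfolding xy by (simp_all add: flip_yang_abs A.add[symmetric] A.mult[symmetric] F.add F.mult)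
    show "flip_yang 1 = (1 :: 'k yang)"
      using flip_yang_abs[of "1 :: 'k free"] by (simp add: A.one F.one)
  qed
qed

locale restricted_weight =
  fixes p :: nat and lam1 lam2 :: "nat \<Rightarrow> 'k::field"
  assumes p_pos: "p > 0" and p_zero: "of_nat p = (0::'k)" and two: "(2::'k) \<noteq> 0"
    and restricted: "restricted_series p lam1" "restricted_series p lam2"
begin

lemma lam_0: "lam1 0 = 1" "lam2 0 = 1"
  using restricted by (simp_all add: restricted_series_def)

lemma lam_restricted: "sprod_shift p lam1 = sone" "sprod_shift p lam2 = sone"
  using restricted by (simp_all add: restricted_series_def sone_def[abs_def])

text \<open>Every element of the Verma ideal annihilates the vacuum of the Fock model, and 1 does
  not.\<close>

lemma one_notin_verma: "1 \<notin> verma_ideal p lam1 lam2"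
proof
  interpret M: fock_model lam1 lam2
    using two lam_0 by unfold_locales
  interpret s: scalar_hom "opscal :: 'k \<Rightarrow> 'k op"
    by standard (rule opscal_simps opscal_central)+
  define ev where "ev = free_eval opscal (\<lambda>g. case g of T i j n \<Rightarrow> M.t i j (Suc n))"
  have hom: "unital_hom ev" unfolding ev_def by (rule s.eval_hom)
  interpret h: unital_hom ev by (rule hom)
  have ev_tt: "ev (tt i j r) = M.t i j r" for i j r
    unfolding ev_def s.eval_tt by (cases r) (simp_all add: M.t_0)
  have "(\<lambda>n. ev (dser1 n)) = M.t I1 I1"
    by (simp add: dser1_def tser_def ev_tt)
  moreover have M_d: "M.t I1 I1 = M.d" by (simp add: M.t_def)
  ultimately have ev_d: "(\<lambda>n. ev (dser1 n)) = M.d" by simp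
  have ev_e: "(\<lambda>n. ev (eser n)) = M.e"
    using M.gauss_e by (simp add: eser_def h.smul h.sinv ev_d M_d) (simp add: tser_def ev_tt)
  have ev_f: "(\<lambda>n. ev (fser n)) = M.f"
    using M.gauss_f by (simp add: fser_def h.smul h.sinv ev_d M_d) (simp add: tser_def ev_tt)
  have "(\<lambda>n. ev (smul (smul fser dser1) eser n)) = smul (smul M.f M.d) M.e"
    by (simp add: h.smul ev_f ev_d ev_e)
  then have ev_d2: "(\<lambda>n. ev (dser2 n)) = smul M.h M.d"
    using M.gauss_d2 by (simp add: dser2_def h.minus fun_eq_iff tser_def ev_tt M_d)
  have d_0: "M.d 0 = 1" "smul M.h M.d 0 = 1"
    by (simp_all add: M.d_0 M.h_0 smul_nth_0)
  have transfer: "sprod_shift p transfer_poly = (sone :: nat \<Rightarrow> 'k poly)" "transfer_poly 0 = (1 :: 'k poly)"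
    using p_zero by (simp_all add: sprod_shift_transfer_poly transfer_poly_def)
  \<comment> \<open>The list entries contribute 1 by telescoping and the vacuum contributes 1
    because \<lambda>_1 is restricted; uniqueness of symbols then gives the identity series.\<close>
  have "has_symbol (sprod_shift p M.d) sone sone"
    using has_symbol_sprod_shift[OF M.d_symbol, of p] by (simp add: transfer lam_restricted)
  then have b1: "sprod_shift p M.d = sone"
    by (rule has_symbol_unique[OF _ has_symbol_sone])
  have "has_symbol (sinv (smul M.h M.d)) (sinv transfer_poly) (sinv lam2)"
    by (intro has_symbol_sinv M.d2_symbol d_0 transfer lam_0)
  from has_symbol_sprod_shift[OF this, of p] have "has_symbol (sprod_shift p (sinv (smul M.h M.d))) sone sone"
    using transfer lam_0 lam_restricted by (simp add: sprod_shift_sinv)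
  then have b2: "sprod_shift p (sinv (smul M.h M.d)) = sone"
    by (rule has_symbol_unique[OF _ has_symbol_sone])
  have rtt: "rtt_family (\<lambda>i j r. ev (tt i j r))"
    unfolding ev_tt by (rule M.t_rtt)
  have "ev x = 0" if "x \<in> restricted_rels p" for x
  proof -
    have "ev (bser1 p n) = sone n" "ev (bser2 p n) = sone n" for n
      using fun_cong[OF h.sprod_shift[of p dser1], of n] fun_cong[OF h.sprod_shift[of p "sinv dser2"], of n]
      by (simp_all add: bser1_def bser2_def h.sinv ev_d ev_d2 b1 b2)
    \<comment> \<open>The index r p is positive, where the series 1 has coefficient 0.\<close>
    then show ?thesis
      using that rtt[unfolded hom_rtt_family_iff[OF hom]] p_pos
      unfolding restricted_rels_def by (auto simp: sone_def)
  qed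
  then have ideal: "ev x = 0" if "x \<in> two_sided_ideal (restricted_rels p)" for x
    using hom_two_sided_ideal[OF hom _ that] by blast
  have zero: "app A 0 = (0 :: 'k fock)" for A
    using app_add[of A 0 0] by simp
  have vac: "app (ev x) vacuum = 0" if "x \<in> verma_ideal p lam1 lam2" for x
    using that unfolding verma_ideal_def
  proof induction
    case (gen x)
    have "ev (scal c) = opscal c" for c
      unfolding ev_def by (rule s.eval_scal)
    then have "app (ev (dser1 r - scal (lam1 r))) vacuum = 0" "app (ev (dser2 r - scal (lam2 r))) vacuum = 0" for r
      using fun_cong[OF ev_d, of r] fun_cong[OF ev_d2, of r]
        M.app_vacuum_symbol[OF M.d_symbol, of r] M.app_vacuum_symbol[OF M.d2_symbol, of r]
      by (simp_all add: h.minus app_simps)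
    moreover have "app (ev (eser r)) vacuum = 0" for r
      using fun_cong[OF ev_e, of r] M.app_vacuum_e by simp
    moreover have "app (0 :: 'k op) vacuum = 0" by (simp add: app_simps)
    ultimately show ?case
      using gen ideal by auto
  qed (auto simp: h.zero h.add h.mult app_simps zero)
  assume "1 \<in> verma_ideal p lam1 lam2"
  from vac[OF this] show False
    by (simp add: h.one app_simps vacuum_nonzero)
qed

abbreviation "verma \<equiv> verma_ideal p lam1 lam2"

lemma verma_closed: "0 \<in> verma" "x \<in> verma \<Longrightarrow> y \<in> verma \<Longrightarrow> x + y \<in> verma" "x \<in> verma \<Longrightarrow> a * x \<in> verma"
  unfolding verma_ideal_def by (auto intro: left_ideal_gen.intros)

lemma rtt_ideal_subset: "x \<in> rtt_ideal \<Longrightarrow> x \<in> verma"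
proof -
  assume "x \<in> rtt_ideal"
  then have "x \<in> two_sided_ideal (restricted_rels p)"
    unfolding rtt_ideal_def by (rule two_sided_ideal_mono) (auto simp: restricted_rels_def)
  then show "x \<in> verma"
    unfolding verma_ideal_def by (intro left_ideal_gen.gen) blast
qed

lemma flip_verma: "x \<in> verma \<Longrightarrow> flip x \<in> verma"
  unfolding verma_ideal_def
proof (induction rule: left_ideal_gen.induct)
  case (gen x)
  interpret unital_hom "flip :: 'k free \<Rightarrow> 'k free" by (rule flip_hom)
  let ?S = "two_sided_ideal (restricted_rels p) \<union> {eser r |r. 0 < r} \<union> {dser1 r - scal (lam1 r) |r. 0 < r}
      \<union> {dser2 r - scal (lam2 r) |r. 0 < r}"
  have "flip (dser1 r - scal (lam1 r)) = dser1 r - scal (lam1 r)" "flip (dser2 r - scal (lam2 r)) = dser2 r - scal (lam2 r)"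
     "flip (eser r) = -1 * eser r" for r
    using fun_cong[OF flip_dser1, of r] fun_cong[OF flip_dser2, of r] fun_cong[OF flip_eser, of r]
    by (simp_all add: minus flip_scal)
  then have "flip x \<in> two_sided_ideal (restricted_rels p) \<or> flip x = x \<or> flip x = -1 * x"
    using gen flip_restricted[of x p] by auto
  then show ?case
    using gen left_ideal_gen.gen[of _ ?S] left_ideal_gen.mult[OF left_ideal_gen.gen[OF gen], of "-1"] by auto
qed (auto simp: unital_hom.zero[OF flip_hom] unital_hom.add[OF flip_hom] unital_hom.mult[OF flip_hom] intro: left_ideal_gen.intros)

sublocale A: unital_hom "abs_yang :: 'k free \<Rightarrow> 'k yang"
  by (rule abs_hom)

sublocale Y: yangian "\<lambda>i j r. abs_yang (tt i j r) :: 'k yang"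
proof
  show "rtt_family (\<lambda>i j r. abs_yang (tt i j r) :: 'k yang)" by (rule yang_rtt_family)
next
  fix x :: "'k yang"
  assume a: "x + x = 0"
  have "1 / 2 + 1 / 2 = (1::'k)" using two by (simp add: field_simps)
  then have "abs_yang (scal (1 / 2)) + abs_yang (scal (1 / 2)) = (1 :: 'k yang)"
    by (metis A.add A.one scal_add scal_1)
  then have "x = (abs_yang (scal (1 / 2)) + abs_yang (scal (1 / 2))) * x" by simp
  also have "\<dots> = abs_yang (scal (1 / 2)) * (x + x)" by (simp add: distrib_left distrib_right)
  finally show "x = 0" using a by simp
qed

lemma abs_d: "abs_yang (dser1 n) = Y.d n"
  by (simp add: Y.d_def dser1_def tser_def)

lemma abs_e: "abs_yang (eser n) = Y.e n"
  by (rule fun_cong[of "\<lambda>n. abs_yang (eser n)"]) (simp add: Y.e_def eser_def A.smul A.sinv abs_d tser_def)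

lemma abs_f: "abs_yang (fser n) = Y.f n"
  by (rule fun_cong[of "\<lambda>n. abs_yang (fser n)"]) (simp add: Y.f_def fser_def A.smul A.sinv abs_d tser_def)

lemma abs_d2: "abs_yang (dser2 n) = Y.d2 n"
proof -
  have "(\<lambda>n. abs_yang (smul (smul fser dser1) eser n)) = smul (smul Y.f Y.d) Y.e"
    by (simp add: A.smul abs_f abs_d abs_e)
  from fun_cong[OF this, of n] show ?thesis
    by (simp add: Y.d2_def dser2_def A.minus tser_def)
qed

text \<open>The Verma ideal contains the RTT ideal, so it is the full preimage of its image in the
  Yangian.\<close>

lemma abs_verma_iff: "abs_yang x \<in> abs_yang ` verma \<longleftrightarrow> x \<in> verma"
proof
  assume "abs_yang x \<in> abs_yang ` verma"
  then obtain y where y: "y \<in> verma" "abs_yang x = abs_yang y" by auto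
  then have "x - y \<in> verma" using rtt_ideal_subset by (simp add: abs_yang_eq_iff)
  from verma_closed(2)[OF this y(1)] show "x \<in> verma" by simp
qed simp

lemma lam_mem: "eser r \<in> verma" "dser1 r - scal (lam1 r) \<in> verma" "dser2 r - scal (lam2 r) \<in> verma"
proof -
  have 0: "eser 0 = (0 :: 'k free)" "dser1 0 = (1 :: 'k free)" "dser2 0 = (1 :: 'k free)" "fser 0 = (0 :: 'k free)"
    by (simp_all add: eser_def dser1_def dser2_def fser_def smul_nth_0 tser_def tt_0)
  have "eser r \<in> verma \<and> dser1 r - scal (lam1 r) \<in> verma \<and> dser2 r - scal (lam2 r) \<in> verma"
  proof (cases "r = 0")
    case True
    then show ?thesis by (simp add: 0 lam_0 scal_1 verma_closed)
  next
    case False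
    then show ?thesis unfolding verma_ideal_def by (intro conjI left_ideal_gen.gen) auto
  qed
  then show "eser r \<in> verma" "dser1 r - scal (lam1 r) \<in> verma" "dser2 r - scal (lam2 r) \<in> verma" by auto
qed

sublocale HW: highest_weight "\<lambda>i j r. abs_yang (tt i j r) :: 'k yang" "\<lambda>c. abs_yang (scal c)" "abs_yang ` verma" lam1 lam2
proof
  show "abs_yang (scal (c + c')) = abs_yang (scal c) + (abs_yang (scal c') :: 'k yang)"
    "abs_yang (scal (c * c')) = abs_yang (scal c) * (abs_yang (scal c') :: 'k yang)" for c c'
    by (simp_all add: scal_add scal_mult A.add A.mult)
  show "abs_yang (scal 1) = (1 :: 'k yang)" by (simp add: scal_1 A.one)
  show "abs_yang (scal c) * x = x * abs_yang (scal c)" for c and x :: "'k yang"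
    using abs_yang_surj[of x] scal_central by (metis A.mult)
  show "0 \<in> abs_yang ` verma"
    using verma_closed(1) by (metis A.zero imageI)
  show "x + y \<in> abs_yang ` verma" if "x \<in> abs_yang ` verma" "y \<in> abs_yang ` verma" for x y
    using that by (auto simp: A.add[symmetric] intro!: imageI verma_closed)
  show "a * x \<in> abs_yang ` verma" if "x \<in> abs_yang ` verma" for a x
    using that abs_yang_surj[of a] by (auto simp: A.mult[symmetric] intro!: imageI verma_closed)
  show "P x" if "\<And>c. P (abs_yang (scal c))" "\<And>x y. P x \<Longrightarrow> P y \<Longrightarrow> P (x + y)"
    "\<And>i j r x. P x \<Longrightarrow> P (abs_yang (tt i j r) * x)" for P and x :: "'k yang"
  proof -
    obtain y where "x = abs_yang y" using abs_yang_surj by blast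
    moreover have "P (abs_yang y)"
      by (rule free_generated[of "\<lambda>y. P (abs_yang y)"]) (auto simp: A.add A.mult intro: that)
    ultimately show ?thesis by simp
  qed
  show "lam1 0 = 1" "lam2 0 = 1" by (rule lam_0)+
  show "Y.e r \<in> abs_yang ` verma" "Y.d r - abs_yang (scal (lam1 r)) \<in> abs_yang ` verma"
    "Y.d2 r - abs_yang (scal (lam2 r)) \<in> abs_yang ` verma" for r
    using lam_mem[of r] by (auto simp: abs_e[symmetric] abs_d[symmetric] abs_d2[symmetric] A.minus[symmetric])
qed

lemma one_notin_abs_verma: "1 \<notin> abs_yang ` verma"
  using one_notin_verma abs_verma_iff[of 1] by (simp add: A.one)

lemma flip_kspan:
  assumes "z \<in> HW.kspan HW.pos_monomials"
  shows "flip_yang z \<in> HW.kspan HW.pos_monomials"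
proof -
  interpret F: unital_hom "flip_yang :: 'k yang \<Rightarrow> 'k yang" by (rule flip_yang_hom)
  have f: "flip_yang (Y.f r) = - Y.f r" for r
  proof -
    have "flip (fser r) = - (fser r :: 'k free)"
      using fun_cong[OF flip_fser, of r] .
    then show ?thesis by (simp add: abs_f[symmetric] flip_yang_abs A.uminus)
  qed
  have fm: "flip_yang (HW.fm rs) = HW.fm rs \<or> flip_yang (HW.fm rs) = - HW.fm rs" for rs
    by (induction rs) (auto simp: F.one F.mult f)
  from assms show ?thesis
  proof induction
    case (scale_base x c)
    then obtain rs where "x = HW.fm rs" by blast
    then have "flip_yang x = x \<or> flip_yang x = - x" using fm[of rs] by simp
    then have "flip_yang x \<in> HW.kspan HW.pos_monomials"
      using HW.kspan_base[OF scale_base] HW.kspan_minus[OF HW.kspan_base[OF scale_base]] by metis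
    then show ?case
      by (simp add: F.mult flip_yang_abs flip_scal HW.kspan_scale)
  qed (auto simp: F.zero F.add intro: HW.kspan.intros)
qed

lemma flip_M0:
  assumes "z \<in> HW.M0"
  shows "flip_yang z \<in> HW.M0"
proof -
  interpret F: unital_hom "flip_yang :: 'k yang \<Rightarrow> 'k yang" by (rule flip_yang_hom)
  obtain y where y: "y \<in> HW.kspan HW.pos_monomials" "z - y \<in> abs_yang ` verma"
    using assms by (auto simp: HW.cosp_def HW.eqK_def)
  then have "flip_yang (z - y) \<in> abs_yang ` verma"
    using flip_verma by (auto simp: flip_yang_abs)
  then show ?thesis
    using flip_kspan[OF y(1)] by (auto simp: HW.cosp_def HW.eqK_def F.minus)
qed

text \<open>\<open>M0\<close> is stable under parity, because each f_r is odd and the Verma ideal is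
  homogeneous. As \<open>flip\<close> is an involution, every multiple of the image is the image of
  a multiple.\<close>

lemma flip_rad:
  assumes "abs_yang x \<in> HW.rad"
  shows "abs_yang (flip x) \<in> HW.rad"
  unfolding HW.rad_def
proof (intro CollectI allI)
  fix a :: "'k yang"
  obtain a' where a: "a = abs_yang a'" using abs_yang_surj by blast
  have "abs_yang (flip a') * abs_yang x \<in> HW.M0"
    using assms by (simp add: HW.rad_def)
  from flip_M0[OF this] show "a * abs_yang (flip x) \<in> HW.M0"
    by (simp add: a A.mult[symmetric] flip_yang_abs unital_hom.mult[OF flip_hom] flip_flip)
qed

lemma rad_closed: "0 \<in> HW.rad" "x \<in> HW.rad \<Longrightarrow> y \<in> HW.rad \<Longrightarrow> x + y \<in> HW.rad" "x \<in> HW.rad \<Longrightarrow> a * x \<in> HW.rad"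
  using HW.rad_left_ideal by (auto simp: is_left_ideal_def)

text \<open>Each ideal in the union maps into \<open>M0\<close> and, being closed under left
  multiplication, into \<open>rad\<close>. Conversely the preimage of \<open>rad\<close> is itself a
  member of the union: it is proper because 1 is not in \<open>M0\<close>, and graded by parity
  stability.\<close>

lemma max_ideal_eq: "max_ideal p lam1 lam2 = {x. abs_yang x \<in> HW.rad}"
proof (intro equalityI subsetI CollectI)
  fix x
  assume "x \<in> max_ideal p lam1 lam2"
  then show "abs_yang x \<in> HW.rad"
    unfolding max_ideal_def
  proof induction
    case (gen x)
    then obtain N where N: "verma \<subseteq> N" "is_left_ideal N" "1 \<notin> N" "x \<in> N" by blast
    have N_add: "a \<in> N \<Longrightarrow> b \<in> N \<Longrightarrow> a + b \<in> N" and N_mult: "a \<in> N \<Longrightarrow> b * a \<in> N" and N_zero: "0 \<in> N" for a b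
      using N(2) by (auto simp: is_left_ideal_def)
    have "a + b \<in> abs_yang ` N" if "a \<in> abs_yang ` N" "b \<in> abs_yang ` N" for a b
      using that by (auto simp: A.add[symmetric] intro!: imageI N_add)
    moreover have mult: "a * b \<in> abs_yang ` N" if "b \<in> abs_yang ` N" for a b
      using that abs_yang_surj[of a] by (auto simp: A.mult[symmetric] intro!: imageI N_mult)
    moreover have "0 \<in> abs_yang ` N" using N_zero by (metis A.zero imageI)
    ultimately have "is_left_ideal (abs_yang ` N)" by (simp add: is_left_ideal_def)
    moreover have "1 \<notin> abs_yang ` N"
    proof
      assume "1 \<in> abs_yang ` N"
      then obtain y where y: "y \<in> N" "abs_yang 1 = abs_yang y" by (auto simp: A.one)
      then have "1 - y \<in> N" using rtt_ideal_subset N(1) by (auto simp: abs_yang_eq_iff)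
      from N_add[OF this y(1)] show False using N(3) by simp
    qed
    ultimately have "abs_yang ` N \<subseteq> HW.M0"
      using N(1) by (intro HW.proper_subset_M0) auto
    then show ?case
      using mult N(4) unfolding HW.rad_def by blast
  qed (simp_all add: A.zero A.add A.mult rad_closed)
next
  fix x
  assume x: "x \<in> {x. abs_yang x \<in> HW.rad}"
  let ?N = "{x. abs_yang x \<in> HW.rad}"
  have "verma \<subseteq> ?N" using HW.K_subset_rad by auto
  moreover have "is_left_ideal ?N"
    by (simp add: is_left_ideal_def A.zero A.add A.mult rad_closed)
  moreover have "1 \<notin> ?N"
    using HW.rad_subset HW.one_notin_M0[OF one_notin_abs_verma] by (auto simp: A.one)
  moreover have "graded ?N"
    unfolding graded_def even_part_def[symmetric]
  proof (intro ballI CollectI)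
    fix y
    assume "y \<in> ?N"
    then have "abs_yang y + abs_yang (flip y) \<in> HW.rad"
      by (intro rad_closed flip_rad) auto
    then have 1: "abs_yang (scal (1 / 2) * (even_part y + even_part y)) \<in> HW.rad"
      by (simp add: even_part_flip A.add A.mult rad_closed)
    have "1 / 2 + 1 / 2 = (1::'k)" using two by (simp add: field_simps)
    then have half: "scal (1 / 2) + scal (1 / 2) = (1 :: 'k free)" by (metis scal_add scal_1)
    have "scal (1 / 2) * (even_part y + even_part y) = (scal (1 / 2) + scal (1 / 2)) * even_part y"
      by (simp add: distrib_left distrib_right)
    then show "abs_yang (even_part y) \<in> HW.rad" using 1 by (simp add: half)
  qed
  ultimately show "x \<in> max_ideal p lam1 lam2"
    unfolding max_ideal_def using x by (intro left_ideal_gen.gen) blast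
qed

lemma simple_fin_dim_if:
  fixes c :: "nat \<Rightarrow> 'k" and n :: nat
  assumes rec: "\<And>m. m > 0 \<Longrightarrow> (\<Sum>j\<le>n. c j * HW.hlam (m + j)) = 0" and c: "c n = 1"
  shows "simple_fin_dim p lam1 lam2"
proof -
  obtain B where B: "finite B" "\<And>x. \<exists>a. x - (\<Sum>b\<in>B. abs_yang (scal (a b)) * b) \<in> HW.rad"
    using HW.rad_finite_codim[OF rec c] by blast
  \<comment> \<open>A section of the projection lifts the spanning set back to the free
    algebra.\<close>
  obtain g where g: "\<And>b :: 'k yang. b = abs_yang (g b)"
    using abs_yang_surj by metis
  have inj: "inj_on g B" by (metis g inj_onI)
  have "\<exists>c. x - (\<Sum>b\<in>g ` B. scal (c b) * b) \<in> max_ideal p lam1 lam2" for x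
  proof -
    obtain a where a: "abs_yang x - (\<Sum>b\<in>B. abs_yang (scal (a b)) * b) \<in> HW.rad"
      using B(2) by blast
    have "abs_yang (x - (\<Sum>b\<in>g ` B. scal (a (abs_yang b)) * b)) = abs_yang x - (\<Sum>b\<in>B. abs_yang (scal (a b)) * b)"
      by (simp add: A.minus A.sum A.mult sum.reindex[OF inj] g[symmetric])
    then show ?thesis
      unfolding max_ideal_eq using a by (intro exI[of _ "\<lambda>b. a (abs_yang b)"]) simp
  qed
  then show ?thesis
    unfolding simple_fin_dim_def using B(1) by (intro exI[of _ "g ` B"]) auto
qed

end

text \<open>Infinitely many vectors with finitely many coordinates are dependent. Two relations for
  the old coordinates, on disjoint blocks of indices, are combined crosswise so that the new
  coordinate cancels.\<close>

lemma finite_coordinates_dependence: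
  fixes a :: "nat \<Rightarrow> 'b \<Rightarrow> 'k::field"
  assumes "finite B"
  shows "\<exists>m c. (\<exists>r\<in>{1..m}. c r \<noteq> 0) \<and> (\<forall>b\<in>B. (\<Sum>r=1..m. c r * a r b) = 0)"
  using assms
proof (induction B arbitrary: a)
  case empty
  show ?case by (rule exI[of _ 1], rule exI[of _ "\<lambda>_. 1"]) auto
next
  case (insert b B)
  obtain m c where c: "\<exists>r\<in>{1..m}. c r \<noteq> 0" "\<forall>b\<in>B. (\<Sum>r=1..m. c r * a r b) = 0"
    using insert.IH by blast
  obtain m' c' where c': "\<exists>r\<in>{1..m'}. c' r \<noteq> 0" "\<forall>b\<in>B. (\<Sum>r=1..m'. c' r * a (m + r) b) = 0"
    using insert.IH[of "\<lambda>r. a (m + r)"] by blast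
  define v where "v = (\<Sum>r=1..m. c r * a r b)"
  define v' where "v' = (\<Sum>r=1..m'. c' r * a (m + r) b)"
  show ?case
  proof (cases "v = 0")
    case True
    then show ?thesis using c by (intro exI[of _ m] exI[of _ c]) (auto simp: v_def)
  next
    case False
    define k where "k r = (if r \<le> m then v' * c r else - v * c' (r - m))" for r
    have split: "(\<Sum>r=1..m + m'. k r * a r x) = v' * (\<Sum>r=1..m. c r * a r x) - v * (\<Sum>r=1..m'. c' r * a (m + r) x)" for x
    proof -
      have "(\<Sum>r=1..m + m'. k r * a r x) = (\<Sum>r=1..m. k r * a r x) + (\<Sum>r=m+1..m + m'. k r * a r x)"
        using sum.ub_add_nat[of 1 m "\<lambda>r. k r * a r x" m'] by simp
      also have "(\<Sum>r=m+1..m + m'. k r * a r x) = (\<Sum>r=1..m'. k (m + r) * a (m + r) x)"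
        using sum.shift_bounds_cl_nat_ivl[of "\<lambda>r. k r * a r x" 1 m m'] by (simp add: add.commute)
      finally show ?thesis
        by (simp add: k_def sum_distrib_left mult.assoc sum_negf)
    qed
    obtain r where "r \<in> {1..m'}" "c' r \<noteq> 0" using c'(1) by blast
    then have "m + r \<in> {1..m + m'}" "k (m + r) \<noteq> 0" using False by (auto simp: k_def)
    moreover have "(\<Sum>r=1..m + m'. k r * a r b) = 0"
      unfolding split v_def[symmetric] v'_def[symmetric] by (simp add: mult.commute)
    moreover have "\<forall>x\<in>B. (\<Sum>r=1..m + m'. k r * a r x) = 0"
      unfolding split using c(2) c'(2) by simp
    ultimately show ?thesis by blast
  qed
qed

context restricted_weight
begin

text \<open>The classes of f_1, f_2, ... in a finite dimensional quotient are dependent; such a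
  dependence is an element of \<open>rad\<close>, which \<open>rad_dependence\<close> reads as a
  recurrence.\<close>

lemma simple_fin_dim_only_if:
  assumes "simple_fin_dim p lam1 lam2"
  shows "\<exists>m c. (\<exists>r\<in>{1..m}. c r \<noteq> 0) \<and> (\<forall>s>0. (\<Sum>r=1..m. c r * HW.hlam (r + s - 1)) = 0)"
proof -
  obtain B where B: "finite B" "\<And>x. \<exists>c. x - (\<Sum>b\<in>B. scal (c b) * b) \<in> max_ideal p lam1 lam2"
    using assms unfolding simple_fin_dim_def by blast
  obtain a where a: "\<And>r. fser r - (\<Sum>b\<in>B. scal (a r b) * b) \<in> max_ideal p lam1 lam2"
    using B(2)[of "fser r" for r] by metis
  obtain m c where c: "\<exists>r\<in>{1..m}. c r \<noteq> 0" "\<forall>b\<in>B. (\<Sum>r=1..m. c r * a r b) = 0"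
    using finite_coordinates_dependence[OF B(1), of a] by blast
  have "(\<Sum>r=1..m. scal (c r) * (fser r - (\<Sum>b\<in>B. scal (a r b) * b)))
    = (\<Sum>r=1..m. scal (c r) * fser r) - (\<Sum>b\<in>B. scal (\<Sum>r=1..m. c r * a r b) * b)"
  proof -
    have scal_sum: "scal (sum g I) = (\<Sum>i\<in>I. scal (g i))" for g :: "nat \<Rightarrow> 'k" and I
      by (induction I rule: infinite_finite_induct) (auto simp: scal_0 scal_add)
    have "(\<Sum>r=1..m. scal (c r) * (\<Sum>b\<in>B. scal (a r b) * b)) = (\<Sum>b\<in>B. \<Sum>r=1..m. scal (c r * a r b) * b)"
      by (subst sum.swap) (simp add: sum_distrib_left scal_mult mult.assoc)
    then show ?thesis
      by (simp add: right_diff_distrib sum_subtractf scal_sum sum_distrib_right)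
  qed
  also have "\<dots> = (\<Sum>r=1..m. scal (c r) * fser r)"
    using c(2) by (simp add: scal_0)
  finally have eq: "(\<Sum>r=1..m. scal (c r) * (fser r - (\<Sum>b\<in>B. scal (a r b) * b))) = (\<Sum>r=1..m. scal (c r) * fser r)" .
  have sum_rad: "sum g I \<in> HW.rad" if "\<And>i. i \<in> I \<Longrightarrow> g i \<in> HW.rad" for g and I :: "nat set"
    using that by (induction I rule: infinite_finite_induct) (auto intro: rad_closed)
  have "abs_yang (\<Sum>r=1..m. scal (c r) * (fser r - (\<Sum>b\<in>B. scal (a r b) * b))) \<in> HW.rad"
    unfolding A.sum A.mult using a unfolding max_ideal_eq by (intro sum_rad rad_closed) auto
  then have "(\<Sum>r=1..m. abs_yang (scal (c r)) * Y.f r) \<in> HW.rad"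
    unfolding eq A.sum A.mult abs_f .
  then show ?thesis
    using HW.rad_dependence[OF one_notin_abs_verma, of c m] c(1) by blast
qed

end

section \<open>Rational series\<close>

lemma poly_ser_conv: "poly_ser P = coeff (reflect_poly P)"
  by (rule ext) (simp add: poly_ser_def coeff_reflect_poly)

lemma poly_ser_mult: "poly_ser (P * Q) = smul (poly_ser P) (poly_ser Q)"
  by (rule ext) (simp add: poly_ser_conv reflect_poly_mult coeff_mult smul_def)

lemma poly_ser_0: "poly_ser P 0 = lead_coeff P"
  by (simp add: poly_ser_def)

lemma smul_comm: "smul A B = smul B (A :: nat \<Rightarrow> 'a::comm_ring_1)"
  by (rule smul_commute) (rule mult.commute)

lemma smul_cancel_left:
  fixes A B C :: "nat \<Rightarrow> 'a::comm_ring_1"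
  assumes "A 0 = 1" "smul A B = smul A C"
  shows "B = C"
  using arg_cong[OF assms(2), of "smul (sinv A)"]
  by (simp add: smul_assoc[symmetric] smul_sinv_left assms(1))

text \<open>The cleared form on the right is the one accessible to recurrences: multiplying
  \<lambda>_2/\<lambda>_1 by one polynomial gives the other.\<close>

lemma ratio_iff:
  fixes l1 l2 P Q :: "nat \<Rightarrow> 'a::comm_ring_1"
  assumes 0: "l1 0 = 1" "l2 0 = 1" "P 0 = 1" "Q 0 = 1"
  shows "smul l1 (sinv l2) = smul P (sinv Q) \<longleftrightarrow> smul P (smul (sinv l1) l2) = Q"
proof -
  have cross: "smul l1 (sinv l2) = smul P (sinv Q) \<longleftrightarrow> smul l1 Q = smul P l2"
  proof
    assume "smul l1 (sinv l2) = smul P (sinv Q)"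
    then have "smul (smul l1 (sinv l2)) (smul l2 Q) = smul (smul P (sinv Q)) (smul Q l2)"
      by (simp only: smul_comm[of l2 Q])
    moreover have "smul (smul l1 (sinv l2)) (smul l2 Q) = smul l1 (smul (smul (sinv l2) l2) Q)"
      "smul (smul P (sinv Q)) (smul Q l2) = smul P (smul (smul (sinv Q) Q) l2)"
      by (simp_all only: smul_assoc)
    ultimately show "smul l1 Q = smul P l2"
      by (simp add: smul_sinv_left[of l2, OF 0(2)] smul_sinv_left[of Q, OF 0(4)])
  next
    assume "smul l1 Q = smul P l2"
    then have "smul (smul l1 Q) (smul (sinv Q) (sinv l2)) = smul (smul P l2) (smul (sinv l2) (sinv Q))"
      by (simp only: smul_comm[of "sinv Q" "sinv l2"])
    moreover have "smul (smul l1 Q) (smul (sinv Q) (sinv l2)) = smul l1 (smul (smul Q (sinv Q)) (sinv l2))"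
      "smul (smul P l2) (smul (sinv l2) (sinv Q)) = smul P (smul (smul l2 (sinv l2)) (sinv Q))"
      by (simp_all only: smul_assoc)
    ultimately show "smul l1 (sinv l2) = smul P (sinv Q)"
      by (simp add: smul_sinv_right[of l2, OF 0(2)] smul_sinv_right[of Q, OF 0(4)])
  qed
  have "smul P (smul (sinv l1) l2) = Q \<longleftrightarrow> smul l1 (smul P (smul (sinv l1) l2)) = smul l1 Q"
    using smul_cancel_left[of l1, OF 0(1)] by metis
  moreover have "smul l1 (smul P (smul (sinv l1) l2)) = smul P (smul (smul l1 (sinv l1)) l2)"
    by (simp add: Abs_fps_inject_iff[symmetric] Abs_fps_smul mult_ac)
  ultimately show ?thesis
    unfolding cross by (auto simp: smul_sinv_right[of l1, OF 0(1)])
qed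

text \<open>From index \<open>degree P\<close> on, all coefficients of P contribute, and the sum is
  the left side of a recurrence.\<close>

lemma poly_ser_smul_nth:
  assumes "m \<ge> degree P"
  shows "smul (poly_ser P) H m = (\<Sum>j\<le>degree P. coeff P j * H (m - degree P + j))"
proof -
  have "smul (poly_ser P) H m = (\<Sum>i\<le>degree P. poly_ser P i * H (m - i))"
    unfolding smul_def
    by (rule sum.mono_neutral_right) (use assms in \<open>auto simp: poly_ser_def\<close>)
  also have "\<dots> = (\<Sum>j\<le>degree P. poly_ser P (degree P - j) * H (m - (degree P - j)))"
    by (subst sum.atLeastAtMost_rev[of _ 0, unfolded atLeast0AtMost]) (auto intro!: sum.cong)
  also have "\<dots> = (\<Sum>j\<le>degree P. coeff P j * H (m - degree P + j))"
    using assms by (intro sum.cong refl) (auto simp: poly_ser_def)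
  finally show ?thesis .
qed

text \<open>The recurrence coefficients form a polynomial with c_r at u^{r-1}, scaled to the monic
  P. The recurrence says that P(u) H(u) has no negative powers of u, so it is a polynomial Q;
  \<open>H 0 = 1\<close> makes Q monic of the same degree.\<close>

lemma recurrence_imp_ratio:
  fixes H :: "nat \<Rightarrow> 'k::field"
  assumes "\<exists>r\<in>{1..m}. c r \<noteq> 0" "\<And>s. s > 0 \<Longrightarrow> (\<Sum>r=1..m. c r * H (r + s - 1)) = 0" "H 0 = 1"
  shows "\<exists>P Q. lead_coeff P = 1 \<and> lead_coeff Q = 1 \<and> degree P = degree Q \<and> smul (poly_ser P) H = poly_ser Q"
proof -
  define C where "C = (\<Sum>r=1..m. monom (c r) (r - 1))"
  have coeff_C: "coeff C j = (if j < m then c (Suc j) else 0)" for j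
  proof -
    have "coeff C j = (\<Sum>r=1..m. if r = Suc j then c (Suc j) else 0)"
      unfolding C_def coeff_sum by (intro sum.cong refl) auto
    then show ?thesis by auto
  qed
  obtain r where "r \<in> {1..m}" "c r \<noteq> 0" using assms(1) by blast
  then have "coeff C (r - 1) \<noteq> 0" by (auto simp: coeff_C)
  then have C: "C \<noteq> 0" by auto
  define P where "P = smult (inverse (lead_coeff C)) C"
  have deg: "degree P = degree C" using C by (simp add: P_def)
  have lead: "lead_coeff P = 1" using C by (simp add: P_def)
  have rec: "(\<Sum>j\<le>degree C. coeff C j * H (s + j)) = 0" if "s > 0" for s
  proof -
    have "degree C < m"
      using C coeff_C[of "degree C"] by (metis leading_coeff_0_iff)
    then have "(\<Sum>j\<le>degree C. coeff C j * H (s + j)) = (\<Sum>j<m. coeff C j * H (s + j))"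
      by (intro sum.mono_neutral_left) (auto simp: coeff_eq_0)
    also have "\<dots> = (\<Sum>r=1..m. c r * H (r + s - 1))"
      by (rule sum.reindex_bij_witness[of _ "\<lambda>r. r - 1" Suc]) (auto simp: coeff_C add.commute)
    finally show ?thesis using assms(2)[OF that] by simp
  qed
  define n where "n = degree C"
  define S where "S = smul (poly_ser P) H"
  have S0: "S 0 = 1" using lead assms(3) by (simp add: S_def smul_nth_0 poly_ser_0)
  have Sn: "S m = 0" if "m > n" for m
  proof -
    have "S m = (\<Sum>j\<le>degree C. inverse (lead_coeff C) * (coeff C j * H (m - degree C + j)))"
      unfolding S_def using that by (subst poly_ser_smul_nth) (auto simp: deg n_def P_def mult.assoc)
    also have "\<dots> = 0"
      using rec[of "m - degree C"] that by (simp add: sum_distrib_left[symmetric] n_def)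
    finally show ?thesis .
  qed
  \<comment> \<open>\<open>S\<close> carries the normalising factor u^{-n}, so the coefficient of
    u^i in Q sits at index n - i.\<close>
  define Q where "Q = (\<Sum>i\<le>n. monom (S (n - i)) i)"
  have coeff_Q: "coeff Q j = (if j \<le> n then S (n - j) else 0)" for j
  proof -
    have "coeff Q j = (\<Sum>i\<le>n. if i = j then S (n - j) else 0)"
      unfolding Q_def coeff_sum by (intro sum.cong refl) auto
    then show ?thesis by auto
  qed
  have degQ: "degree Q = n"
    by (rule antisym) (auto intro!: degree_le le_degree simp: coeff_Q S0)
  have "poly_ser Q = S"
    by (rule ext) (auto simp: poly_ser_def degQ coeff_Q Sn)
  then have "smul (poly_ser P) H = poly_ser Q" by (simp only: S_def)
  moreover have "lead_coeff Q = 1" by (simp add: degQ coeff_Q S0)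
  moreover have "degree P = degree Q" by (simp only: deg degQ n_def)
  ultimately show ?thesis
    using lead by (intro exI[of _ P] exI[of _ Q] conjI)
qed

text \<open>Descent on the degree: a common linear factor cancels from both polynomials and leaves
  them monic, of equal degree and with the same ratio.\<close>

lemma ratio_coprime:
  fixes H :: "nat \<Rightarrow> 'k::field"
  assumes "\<exists>P Q. lead_coeff P = 1 \<and> lead_coeff Q = 1 \<and> degree P = degree Q \<and> smul (poly_ser P) H = poly_ser Q"
  shows "\<exists>P Q. lead_coeff P = 1 \<and> lead_coeff Q = 1 \<and> degree P = degree Q \<and> smul (poly_ser P) H = poly_ser Q
     \<and> \<not> (\<exists>x. poly P x = 0 \<and> poly Q x = 0)"
proof -
  define good where "good P Q \<longleftrightarrow> lead_coeff P = 1 \<and> lead_coeff Q = 1 \<and> degree P = degree Q \<and> smul (poly_ser P) H = poly_ser Q"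
    for P Q
  obtain P Q where "good P Q" using assms unfolding good_def by blast
  then show ?thesis
  proof (induction "degree P" arbitrary: P Q rule: less_induct)
    case less
    show ?case
    proof (cases "\<exists>x. poly P x = 0 \<and> poly Q x = 0")
      case False
      then show ?thesis using less.prems unfolding good_def by blast
    next
      case True
      then obtain x where "poly P x = 0" "poly Q x = 0" by blast
      then have "[:- x, 1:] dvd P" "[:- x, 1:] dvd Q" by (simp_all only: poly_eq_0_iff_dvd)
      then obtain P' Q' where PQ: "P = [:- x, 1:] * P'" "Q = [:- x, 1:] * Q'"
        unfolding dvd_def by blast
      have prems: "lead_coeff P = 1" "lead_coeff Q = 1" "degree P = degree Q" "smul (poly_ser P) H = poly_ser Q"
        using less.prems unfolding good_def by blast+
      have lead: "lead_coeff P' = 1" "lead_coeff Q' = 1"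
        using prems(1,2) unfolding PQ lead_coeff_mult by simp_all
      then have nz: "P' \<noteq> 0" "Q' \<noteq> 0" by auto
      have "degree P = degree [:- x, 1:] + degree P'" "degree Q = degree [:- x, 1:] + degree Q'"
        unfolding PQ by (rule degree_mult_eq; use nz in simp)+
      then have deg: "degree P = Suc (degree P')" "degree Q = Suc (degree Q')" by simp_all
      have "smul (poly_ser [:- x, 1:]) (smul (poly_ser P') H) = smul (poly_ser [:- x, 1:]) (poly_ser Q')"
        using prems(4) unfolding PQ poly_ser_mult smul_assoc .
      then have "smul (poly_ser P') H = poly_ser Q'"
        by (rule smul_cancel_left[rotated]) (simp add: poly_ser_0)
      moreover have "degree P' = degree Q'"
        using prems(3) deg by linarith
      ultimately have "good P' Q'"
        using lead unfolding good_def by blast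
      then show ?thesis by (rule less.hyps[rotated]) (simp only: deg(1) lessI)
    qed
  qed
qed

theorem theorem3p9:
  fixes p :: nat and lam1 lam2 :: "nat \<Rightarrow> 'k::field"
  assumes "prime p" and "p > 2" and "CHAR('k) = p"
    and "\<forall>q :: 'k poly. degree q > 0 \<longrightarrow> (\<exists>x. poly q x = 0)"
    and "restricted_series p lam1" and "restricted_series p lam2"
  shows "simple_fin_dim p lam1 lam2 \<longleftrightarrow>
    (\<exists>P1 P2 :: 'k poly. lead_coeff P1 = 1 \<and> lead_coeff P2 = 1 \<and> degree P1 = degree P2
       \<and> \<not> (\<exists>x. poly P1 x = 0 \<and> poly P2 x = 0)
       \<and> smul lam1 (sinv lam2) = smul (poly_ser P1) (sinv (poly_ser P2)))"
proof -
  have two: "(2::'k) \<noteq> 0"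
  proof
    assume "(2::'k) = 0"
    then have "of_nat 2 = (0::'k)" by simp
    then have "p dvd 2" unfolding of_nat_eq_0_iff_char_dvd assms(3) .
    then show False using assms(2) by (auto dest: dvd_imp_le)
  qed
  have "of_nat p = (0::'k)"
    unfolding of_nat_eq_0_iff_char_dvd assms(3) by simp
  then interpret restricted_weight p lam1 lam2
    using two assms(2,5,6) by unfold_locales auto
  have ratio: "smul lam1 (sinv lam2) = smul (poly_ser P1) (sinv (poly_ser P2))
      \<longleftrightarrow> smul (poly_ser P1) HW.hlam = poly_ser P2" if "lead_coeff P1 = 1" "lead_coeff P2 = 1" for P1 P2
    unfolding HW.hlam_def using that by (intro ratio_iff lam_0) (simp_all add: poly_ser_0)
  have hlam_0: "HW.hlam 0 = 1"
    by (simp add: HW.hlam_def smul_nth_0 lam_0)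
  show ?thesis
  proof
    assume "simple_fin_dim p lam1 lam2"
    then obtain m c where "\<exists>r\<in>{1..m}. c r \<noteq> 0" "\<forall>s>0. (\<Sum>r=1..m. c r * HW.hlam (r + s - 1)) = 0"
      using simple_fin_dim_only_if by blast
    then have "\<exists>P Q. lead_coeff P = 1 \<and> lead_coeff Q = 1 \<and> degree P = degree Q \<and> smul (poly_ser P) HW.hlam = poly_ser Q"
      by (intro recurrence_imp_ratio hlam_0) auto
    then show "\<exists>P1 P2 :: 'k poly. lead_coeff P1 = 1 \<and> lead_coeff P2 = 1 \<and> degree P1 = degree P2
       \<and> \<not> (\<exists>x. poly P1 x = 0 \<and> poly P2 x = 0)
       \<and> smul lam1 (sinv lam2) = smul (poly_ser P1) (sinv (poly_ser P2))"
      using ratio_coprime[of HW.hlam] ratio by metis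
  next
    assume "\<exists>P1 P2 :: 'k poly. lead_coeff P1 = 1 \<and> lead_coeff P2 = 1 \<and> degree P1 = degree P2
       \<and> \<not> (\<exists>x. poly P1 x = 0 \<and> poly P2 x = 0)
       \<and> smul lam1 (sinv lam2) = smul (poly_ser P1) (sinv (poly_ser P2))"
    then obtain P1 P2 where P: "lead_coeff P1 = 1" "lead_coeff P2 = 1" "degree P1 = degree P2"
      "smul (poly_ser P1) HW.hlam = poly_ser P2"
      using ratio by blast
    \<comment> \<open>The series of \<open>P2\<close> ends at index \<open>degree P2\<close>, which
      equals \<open>degree P1\<close>; its vanishing beyond is the recurrence, with leading
      coefficient 1 as \<open>P1\<close> is monic.\<close>
    have "(\<Sum>j\<le>degree P1. coeff P1 j * HW.hlam (m + j)) = 0" if "m > 0" for m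
      using poly_ser_smul_nth[of P1 "m + degree P1" HW.hlam] that P(3)
      unfolding P(4) by (simp add: poly_ser_def)
    then show "simple_fin_dim p lam1 lam2"
      using P(1) by (rule simple_fin_dim_if)
  qed
qed

end
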